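(* For any real Schläfli six $\mathcal{L}=\{L_1,\dots,L_6\}$, all six subconfigurations $\mathcal{L}\smallsetminus\{L_i\}$, $i=1,\dots,6$, of five skew lines in $\mathbb{RP}^3$ are coarse deformation equivalent to each other.
   Context: A real Schläfli six is a set of six real, pairwise skew lines in $\mathbb{P}^3$ that all lie on some non-singular cubic surface $X\subset\mathbb{P}^3$; it is regarded as a configuration of six pairwise disjoint lines in $\mathbb{RP}^3$. $\mathcal{C}_n$ denotes the space of configurations (unordered sets) of $n$ pairwise disjoint lines in $\mathbb{RP}^3$. A mirror partner of a configuration is its image under an orientation-reversing projective transformation of $\mathbb{RP}^3$. Two configurations in $\mathcal{C}_n$ are coarse deformation equivalent if one of them can be connected by a continuous path in $\mathcal{C}_n$ with the other or with a mirror partner of the other. *)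

theory Defs
  imports "HOL-Analysis.Analysis"
begin

section \<open>Lines in real projective 3-space\<close>

text \<open>
  Points of \<open>\<real>P\<^sup>3\<close> are the one-dimensional subspaces of \<open>\<real>\<^sup>4\<close>; a line of \<open>\<real>P\<^sup>3\<close> is given by the
  two-dimensional subspace of \<open>\<real>\<^sup>4\<close> formed by its points. Two lines are disjoint in \<open>\<real>P\<^sup>3\<close> iff
  the corresponding subspaces meet only in \<open>0\<close>.
\<close>

definition proj_line :: "(real ^ 4) set \<Rightarrow> bool" where
  "proj_line L \<longleftrightarrow> subspace L \<and> dim L = 2"

definition skew :: "(real ^ 4) set \<Rightarrow> (real ^ 4) set \<Rightarrow> bool" where
  "skew L M \<longleftrightarrow> L \<inter> M = {0}"

definition configurations :: "nat \<Rightarrow> (real ^ 4) set set set" where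
  "configurations n = {A. finite A \<and> card A = n \<and> (\<forall>L\<in>A. proj_line L) \<and> pairwise skew A}"


section \<open>The space of configurations\<close>

definition quotient_topology :: "'a topology \<Rightarrow> ('a \<Rightarrow> 'b) \<Rightarrow> 'b topology" where
  "quotient_topology X f =
     topology (\<lambda>U. U \<subseteq> f ` topspace X \<and> openin X {x \<in> topspace X. f x \<in> U})"

lemma openin_quotient_topology:
  "openin (quotient_topology X f) U \<longleftrightarrow>
     U \<subseteq> f ` topspace X \<and> openin X {x \<in> topspace X. f x \<in> U}"
proof -
  have "istopology (\<lambda>U. U \<subseteq> f ` topspace X \<and> openin X {x \<in> topspace X. f x \<in> U})"
    unfolding istopology_def
  proof (intro conjI allI impI)
    fix S T
    assume S: "S \<subseteq> f ` topspace X \<and> openin X {x \<in> topspace X. f x \<in> S}"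
      and T: "T \<subseteq> f ` topspace X \<and> openin X {x \<in> topspace X. f x \<in> T}"
    have "{x \<in> topspace X. f x \<in> S \<inter> T} =
        {x \<in> topspace X. f x \<in> S} \<inter> {x \<in> topspace X. f x \<in> T}" by auto
    then show "openin X {x \<in> topspace X. f x \<in> S \<inter> T}" using S T by auto
    show "S \<inter> T \<subseteq> f ` topspace X" using S by auto
  next
    fix K
    assume K: "\<forall>S\<in>K. S \<subseteq> f ` topspace X \<and> openin X {x \<in> topspace X. f x \<in> S}"
    have "{x \<in> topspace X. f x \<in> \<Union>K} = (\<Union>S\<in>K. {x \<in> topspace X. f x \<in> S})" by auto
    then show "openin X {x \<in> topspace X. f x \<in> \<Union>K}" using K by auto
    show "\<Union>K \<subseteq> f ` topspace X" using K by blast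
  qed
  then show ?thesis unfolding quotient_topology_def by (simp add: topology_inverse')
qed

lemma topspace_quotient_topology [simp]: "topspace (quotient_topology X f) = f ` topspace X"
proof (rule antisym)
  show "topspace (quotient_topology X f) \<subseteq> f ` topspace X"
    using openin_topspace[of "quotient_topology X f"] unfolding openin_quotient_topology
    by (rule conjunct1)
  have "{x \<in> topspace X. f x \<in> f ` topspace X} = topspace X" by auto
  then have "openin (quotient_topology X f) (f ` topspace X)"
    by (simp add: openin_quotient_topology)
  then show "f ` topspace X \<subseteq> topspace (quotient_topology X f)" by (rule openin_subset)
qed

lemma quotient_map_quotient_topology: "quotient_map X (quotient_topology X f) f"
  unfolding quotient_map_def openin_quotient_topology topspace_quotient_topology by simp

text \<open>
  The Grassmannian of lines of \<open>\<real>P\<^sup>3\<close>, topologised as a quotient of the space of 2-frames of \<open>\<real>\<^sup>4\<close>.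
\<close>

definition frames :: "((real ^ 4) \<times> (real ^ 4)) set" where
  "frames = {(u, v). u \<noteq> v \<and> independent {u, v}}"

definition line_space :: "(real ^ 4) set topology" where
  "line_space = quotient_topology (top_of_set frames) (\<lambda>(u, v). span {u, v})"

lemma proj_line_span_frame: "(u, v) \<in> frames \<Longrightarrow> proj_line (span {u, v})"
proof -
  assume "(u, v) \<in> frames"
  then have uv: "u \<noteq> v" "independent {u, v}"
    unfolding frames_def mem_Collect_eq prod.case by (rule conjunct1, rule conjunct2)
  have "dim (span {u, v}) = card {u, v}"
    unfolding dim_span by (rule dim_eq_card_independent[OF uv(2)])
  also have "card {u, v} = 2" by (rule card_2_iff[THEN iffD2]) (use uv(1) in blast)
  finally show "proj_line (span {u, v})"
    unfolding proj_line_def by (intro conjI subspace_span)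
qed

lemma proj_line_imp_frame:
  assumes "proj_line L"
  shows "\<exists>u v. (u, v) \<in> frames \<and> L = span {u, v}"
proof -
  from assms have L: "subspace L" "dim L = 2" by (auto simp: proj_line_def)
  obtain B where B: "B \<subseteq> L" "independent B" "L \<subseteq> span B" "card B = dim L"
    by (rule basis_exists)
  have "card B = 2" using B L by simp
  then obtain u v where uv: "B = {u, v}" "u \<noteq> v"
    by (auto simp only: card_2_iff)
  have "span B = L" using B L(1) by (intro antisym span_minimal)
  then have "L = span {u, v}" "(u, v) \<in> frames"
    using uv B(2) by (auto simp only: frames_def mem_Collect_eq prod.case)
  then show ?thesis by blast
qed

lemma topspace_line_space: "topspace line_space = {L. proj_line L}"
proof -
  have "(\<lambda>(u, v). span {u, v}) ` frames = {L. proj_line L}"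
    (is "?f ` _ = _")
  proof (intro antisym subsetI)
    fix L assume "L \<in> ?f ` frames"
    then obtain u v where "(u, v) \<in> frames" "L = span {u, v}"
      by (elim imageE) (simp only: split_paired_all prod.case)
    then show "L \<in> {L. proj_line L}" using proj_line_span_frame by (simp only: mem_Collect_eq)
  next
    fix L assume "L \<in> {L. proj_line L}"
    then obtain u v where "(u, v) \<in> frames" "L = ?f (u, v)"
      using proj_line_imp_frame by (simp only: mem_Collect_eq prod.case) blast
    then show "L \<in> ?f ` frames" by (intro image_eqI)
  qed
  then show ?thesis
    by (simp only: line_space_def topspace_quotient_topology topspace_euclidean_subtopology)
qed

lemma not_skew_refl: "proj_line L \<Longrightarrow> \<not> skew L L"
proof
  assume L: "proj_line L" and "skew L L"
  then have "L = {0}" by (simp only: skew_def Int_absorb)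
  then show False using L unfolding proj_line_def by (simp only: dim_singleton) simp
qed

text \<open>
  Unordered configurations carry the quotient topology from ordered ones, which form a subspace of
  the \<open>n\<close>-th power of the space of lines (functions on \<open>{..<n}\<close>, \<^const>\<open>undefined\<close> elsewhere).
\<close>

definition ordered_config_space :: "nat \<Rightarrow> (nat \<Rightarrow> (real ^ 4) set) topology" where
  "ordered_config_space n =
     subtopology (product_topology (\<lambda>_. line_space) {..<n})
       {l. \<forall>i<n. \<forall>j<n. i \<noteq> j \<longrightarrow> skew (l i) (l j)}"

definition config_space :: "nat \<Rightarrow> (real ^ 4) set set topology" where
  "config_space n = quotient_topology (ordered_config_space n) (\<lambda>l. l ` {..<n})"

lemma topspace_config_space: "topspace (config_space n) = configurations n"
proof (rule antisym)
  show "topspace (config_space n) \<subseteq> configurations n"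
  proof
    fix A assume "A \<in> topspace (config_space n)"
    then obtain l where l: "A = l ` {..<n}" "\<And>i. i < n \<Longrightarrow> proj_line (l i)"
      and s: "\<And>i j. i < n \<Longrightarrow> j < n \<Longrightarrow> i \<noteq> j \<Longrightarrow> skew (l i) (l j)"
      by (auto simp: config_space_def ordered_config_space_def topspace_line_space PiE_iff)
    have "i = j" if "i < n" "j < n" "l i = l j" for i j
      using s[of i j] not_skew_refl[of "l i"] l(2)[of i] that by metis
    then have "inj_on l {..<n}" by (simp add: inj_on_def)
    then have "card A = n" by (simp add: l(1) card_image)
    moreover have "pairwise skew A" using s by (auto simp: l(1) pairwise_def)
    ultimately show "A \<in> configurations n" using l by (auto simp: configurations_def)
  qed
next
  show "configurations n \<subseteq> topspace (config_space n)"
  proof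
    fix A :: "(real ^ 4) set set"
    assume A: "A \<in> configurations n"
    then have "finite A" "card A = n" by (auto simp: configurations_def)
    then obtain h where h: "bij_betw h {..<n} A"
      using ex_bij_betw_nat_finite[of A] by (auto simp: atLeast0LessThan)
    define l where "l = restrict h {..<n}"
    have l: "bij_betw l {..<n} A" using h by (simp add: l_def)
    have in_A: "l i \<in> A" if "i < n" for i using l that by (auto simp: bij_betw_def)
    have "skew (l i) (l j)" if "i < n" "j < n" "i \<noteq> j" for i j
    proof -
      have "l i \<noteq> l j" using l that by (auto simp: bij_betw_def inj_on_def)
      then show ?thesis using A in_A that by (auto simp: configurations_def pairwise_def)
    qed
    moreover have "l \<in> (\<Pi>\<^sub>E i\<in>{..<n}. {L. proj_line L})"
      using A in_A by (auto simp: configurations_def PiE_iff l_def)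
    ultimately have "l \<in> topspace (ordered_config_space n)"
      by (auto simp: ordered_config_space_def topspace_line_space)
    moreover have "A = l ` {..<n}" using l by (simp add: bij_betw_def)
    ultimately show "A \<in> topspace (config_space n)" by (auto simp: config_space_def)
  qed
qed


section \<open>Mirror partners and coarse deformation equivalence\<close>

text \<open>
  A projective transformation of \<open>\<real>P\<^sup>3\<close> is induced by an invertible \<open>4 \<times> 4\<close> matrix, unique up to a
  nonzero scalar \<open>c\<close>. Scaling multiplies the determinant by \<open>c\<^sup>4 > 0\<close>, so its sign is well defined;
  the transformation reverses the orientation iff the determinant is negative.
\<close>

definition orientation_reversing :: "real ^ 4 ^ 4 \<Rightarrow> bool" where
  "orientation_reversing M \<longleftrightarrow> det M < 0"

definition mirror_partner :: "(real ^ 4) set set \<Rightarrow> (real ^ 4) set set \<Rightarrow> bool" where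
  "mirror_partner A B \<longleftrightarrow> (\<exists>M. orientation_reversing M \<and> B = (\<lambda>L. (*v) M ` L) ` A)"

definition coarse_deformation_equivalent ::
    "nat \<Rightarrow> (real ^ 4) set set \<Rightarrow> (real ^ 4) set set \<Rightarrow> bool" where
  "coarse_deformation_equivalent n A B \<longleftrightarrow>
     path_component_of (config_space n) A B \<or>
     (\<exists>B'. mirror_partner B B' \<and> path_component_of (config_space n) A B')"


section \<open>Real Schlaefli sixes\<close>

definition cubic_form :: "(complex ^ 4 \<Rightarrow> complex) \<Rightarrow> bool" where
  "cubic_form F \<longleftrightarrow>
     (\<exists>a :: 4 \<Rightarrow> 4 \<Rightarrow> 4 \<Rightarrow> complex.
        \<forall>x. F x = (\<Sum>i\<in>UNIV. \<Sum>j\<in>UNIV. \<Sum>k\<in>UNIV. a i j k * x $ i * x $ j * x $ k))"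

definition partial_deriv :: "4 \<Rightarrow> (complex ^ 4 \<Rightarrow> complex) \<Rightarrow> complex ^ 4 \<Rightarrow> complex" where
  "partial_deriv i F x = deriv (\<lambda>t. F (x + t *s axis i 1)) 0"

text \<open>
  A form all of whose zeros in \<open>\<complex>P\<^sup>3\<close> are non-singular points; in particular it is not the zero form.
\<close>

definition nonsingular_cubic_form :: "(complex ^ 4 \<Rightarrow> complex) \<Rightarrow> bool" where
  "nonsingular_cubic_form F \<longleftrightarrow>
     cubic_form F \<and> (\<forall>x. x \<noteq> 0 \<and> F x = 0 \<longrightarrow> (\<exists>i. partial_deriv i F x \<noteq> 0))"

text \<open>
  The complex points \<open>L \<otimes> \<complex>\<close> of a real line \<open>L\<close>.
\<close>

definition complexification :: "(real ^ 4) set \<Rightarrow> (complex ^ 4) set" where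
  "complexification L = {z. (\<chi> k. Re (z $ k)) \<in> L \<and> (\<chi> k. Im (z $ k)) \<in> L}"

definition real_schlaefli_six :: "(real ^ 4) set set \<Rightarrow> bool" where
  "real_schlaefli_six A \<longleftrightarrow>
     A \<in> configurations 6 \<and>
     (\<exists>F. nonsingular_cubic_form F \<and> (\<forall>L\<in>A. complexification L \<subseteq> {z. F z = 0}))"

end

theory Submission
  imports Defs
begin

text \<open>
  Let \<open>L\<close>, \<open>L'\<close> be two of the six lines and \<open>M1\<close>, \<open>M2\<close>, \<open>M3\<close>, \<open>M4\<close> the others. In coordinates \<open>(x, y)\<close> with
  two-dimensional \<open>x\<close> and \<open>y\<close>, in which \<open>M1\<close>, \<open>M2\<close>, \<open>M3\<close> are given by \<open>y = 0\<close>, \<open>x = 0\<close> and \<open>x = y\<close>, the lines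
  \<open>M4\<close>, \<open>L\<close>, \<open>L'\<close> are graphs of matrices \<open>A\<close>, \<open>B\<close>, \<open>C\<close>. A common transversal of \<open>M1\<close>, \<open>M2\<close>, \<open>M3\<close> belongs to a
  vector \<open>x\<close>; it lies on the cubic surface iff \<open>x\<close> is a root of a binary cubic, and it
  does so if \<open>x\<close> is an eigenvector of \<open>A\<close>, \<open>B\<close> or \<open>C\<close>. Smoothness forbids double roots (\<open>no_double_root\<close>), so \<open>A\<close> has
  two eigenvectors, and in this basis \<open>B\<close> and \<open>C\<close> are triangular (\<open>graph_triangular\<close>). The two transversals that
  belong to the eigenvectors of \<open>A\<close> lie on the surface, and the lines of the surface that meet both correspond to
  common zeros of two forms of bidegree \<open>(2, 1)\<close> and \<open>(1, 2)\<close>; there are at most five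
  (\<open>at_most_three_common_zeros\<close>). Hence the eigenvectors are real, one of the transversals meets \<open>L'\<close> but not \<open>L\<close>, the
  other one \<open>L\<close> but not \<open>L'\<close>, and the fifth common zero is a line coplanar with \<open>L'\<close> and the first transversal,
  and also with \<open>L\<close> and the second one (\<open>lower_upper_relation\<close>).

  So the four remaining lines join points \<open>u\<close> of one axis to points \<open>w\<close> of another. With the fifth common
  zero put at infinity on both axes, \<open>L'\<close> can be turned about its point \<open>s\<close> on the first axis until it joins \<open>s\<close> to
  infinity, and likewise \<open>L\<close> until it joins infinity to a point \<open>t\<close>. Lines joining two skew axes stay disjoint as long as their
  points on each axis stay distinct; hence only the two cyclic orders of five points matter.

  The form of bidegree \<open>(2, 1)\<close> makes \<open>w\<close> a quotient of a quadratic polynomial in \<open>u\<close> by a linear one with its zero at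
  \<open>s\<close>, and the other form does the same with \<open>u\<close> and \<open>w\<close> exchanged and \<open>t\<close> in place of \<open>s\<close>. Comparing both
  expressions for the determinant of three points \<open>(u, w)\<close> gives one sign that is the same for all
  triples (\<open>balanced_if_quadratics\<close>). This sign condition ties the position of \<open>s\<close> to that of \<open>t\<close> so closely that
  the cyclic orders of the two configurations agree up to rotations of both axes and possibly a reflection of one
  (\<open>grids_agree\<close>). Rotations are deformations, and a reflection is a mirror image.
\<close>

section \<open>Moving lines\<close>

text \<open>
  Both the Grassmannian and the space of configurations are quotients, so a path can be given by moving vectors that
  span the lines: the composition with the two quotient maps is continuous.
\<close>

lemma path_component_of_moving_lines:
  fixes a b :: "nat \<Rightarrow> real \<Rightarrow> real ^ 4"
  assumes cont: "\<And>i. i < n \<Longrightarrow> continuous_on {0..1} (a i)" "\<And>i. i < n \<Longrightarrow> continuous_on {0..1} (b i)"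
    and frame: "\<And>i t. i < n \<Longrightarrow> t \<in> {0..1} \<Longrightarrow> (a i t, b i t) \<in> frames"
    and skew: "\<And>i j t. i < n \<Longrightarrow> j < n \<Longrightarrow> i \<noteq> j \<Longrightarrow> t \<in> {0..1} \<Longrightarrow>
      skew (span {a i t, b i t}) (span {a j t, b j t})"
  shows "path_component_of (config_space n)
    ((\<lambda>i. span {a i 0, b i 0}) ` {..<n}) ((\<lambda>i. span {a i 1, b i 1}) ` {..<n})"
proof -
  define l where "l t = (\<lambda>i\<in>{..<n}. span {a i t, b i t})" for t
  have line: "continuous_map (top_of_set {0..1}) line_space (\<lambda>t. span {a i t, b i t})" if "i < n" for i
  proof -
    have "continuous_map (top_of_set {0..1}) (top_of_set frames) (\<lambda>t. (a i t, b i t))"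
      using cont[OF that] frame[OF that] by (auto intro!: continuous_on_Pair)
    moreover have "continuous_map (top_of_set frames) line_space (\<lambda>(u, v). span {u, v})"
      unfolding line_space_def by (rule quotient_imp_continuous_map[OF quotient_map_quotient_topology])
    ultimately have "continuous_map (top_of_set {0..1}) line_space
        ((\<lambda>(u, v). span {u, v}) \<circ> (\<lambda>t. (a i t, b i t)))"
      by (rule continuous_map_compose)
    then show ?thesis by (simp add: o_def)
  qed
  have "continuous_map (top_of_set {0..1}) (product_topology (\<lambda>_. line_space) {..<n}) l"
    unfolding continuous_map_componentwise using line by (auto simp: l_def)
  then have "continuous_map (top_of_set {0..1}) (ordered_config_space n) l"
    unfolding ordered_config_space_def continuous_map_in_subtopology
    using skew by (auto simp: l_def)
  moreover have "continuous_map (ordered_config_space n) (config_space n) (\<lambda>l. l ` {..<n})"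
    unfolding config_space_def by (rule quotient_imp_continuous_map[OF quotient_map_quotient_topology])
  ultimately have "continuous_map (top_of_set {0..1}) (config_space n) ((\<lambda>l. l ` {..<n}) \<circ> l)"
    by (rule continuous_map_compose)
  then have "pathin (config_space n) ((\<lambda>l. l ` {..<n}) \<circ> l)"
    by (simp add: pathin_def)
  then show ?thesis
    unfolding path_component_of_def by (rule exI[where x = "(\<lambda>l. l ` {..<n}) \<circ> l", OF conjI]) (auto simp: l_def intro!: image_cong)
qed

text \<open>
  All four coefficients are compared at once, so that distinctness of the vectors need not be tracked separately.
\<close>

definition independent4 :: "real ^ 4 \<Rightarrow> real ^ 4 \<Rightarrow> real ^ 4 \<Rightarrow> real ^ 4 \<Rightarrow> bool" where
  "independent4 a b c d \<longleftrightarrow> (\<forall>r s t u. r *\<^sub>R a + s *\<^sub>R b + t *\<^sub>R c + u *\<^sub>R d = 0 \<longrightarrow>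
     r = 0 \<and> s = 0 \<and> t = 0 \<and> u = 0)"

lemma independent4_basis_matrix:
  assumes "independent4 a b c d"
  shows "\<exists>B B' :: real ^ 4 ^ 4. B' ** B = mat 1 \<and> B ** B' = mat 1 \<and>
    (\<forall>x. B *v x = x $ 1 *\<^sub>R a + x $ 2 *\<^sub>R b + x $ 3 *\<^sub>R c + x $ 4 *\<^sub>R d)"
proof -
  define col :: "4 \<Rightarrow> real ^ 4" where "col j = (if j = 1 then a else if j = 2 then b else if j = 3 then c else d)" for j
  define B :: "real ^ 4 ^ 4" where "B = (\<chi> i j. col j $ i)"
  have B_col: "column k B = col k" for k by (simp add: column_def B_def vec_eq_iff)
  have B: "B *v x = x $ 1 *\<^sub>R a + x $ 2 *\<^sub>R b + x $ 3 *\<^sub>R c + x $ 4 *\<^sub>R d" for x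
    by (simp add: matrix_mult_sum B_col sum_4 col_def scalar_mult_eq_scaleR)
  have "x = 0" if "B *v x = 0" for x
  proof -
    have "x $ 1 = 0 \<and> x $ 2 = 0 \<and> x $ 3 = 0 \<and> x $ 4 = 0"
      using that assms unfolding B independent4_def by blast
    then show ?thesis by (simp add: vec_eq_iff forall_4)
  qed
  then obtain B' where "B' ** B = mat 1" using matrix_left_invertible_ker[of B] by blast
  moreover from this have "B ** B' = mat 1" by (simp add: matrix_left_right_inverse)
  ultimately show ?thesis using B by blast
qed

lemma span_2: "span {a, b} = {r *\<^sub>R a + s *\<^sub>R b | r s. True}"
  for a b :: "'a::real_vector"
proof -
  have "x \<in> span {a, b} \<longleftrightarrow> (\<exists>r s. x = r *\<^sub>R a + s *\<^sub>R b)" for x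
    unfolding span_breakdown_eq[of x] span_singleton
    by (auto simp: image_iff algebra_simps)
  then show ?thesis by auto
qed

lemma frames_if_coefficients_zero:
  assumes "\<And>r s. r *\<^sub>R u + s *\<^sub>R v = 0 \<Longrightarrow> r = 0 \<and> s = 0"
  shows "(u, v) \<in> frames"
proof -
  have v: "v \<noteq> 0" using assms[of 0 1] by auto
  have uv: "u \<noteq> v" using assms[of 1 "-1"] by auto
  have "u \<notin> span {v}"
  proof
    assume "u \<in> span {v}"
    then obtain k where "u = k *\<^sub>R v" by (auto simp: span_singleton)
    then show False using assms[of 1 "-k"] by simp
  qed
  then have "independent {u, v}" using v uv by (simp add: independent_insert)
  then show ?thesis using uv by (simp add: frames_def)
qed

lemma parallel_unit_vectors_zero: 
  assumes "a * cos x = b * cos y" "a * sin x = b * sin y" "sin (x - y) \<noteq> (0::real)"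
  shows "a = 0" "b = 0"
proof -
  have "a * sin (x - y) = (a * sin x) * cos y - (a * cos x) * sin y"
    by (simp add: sin_diff algebra_simps)
  also have "\<dots> = 0" unfolding assms(1,2) by simp
  finally have "a * sin (x - y) = 0" .
  moreover have "b * sin (x - y) = (b * cos y) * sin x - (b * sin y) * cos x"
    by (simp add: sin_diff algebra_simps)
  then have "b * sin (x - y) = 0" unfolding assms(1,2)[symmetric] by simp
  ultimately show "a = 0" "b = 0" using assms(3) by auto
qed

lemma sin_nonzero_if_abs_less_pi: "sin x \<noteq> 0" if "x \<noteq> 0" "\<bar>x\<bar> < pi" for x :: real
  using that sin_gt_zero[of x] sin_gt_zero[of "-x"] by (cases "x > 0") auto

text \<open>
  Points of a projective line are angles modulo \<open>\<pi>\<close>. Here they are lifted to arcs of length less than \<open>\<pi>\<close>, on which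
  different angles are different points.
\<close>

definition same_order :: "nat \<Rightarrow> (nat \<Rightarrow> real) \<Rightarrow> (nat \<Rightarrow> real) \<Rightarrow> bool" where
  "same_order n x y \<longleftrightarrow> (\<forall>i<n. \<forall>j<n. i \<noteq> j \<longrightarrow>
     x i \<noteq> x j \<and> y i \<noteq> y j \<and> (x i < x j \<longleftrightarrow> y i < y j) \<and> \<bar>x i - x j\<bar> < pi \<and> \<bar>y i - y j\<bar> < pi)"

section \<open>Lines joining points of two skew axes\<close>

text \<open>
  The axes are the projective lines spanned by \<open>e1\<close>, \<open>e2\<close> and by \<open>e3\<close>, \<open>e4\<close>.
\<close>

locale axis_pair =
  fixes e1 e2 e3 e4 :: "real ^ 4"
  assumes axes: "independent4 e1 e2 e3 e4"
begin

definition axis1 where "axis1 \<theta> = cos \<theta> *\<^sub>R e1 + sin \<theta> *\<^sub>R e2"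
definition axis2 where "axis2 \<eta> = cos \<eta> *\<^sub>R e3 + sin \<eta> *\<^sub>R e4"
definition join where "join \<theta> \<eta> = span {axis1 \<theta>, axis2 \<eta>}"

text \<open>
  Adding a multiple of \<open>e1\<close> and \<open>e2\<close> to the second vector turns the line in the plane through the first axis and
  \<open>axis2 \<eta>\<close>. This cannot create intersections: lines in different planes through the first axis meet at most on that
  axis, where their points differ.
\<close>

lemma join_skew:
  assumes "sin (\<theta> - \<theta>') \<noteq> 0" "sin (\<eta> - \<eta>') \<noteq> 0"
  shows "skew (span {axis1 \<theta>, axis2 \<eta> + (p *\<^sub>R e1 + q *\<^sub>R e2)}) (span {axis1 \<theta>', axis2 \<eta>' + (p' *\<^sub>R e1 + q' *\<^sub>R e2)})"
proof -
  have "r *\<^sub>R axis1 \<theta> + s *\<^sub>R (axis2 \<eta> + (p *\<^sub>R e1 + q *\<^sub>R e2)) = 0"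
    if "r *\<^sub>R axis1 \<theta> + s *\<^sub>R (axis2 \<eta> + (p *\<^sub>R e1 + q *\<^sub>R e2)) =
        r' *\<^sub>R axis1 \<theta>' + s' *\<^sub>R (axis2 \<eta>' + (p' *\<^sub>R e1 + q' *\<^sub>R e2))" for r s r' s'
  proof -
    have "(r * cos \<theta> + s * p - r' * cos \<theta>' - s' * p') *\<^sub>R e1
        + (r * sin \<theta> + s * q - r' * sin \<theta>' - s' * q') *\<^sub>R e2
        + (s * cos \<eta> - s' * cos \<eta>') *\<^sub>R e3 + (s * sin \<eta> - s' * sin \<eta>') *\<^sub>R e4 = 0"
      using that by (simp add: axis1_def axis2_def algebra_simps)
    then have z: "r * cos \<theta> + s * p - r' * cos \<theta>' - s' * p' = 0"
      "r * sin \<theta> + s * q - r' * sin \<theta>' - s' * q' = 0"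
      "s * cos \<eta> - s' * cos \<eta>' = 0" "s * sin \<eta> - s' * sin \<eta>' = 0"
      using axes unfolding independent4_def by blast+
    have ss: "s * cos \<eta> = s' * cos \<eta>'" "s * sin \<eta> = s' * sin \<eta>'" using z by linarith+
    note s = parallel_unit_vectors_zero[OF ss assms(2)]
    have "r * cos \<theta> = r' * cos \<theta>'" "r * sin \<theta> = r' * sin \<theta>'" using z s by simp_all
    then have "r = 0" by (rule parallel_unit_vectors_zero(1)[OF _ _ assms(1)])
    with s show ?thesis by simp
  qed
  note meet = this
  show ?thesis unfolding skew_def
  proof (intro antisym subsetI)
    fix x assume "x \<in> span {axis1 \<theta>, axis2 \<eta> + (p *\<^sub>R e1 + q *\<^sub>R e2)} \<inter> span {axis1 \<theta>', axis2 \<eta>' + (p' *\<^sub>R e1 + q' *\<^sub>R e2)}"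
    then obtain r s r' s' where "x = r *\<^sub>R axis1 \<theta> + s *\<^sub>R (axis2 \<eta> + (p *\<^sub>R e1 + q *\<^sub>R e2))"
      "x = r' *\<^sub>R axis1 \<theta>' + s' *\<^sub>R (axis2 \<eta>' + (p' *\<^sub>R e1 + q' *\<^sub>R e2))"
      unfolding span_2 Int_iff mem_Collect_eq by metis
    then show "x \<in> {0}" using meet[of r s r' s'] by simp
  qed (simp add: span_zero)
qed

lemma join_frame: "(axis1 \<theta>, axis2 \<eta> + (p *\<^sub>R e1 + q *\<^sub>R e2)) \<in> frames"
proof (rule frames_if_coefficients_zero)
  fix r s assume "r *\<^sub>R axis1 \<theta> + s *\<^sub>R (axis2 \<eta> + (p *\<^sub>R e1 + q *\<^sub>R e2)) = 0"
  then have "(r * cos \<theta> + s * p) *\<^sub>R e1 + (r * sin \<theta> + s * q) *\<^sub>R e2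
        + (s * cos \<eta>) *\<^sub>R e3 + (s * sin \<eta>) *\<^sub>R e4 = 0"
    by (simp add: axis1_def axis2_def algebra_simps)
  then have z: "r * cos \<theta> + s * p = 0" "r * sin \<theta> + s * q = 0" "s * cos \<eta> = 0" "s * sin \<eta> = 0"
    using axes unfolding independent4_def by blast+
  have s: "s = 0" using z(3,4) sin_cos_squared_add[of \<eta>] by (cases "s = 0") auto
  then show "r = 0 \<and> s = 0" using z(1,2) sin_cos_squared_add[of \<theta>]
    by (cases "r = 0") auto
qed

lemma axis1_continuous: "continuous_on S f \<Longrightarrow> continuous_on S (\<lambda>t. axis1 (f t))" for f :: "real \<Rightarrow> real"
  by (auto simp: axis1_def intro!: continuous_intros)

lemma axis2_continuous: "continuous_on S f \<Longrightarrow> continuous_on S (\<lambda>t. axis2 (f t))" for f :: "real \<Rightarrow> real"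
  by (auto simp: axis2_def intro!: continuous_intros)

lemma join_path:
  fixes \<theta> \<eta> p q :: "nat \<Rightarrow> real \<Rightarrow> real"
  assumes "\<And>i. i < n \<Longrightarrow> continuous_on {0..1} (\<theta> i)" "\<And>i. i < n \<Longrightarrow> continuous_on {0..1} (\<eta> i)"
    "\<And>i. i < n \<Longrightarrow> continuous_on {0..1} (p i)" "\<And>i. i < n \<Longrightarrow> continuous_on {0..1} (q i)"
    and "\<And>i j t. i < n \<Longrightarrow> j < n \<Longrightarrow> i \<noteq> j \<Longrightarrow> t \<in> {0..1} \<Longrightarrow>
      sin (\<theta> i t - \<theta> j t) \<noteq> 0 \<and> sin (\<eta> i t - \<eta> j t) \<noteq> 0"
  shows "path_component_of (config_space n)
    ((\<lambda>i. span {axis1 (\<theta> i 0), axis2 (\<eta> i 0) + (p i 0 *\<^sub>R e1 + q i 0 *\<^sub>R e2)}) ` {..<n})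
    ((\<lambda>i. span {axis1 (\<theta> i 1), axis2 (\<eta> i 1) + (p i 1 *\<^sub>R e1 + q i 1 *\<^sub>R e2)}) ` {..<n})"
  by (rule path_component_of_moving_lines[where a = "\<lambda>i t. axis1 (\<theta> i t)"
        and b = "\<lambda>i t. axis2 (\<eta> i t) + (p i t *\<^sub>R e1 + q i t *\<^sub>R e2)"])
    (use assms in \<open>auto intro!: join_skew join_frame continuous_intros axis1_continuous axis2_continuous\<close>)

text \<open>
  Under linear interpolation of the angles each difference keeps its sign and stays below \<open>\<pi>\<close> in absolute value, so
  no two points of an axis collide.
\<close>

lemma join_path_order:
  assumes \<theta>: "same_order n \<theta> \<theta>'" and \<eta>: "same_order n \<eta> \<eta>'"
  shows "path_component_of (config_space n)
    ((\<lambda>i. join (\<theta> i) (\<eta> i)) ` {..<n}) ((\<lambda>i. join (\<theta>' i) (\<eta>' i)) ` {..<n})"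
proof -
  have conv: "sin (((1 - t) * x + t * x') - ((1 - t) * y + t * y')) \<noteq> 0"
    if "x \<noteq> y" "x < y \<longleftrightarrow> x' < y'" "\<bar>x - y\<bar> < pi" "\<bar>x' - y'\<bar> < pi" "x' \<noteq> y'" "t \<in> {0..1}"
    for x y x' y' t :: real
  proof -
    define d d' where "d = x - y" and "d' = x' - y'"
    have *: "(1 - t) * d + t * d' \<in> {0<..<pi}" if "d \<in> {0<..<pi}" "d' \<in> {0<..<pi}" for d d'
      using convexD[OF convex_real_interval(8)[of 0 pi] that, of "1 - t" t] \<open>t \<in> _\<close> by auto
    have "\<bar>(1 - t) * d + t * d'\<bar> < pi \<and> (1 - t) * d + t * d' \<noteq> 0"
      using *[of d d'] *[of "-d" "-d'"] that by (cases "x < y") (auto simp: d_def d'_def algebra_simps)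
    then show ?thesis using sin_nonzero_if_abs_less_pi[of "(1 - t) * d + t * d'"] by (simp add: d_def d'_def algebra_simps)
  qed
  have path: "path_component_of (config_space n)
    ((\<lambda>i. span {axis1 ((1 - 0) * \<theta> i + 0 * \<theta>' i), axis2 ((1 - 0) * \<eta> i + 0 * \<eta>' i) + (0 *\<^sub>R e1 + 0 *\<^sub>R e2)}) ` {..<n})
    ((\<lambda>i. span {axis1 ((1 - 1) * \<theta> i + 1 * \<theta>' i), axis2 ((1 - 1) * \<eta> i + 1 * \<eta>' i) + (0 *\<^sub>R e1 + 0 *\<^sub>R e2)}) ` {..<n})"
  proof (rule join_path)
    fix i j t assume ij: "i < n" "j < n" "i \<noteq> j" "t \<in> {0..1::real}"
    show "sin (((1 - t) * \<theta> i + t * \<theta>' i) - ((1 - t) * \<theta> j + t * \<theta>' j)) \<noteq> 0 \<and>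
      sin (((1 - t) * \<eta> i + t * \<eta>' i) - ((1 - t) * \<eta> j + t * \<eta>' j)) \<noteq> 0"
      by (intro conjI conv; insert \<theta> \<eta> ij; unfold same_order_def; blast)
  qed (intro continuous_intros)+
  show ?thesis
    using path by (simp add: join_def)
qed

end

section \<open>Permutations on a cyclic grid\<close>

text \<open>
  Let four lines join two axes, with labels increasing along the first axis, and let \<open>R\<close> compare their points on the
  second one. The parity of \<open>R\<close> on the three pairs is the linking sign of three of the lines. This sign is twisted by
  \<open>S\<close>, which will record whether the points of a line on the two axes lie on different sides of \<open>s\<close> and of \<open>t\<close>; in a
  balanced situation the twisted signs of all triples agree.
\<close>

definition odd_triple :: "('a \<Rightarrow> 'a \<Rightarrow> bool) \<Rightarrow> ('a \<Rightarrow> bool) \<Rightarrow> 'a \<Rightarrow> 'a \<Rightarrow> 'a \<Rightarrow> bool" where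
  "odd_triple R S x y z \<longleftrightarrow> (R x y \<noteq> (R y z \<noteq> (R x z \<noteq> (S x \<noteq> (S y \<noteq> S z)))))"

definition balanced :: "(nat \<Rightarrow> nat \<Rightarrow> bool) \<Rightarrow> (nat \<Rightarrow> bool) \<Rightarrow> bool" where
  "balanced R S \<longleftrightarrow> odd_triple R S 0 1 2 = odd_triple R S 0 1 3 \<and>
     odd_triple R S 0 1 3 = odd_triple R S 0 2 3 \<and> odd_triple R S 0 2 3 = odd_triple R S 1 2 3"

text \<open>
  The rank of an old element once a new one of rank \<open>k\<close> is present.
\<close>

definition make_room :: "nat \<Rightarrow> nat \<Rightarrow> nat" where
  "make_room k n = (if n < k then n else Suc n)"

text \<open>
  Since only orders matter, five lines joining the axes form a permutation matrix on a grid of \<open>5\<close> by \<open>5\<close> points.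
  Four of the lines have ranks \<open>i\<close> and \<open>\<pi> i\<close> on the axes. The fifth line is at infinity, with the largest rank \<open>4\<close>,
  on the second axis in \<open>grid_first\<close> and on the first axis in \<open>grid_second\<close>.
\<close>

definition grid_first :: "(nat \<Rightarrow> nat) \<Rightarrow> nat \<Rightarrow> (nat \<times> nat) list" where
  "grid_first \<pi> k = map (\<lambda>i. (make_room k i, \<pi> i)) [0..<4] @ [(k, 4)]"

definition grid_second :: "(nat \<Rightarrow> nat) \<Rightarrow> nat \<Rightarrow> (nat \<times> nat) list" where
  "grid_second \<pi> l = map (\<lambda>i. (i, make_room l (\<pi> i))) [0..<4] @ [(4, l)]"

text \<open>
  Translations of the cyclic grid come from rotations of the axes; the factor \<open>4\<close>, which is \<open>-1\<close> modulo \<open>5\<close>, comes from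
  a reflection of the second axis.
\<close>

definition grid_move :: "nat \<Rightarrow> nat \<Rightarrow> nat \<Rightarrow> (nat \<times> nat) list \<Rightarrow> (nat \<times> nat) list" where
  "grid_move e i j D = map (\<lambda>(p, r). ((i + p) mod 5, (j + e * r) mod 5)) D"

text \<open>
  Among the \<open>24 * 25\<close> choices of a permutation and of two positions, \<open>96\<close> are balanced, and
  for each of them one of the \<open>50\<close> moves takes the second grid to the first. The implications are written as disjunctions because their evaluation
  then stops at the first true disjunct and the search for a move is made in the balanced cases only.
\<close>

lemma grids_agree_enumerated:
  "\<forall>a\<in>set [0..<4]. \<forall>b\<in>set [0..<4]. \<forall>c\<in>set [0..<4]. \<forall>d\<in>set [0..<4]. 
     \<not> distinct [a, b, c, d] \<or>
     (\<forall>k\<in>set [0..<5]. \<forall>l\<in>set [0..<5].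
     \<not> balanced (\<lambda>i j. [a,b,c,d] ! i < [a,b,c,d] ! j) (\<lambda>i. (i < k) \<noteq> ([a,b,c,d] ! i < l)) \<or>
     (\<exists>e\<in>set [1, 4]. \<exists>i\<in>set [0..<5]. \<exists>j\<in>set [0..<5].
        set (grid_first (\<lambda>i. [a,b,c,d] ! i) k) \<subseteq> set (grid_move e i j (grid_second (\<lambda>i. [a,b,c,d] ! i) l)) \<and>
        set (grid_move e i j (grid_second (\<lambda>i. [a,b,c,d] ! i) l)) \<subseteq> set (grid_first (\<lambda>i. [a,b,c,d] ! i) k)))"
  by code_simp

lemma grids_agree:
  assumes \<pi>: "\<And>i. i < 4 \<Longrightarrow> \<pi> i < 4" "inj_on \<pi> {..<4}" and kl: "k < 5" "l < 5"
    and bal: "balanced (\<lambda>i j. \<pi> i < \<pi> j) (\<lambda>i. (i < k) \<noteq> (\<pi> i < l))"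
  shows "\<exists>e i j. (e = 1 \<or> e = 4) \<and> set (grid_first \<pi> k) = set (grid_move e i j (grid_second \<pi> l))"
proof -
  have d: "distinct [\<pi> 0, \<pi> 1, \<pi> 2, \<pi> 3]" by (simp add: inj_on_eq_iff[OF \<pi>(2)])
  have v: "[\<pi> 0, \<pi> 1, \<pi> 2, \<pi> 3] ! i = \<pi> i" if "i < 4" for i
    using that by (auto simp: less_Suc_eq numeral_eq_Suc)
  have b: "balanced (\<lambda>i j. [\<pi> 0, \<pi> 1, \<pi> 2, \<pi> 3] ! i < [\<pi> 0, \<pi> 1, \<pi> 2, \<pi> 3] ! j)
      (\<lambda>i. (i < k) \<noteq> ([\<pi> 0, \<pi> 1, \<pi> 2, \<pi> 3] ! i < l))"
    using bal by (simp add: balanced_def odd_triple_def v)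
  have X: "grid_first (\<lambda>i. [\<pi> 0, \<pi> 1, \<pi> 2, \<pi> 3] ! i) k = grid_first \<pi> k"
    and Y: "grid_second (\<lambda>i. [\<pi> 0, \<pi> 1, \<pi> 2, \<pi> 3] ! i) l = grid_second \<pi> l"
    unfolding grid_first_def grid_second_def by (auto simp del: One_nat_def simp: v)
  have mem: "\<pi> 0 \<in> set [0..<4]" "\<pi> 1 \<in> set [0..<4]" "\<pi> 2 \<in> set [0..<4]" "\<pi> 3 \<in> set [0..<4]"
      "k \<in> set [0..<5]" "l \<in> set [0..<5]"
    using \<pi>(1) kl by auto
  have "\<exists>e\<in>set [1, 4]. \<exists>i\<in>set [0..<5]. \<exists>j\<in>set [0..<5].
        set (grid_first \<pi> k) \<subseteq> set (grid_move e i j (grid_second \<pi> l)) \<and>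
        set (grid_move e i j (grid_second \<pi> l)) \<subseteq> set (grid_first \<pi> k)"
    using mp[OF bspec[OF bspec[OF mp[OF bspec[OF bspec[OF bspec[OF bspec[OF grids_agree_enumerated[unfolded disj_not1]
      mem(1)] mem(2)] mem(3)] mem(4)] d] mem(5)] mem(6)] b] unfolding X Y .
  then obtain e i j where e: "e \<in> set [1, 4]" and "set (grid_first \<pi> k) = set (grid_move e i j (grid_second \<pi> l))"
    by (elim bexE conjE) (rule that, assumption, rule subset_antisym)
  moreover have "e = 1 \<or> e = 4" using e by simp
  ultimately show ?thesis by blast
qed

definition rank :: "(nat \<Rightarrow> real) \<Rightarrow> real \<Rightarrow> nat" where
  "rank x y = card {i. i < 4 \<and> x i < y}"

lemma rank_le: "rank x y \<le> 4"
  using card_mono[of "{..<4::nat}" "{i. i < 4 \<and> x i < y}"] by (auto simp: rank_def)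

lemma rank_less_iff: "i < 4 \<Longrightarrow> rank x (x i) < rank x y \<longleftrightarrow> x i < y"
proof -
  assume i: "i < 4"
  show ?thesis
  proof
    assume "x i < y"
    then have "{j. j < 4 \<and> x j < x i} \<subset> {j. j < 4 \<and> x j < y}" using i by auto
    then show "rank x (x i) < rank x y" unfolding rank_def by (intro psubset_card_mono) auto
  next
    assume r: "rank x (x i) < rank x y"
    show "x i < y"
    proof (rule ccontr)
      assume "\<not> x i < y"
      then have "{j. j < 4 \<and> x j < y} \<subseteq> {j. j < 4 \<and> x j < x i}" by auto
      then have "rank x y \<le> rank x (x i)" unfolding rank_def by (intro card_mono) auto
      then show False using r by simp
    qed
  qed
qed

lemma rank_self: "i < 4 \<Longrightarrow> rank x (x i) < 4"
proof -
  assume "i < 4"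
  then have "{j. j < 4 \<and> x j < x i} \<subset> {..<4}" by auto
  then have "card {j. j < 4 \<and> x j < x i} < card {..<4::nat}" by (intro psubset_card_mono) auto
  then show ?thesis by (simp add: rank_def)
qed

context axis_pair begin

lemma axis1_add_pi: "axis1 (\<theta> + real n * pi) = (-1) ^ n *\<^sub>R axis1 \<theta>"
  by (simp add: axis1_def cos_add sin_add algebra_simps)

lemma axis2_add_pi: "axis2 (\<eta> + real n * pi) = (-1) ^ n *\<^sub>R axis2 \<eta>"
  by (simp add: axis2_def cos_add sin_add algebra_simps)

lemma span_2_scale:
  fixes u v :: "'a::real_vector"
  assumes "a \<noteq> 0" "b \<noteq> 0"
  shows "span {a *\<^sub>R u, b *\<^sub>R v} = span {u, v}"
proof -
  have "span {a *\<^sub>R u, b *\<^sub>R v} \<subseteq> span {u, v}"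
    by (rule span_minimal) (auto intro: span_scale span_base)
  moreover have "u \<in> span {a *\<^sub>R u, b *\<^sub>R v}"
    using span_scale[OF span_base, of "a *\<^sub>R u" "{a *\<^sub>R u, b *\<^sub>R v}" "inverse a"] assms by simp
  moreover have "v \<in> span {a *\<^sub>R u, b *\<^sub>R v}"
    using span_scale[OF span_base, of "b *\<^sub>R v" "{a *\<^sub>R u, b *\<^sub>R v}" "inverse b"] assms by simp
  ultimately have "span {u, v} \<subseteq> span {a *\<^sub>R u, b *\<^sub>R v}" by (intro span_minimal) auto
  then show ?thesis using \<open>span {a *\<^sub>R u, b *\<^sub>R v} \<subseteq> _\<close> by (rule antisym[rotated])
qed

lemma join_add_pi: "join (\<theta> + real m * pi) (\<eta> + real n * pi) = join \<theta> \<eta>"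
  by (simp add: join_def axis1_add_pi axis2_add_pi span_2_scale)

text \<open>
  Rank \<open>r\<close> becomes the angle \<open>r * \<pi> / 5\<close>, so that ranks modulo \<open>5\<close> correspond to angles modulo \<open>\<pi>\<close>.
\<close>

definition grid_line where "grid_line = (\<lambda>(p, r). join (real p * pi / 5) (real r * pi / 5))"

lemma grid_line_shifted: "grid_line ((i + p) mod 5, (j + r) mod 5) = join ((real i + real p) * pi / 5) ((real j + real r) * pi / 5)"
proof -
  have *: "(real a + real b) * pi / 5 = real ((a + b) mod 5) * pi / 5 + real ((a + b) div 5) * pi" for a b
  proof -
    have "real a + real b = real (5 * ((a + b) div 5) + (a + b) mod 5)" by (simp only: mult_div_mod_eq of_nat_add)
    then have "real a + real b = 5 * real ((a + b) div 5) + real ((a + b) mod 5)"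
      by (simp only: of_nat_add of_nat_mult of_nat_numeral)
    then show ?thesis by (simp only:) (simp add: field_simps)
  qed
  show ?thesis unfolding * join_add_pi by (simp add: grid_line_def)
qed

lemma grid_line_reflected: "grid_line ((i + p) mod 5, (j + 4 * r) mod 5) = join ((real i + real p) * pi / 5) ((real j - real r) * pi / 5)"
proof -
  have "(real j + real (4 * r)) * pi / 5 = (real j - real r) * pi / 5 + real r * pi" by (simp add: field_simps)
  then show ?thesis unfolding grid_line_shifted using join_add_pi[of _ 0 _ r] by (simp only: of_nat_0 mult_zero_left add_0_right)
qed

end

lemma same_order_grid:
  assumes "\<And>i j. i < 5 \<Longrightarrow> j < 5 \<Longrightarrow> i \<noteq> j \<Longrightarrow> x i \<noteq> x j \<and> (x i < x j \<longleftrightarrow> p i < p j)"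
    and "\<And>i. i < 5 \<Longrightarrow> - (pi / 2) < x i \<and> x i \<le> pi / 2 \<and> p i < (5::nat)"
  shows "same_order 5 x (\<lambda>i. (c + real (p i)) * pi / 5)"
    and "same_order 5 (\<lambda>i. - x i) (\<lambda>i. (c - real (p i)) * pi / 5)"
proof -
  have gap: "\<bar>(c + real a) * pi / 5 - (c + real b) * pi / 5\<bar> < pi"
    "\<bar>(c - real a) * pi / 5 - (c - real b) * pi / 5\<bar> < pi" if "a < 5" "b < 5" for a b
  proof -
    have "\<bar>real a - real b\<bar> < 5" using that by linarith
    then have "\<bar>(real a - real b) * (pi / 5)\<bar> < 5 * (pi / 5)"
      unfolding abs_mult by (intro mult_strict_right_mono[THEN order_less_le_trans]) auto
    then have *: "\<bar>(real a - real b) * (pi / 5)\<bar> < pi" by simp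
    have "(c + real a) * pi / 5 - (c + real b) * pi / 5 = (real a - real b) * (pi / 5)"
      "(c - real a) * pi / 5 - (c - real b) * pi / 5 = - ((real a - real b) * (pi / 5))"
      by (simp_all add: field_simps)
    with * show "\<bar>(c + real a) * pi / 5 - (c + real b) * pi / 5\<bar> < pi"
      "\<bar>(c - real a) * pi / 5 - (c - real b) * pi / 5\<bar> < pi" by simp_all
  qed
  have x: "\<bar>x i - x j\<bar> < pi" "\<bar>- x i - - x j\<bar> < pi" if "i < 5" "j < 5" for i j
    using assms(2)[OF that(1)] assms(2)[OF that(2)] by linarith+
  have ne: "x i \<noteq> x j" "p i \<noteq> p j" "x i < x j \<longleftrightarrow> p i < p j" if "i < 5" "j < 5" "i \<noteq> j" for i j
    using assms(1)[OF that] assms(1)[OF that(2,1) that(3)[symmetric]] by (metis less_irrefl linorder_neqE)+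
  have le: "(c + real a) * pi / 5 < (c + real b) * pi / 5 \<longleftrightarrow> a < b"
    "(c + real a) * pi / 5 = (c + real b) * pi / 5 \<longleftrightarrow> a = b"
    "(c - real a) * pi / 5 < (c - real b) * pi / 5 \<longleftrightarrow> b < a"
    "(c - real a) * pi / 5 = (c - real b) * pi / 5 \<longleftrightarrow> a = b" for a b
    by (simp_all add: divide_less_cancel)
  show "same_order 5 x (\<lambda>i. (c + real (p i)) * pi / 5)"
    unfolding same_order_def le 
  proof (intro allI impI)
    fix i j :: nat assume ij: "i < 5" "j < 5" "i \<noteq> j"
    show "x i \<noteq> x j \<and> p i \<noteq> p j \<and> (x i < x j \<longleftrightarrow> p i < p j) \<and> \<bar>x i - x j\<bar> < pi \<and>
        \<bar>(c + real (p i)) * pi / 5 - (c + real (p j)) * pi / 5\<bar> < pi"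
      using ne[OF ij] x(1)[OF ij(1,2)] gap(1)[of "p i" "p j"] assms(2)[OF ij(1)] assms(2)[OF ij(2)] by blast
  qed
  show "same_order 5 (\<lambda>i. - x i) (\<lambda>i. (c - real (p i)) * pi / 5)"
    unfolding same_order_def le neg_equal_iff_equal neg_less_iff_less 
  proof (intro allI impI)
    fix i j :: nat assume ij: "i < 5" "j < 5" "i \<noteq> j"
    show "x i \<noteq> x j \<and> p i \<noteq> p j \<and> (x j < x i \<longleftrightarrow> p j < p i) \<and> \<bar>- x i - - x j\<bar> < pi \<and>
        \<bar>(c - real (p i)) * pi / 5 - (c - real (p j)) * pi / 5\<bar> < pi"
      using ne(1,2)[OF ij] ne(3)[OF ij(2,1) ij(3)[symmetric]] x(2)[OF ij(1,2)] gap(2)[of "p i" "p j"]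
        assms(2)[OF ij(1)] assms(2)[OF ij(2)] by blast
  qed
qed

section \<open>Deformations of five lines that meet an axis\<close>

lemma extended_rank_order:
  assumes inj: "inj_on x {..<4}" and y: "\<And>i. i < 4 \<Longrightarrow> x i \<noteq> y"
    and x'_def: "x' = (\<lambda>i. if i = 4 then y else x i)"
    and r'_def: "r' = (\<lambda>i. if i = 4 then rank x y else make_room (rank x y) (rank x (x i)))"
  shows "\<lbrakk>i < 5; j < 5; i \<noteq> j\<rbrakk> \<Longrightarrow> x' i \<noteq> x' j \<and> (x' i < x' j \<longleftrightarrow> r' i < r' j)" and "i < 5 \<Longrightarrow> r' i < 5"
proof -
  have less4: "m < 4" if "m < 5" "m \<noteq> 4" for m :: nat using that by linarith
  show "x' i \<noteq> x' j \<and> (x' i < x' j \<longleftrightarrow> r' i < r' j)" if ij: "i < 5" "j < 5" "i \<noteq> j"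
  proof -
    have rr: "rank x (x a) < rank x (x b) \<longleftrightarrow> x a < x b" "rank x (x a) < rank x y \<longleftrightarrow> x a < y"
      if "a < 4" for a b using rank_less_iff[OF that] by auto
    consider "i < 4" "j < 4" | "i = 4" "j < 4" | "i < 4" "j = 4" using less4 ij by metis
    then show ?thesis
    proof cases
      case 1
      then have "x i \<noteq> x j" using inj ij by (auto simp: inj_on_def)
      moreover have "make_room k a < make_room k b \<longleftrightarrow> a < b" for k a b by (auto simp: make_room_def)
      ultimately show ?thesis using 1 rr by (simp add: x'_def r'_def)
    next
      case 2
      have "k < make_room k a \<longleftrightarrow> \<not> a < k" for k a by (auto simp: make_room_def)
      then show ?thesis using 2 rr(2)[of j] y[of j] by (auto simp: x'_def r'_def)
    next
      case 3
      have "make_room k a < k \<longleftrightarrow> a < k" for k a by (auto simp: make_room_def)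
      then show ?thesis using 3 rr(2)[of i] y[of i] by (auto simp: x'_def r'_def)
    qed
  qed
  show "r' i < 5" if "i < 5"
    using rank_le[of x y] rank_self[of i x] less4[OF that] by (auto simp: r'_def make_room_def)
qed

lemma image_lessThan_5: "f ` {..<5::nat} = insert (f 4) (f ` {..<4})"
proof -
  have "{..<5::nat} = insert 4 {..<4}" by auto
  then show ?thesis by simp
qed

context axis_pair begin

text \<open>
  The last line lies in a plane through the first axis; turning it in this plane about its point \<open>axis1 \<alpha>\<close> brings it
  to the line through \<open>e4\<close>. The closed bound \<open>- \<pi> / 2\<close> is attained by the mirror image of a line with angle \<open>\<pi> / 2\<close>.
\<close>

lemma slide_last_line:
  fixes \<theta> \<eta> :: "nat \<Rightarrow> real"
  assumes range: "\<And>i. i < 4 \<Longrightarrow> - (pi / 2) < \<theta> i \<and> \<theta> i < pi / 2 \<and> - (pi / 2) < \<eta> i \<and> \<eta> i < pi / 2"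
    and inj: "inj_on \<theta> {..<4}" "inj_on \<eta> {..<4}"
    and \<alpha>: "- (pi / 2) \<le> \<alpha>" "\<alpha> \<le> pi / 2" "\<And>i. i < 4 \<Longrightarrow> \<theta> i \<noteq> \<alpha>"
  shows "path_component_of (config_space 5)
    (insert (span {axis1 \<alpha>, e4 + (p *\<^sub>R e1 + q *\<^sub>R e2)}) ((\<lambda>i. join (\<theta> i) (\<eta> i)) ` {..<4}))
    (insert (join \<alpha> (pi / 2)) ((\<lambda>i. join (\<theta> i) (\<eta> i)) ` {..<4}))"
proof -
  define \<theta>' \<eta>' where "\<theta>' i = (if i = 4 then \<alpha> else \<theta> i)" and "\<eta>' i = (if i = 4 then pi / 2 else \<eta> i)" for i :: nat
  have ne: "sin (\<theta>' i - \<theta>' j) \<noteq> 0 \<and> sin (\<eta>' i - \<eta>' j) \<noteq> 0" if ij: "i < 5" "j < 5" "i \<noteq> j" for i j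
  proof -
    consider "i < 4" "j < 4" | "i = 4" "j < 4" | "i < 4" "j = 4" using ij by linarith
    then have "\<theta>' i - \<theta>' j \<noteq> 0 \<and> \<eta>' i - \<eta>' j \<noteq> 0 \<and> \<bar>\<theta>' i - \<theta>' j\<bar> < pi \<and> \<bar>\<eta>' i - \<eta>' j\<bar> < pi"
    proof cases
      case 1
      then show ?thesis
        using inj_on_eq_iff[OF inj(1), of i j] inj_on_eq_iff[OF inj(2), of i j] range[of i] range[of j] ij
        by (simp add: \<theta>'_def \<eta>'_def abs_less_iff)
    next
      case 2
      then show ?thesis using \<alpha>(1,2) \<alpha>(3)[of j] range[of j] by (simp add: \<theta>'_def \<eta>'_def abs_less_iff)
    next
      case 3
      then show ?thesis using \<alpha>(1,2) \<alpha>(3)[of i] range[of i] by (simp add: \<theta>'_def \<eta>'_def abs_less_iff)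
    qed
    then show ?thesis using sin_nonzero_if_abs_less_pi by blast
  qed
  have "path_component_of (config_space 5)
    ((\<lambda>i. span {axis1 (\<theta>' i), axis2 (\<eta>' i) + (((1 - 0) * (if i = 4 then p else 0)) *\<^sub>R e1 + ((1 - 0) * (if i = 4 then q else 0)) *\<^sub>R e2)}) ` {..<5})
    ((\<lambda>i. span {axis1 (\<theta>' i), axis2 (\<eta>' i) + (((1 - 1) * (if i = 4 then p else 0)) *\<^sub>R e1 + ((1 - 1) * (if i = 4 then q else 0)) *\<^sub>R e2)}) ` {..<5})"
    by (rule join_path[where \<theta> = "\<lambda>i t. \<theta>' i" and \<eta> = "\<lambda>i t. \<eta>' i"
        and p = "\<lambda>i t. (1 - t) * (if i = 4 then p else 0)" and q = "\<lambda>i t. (1 - t) * (if i = 4 then q else 0)"])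
      (use ne in \<open>auto intro!: continuous_intros\<close>)
  moreover have "axis2 (pi / 2) = e4" by (simp add: axis2_def)
  ultimately show ?thesis unfolding image_lessThan_5 by (simp add: \<theta>'_def \<eta>'_def join_def)
qed

lemma axis_pair_swapped: "axis_pair e3 e4 e1 e2"
proof
  have "r = 0 \<and> s = 0 \<and> t = 0 \<and> u = 0" if "r *\<^sub>R e3 + s *\<^sub>R e4 + t *\<^sub>R e1 + u *\<^sub>R e2 = 0" for r s t u
  proof -
    have "t *\<^sub>R e1 + u *\<^sub>R e2 + r *\<^sub>R e3 + s *\<^sub>R e4 = 0" using that by (simp add: add_ac)
    then show ?thesis using axes unfolding independent4_def by blast
  qed
  then show "independent4 e3 e4 e1 e2" unfolding independent4_def by blast
qed

lemma slide_last_line_dual: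
  fixes \<theta> \<eta> :: "nat \<Rightarrow> real"
  assumes range: "\<And>i. i < 4 \<Longrightarrow> - (pi / 2) < \<theta> i \<and> \<theta> i < pi / 2 \<and> - (pi / 2) < \<eta> i \<and> \<eta> i < pi / 2"
    and inj: "inj_on \<theta> {..<4}" "inj_on \<eta> {..<4}"
    and \<beta>: "- (pi / 2) \<le> \<beta>" "\<beta> \<le> pi / 2" "\<And>i. i < 4 \<Longrightarrow> \<eta> i \<noteq> \<beta>"
  shows "path_component_of (config_space 5)
    (insert (span {axis2 \<beta>, e2 + (p *\<^sub>R e3 + q *\<^sub>R e4)}) ((\<lambda>i. join (\<theta> i) (\<eta> i)) ` {..<4}))
    (insert (join (pi / 2) \<beta>) ((\<lambda>i. join (\<theta> i) (\<eta> i)) ` {..<4}))"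
proof -
  interpret sw: axis_pair e3 e4 e1 e2 by (rule axis_pair_swapped)
  have [simp]: "sw.axis1 = axis2" "sw.axis2 = axis1" by (simp_all add: fun_eq_iff sw.axis1_def sw.axis2_def axis1_def axis2_def)
  have [simp]: "sw.join x y = join y x" for x y by (simp add: sw.join_def join_def insert_commute)
  show ?thesis using sw.slide_last_line[of \<eta> \<theta> \<beta> p q] assms by auto
qed

lemma grid_path:
  fixes \<theta> \<eta> :: "nat \<Rightarrow> real"
  assumes x: "\<And>i j. i < 5 \<Longrightarrow> j < 5 \<Longrightarrow> i \<noteq> j \<Longrightarrow> \<theta> i \<noteq> \<theta> j \<and> (\<theta> i < \<theta> j \<longleftrightarrow> p i < p j)"
     "\<And>i. i < 5 \<Longrightarrow> - (pi / 2) < \<theta> i \<and> \<theta> i \<le> pi / 2 \<and> p i < (5::nat)"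
    and y: "\<And>i j. i < 5 \<Longrightarrow> j < 5 \<Longrightarrow> i \<noteq> j \<Longrightarrow> \<eta> i \<noteq> \<eta> j \<and> (\<eta> i < \<eta> j \<longleftrightarrow> r i < r j)"
     "\<And>i. i < 5 \<Longrightarrow> - (pi / 2) < \<eta> i \<and> \<eta> i \<le> pi / 2 \<and> r i < (5::nat)"
  shows "path_component_of (config_space 5) ((\<lambda>i. join (\<theta> i) (\<eta> i)) ` {..<5})
      (grid_line ` (\<lambda>i. ((a + p i) mod 5, (b + 1 * r i) mod 5)) ` {..<5})"
    and "path_component_of (config_space 5) ((\<lambda>i. join (\<theta> i) (- \<eta> i)) ` {..<5})
      (grid_line ` (\<lambda>i. ((a + p i) mod 5, (b + 4 * r i) mod 5)) ` {..<5})"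
  unfolding image_image mult_1 unfolding grid_line_reflected unfolding grid_line_shifted
  by (rule join_path_order[OF same_order_grid(1)[OF x] same_order_grid(1)[OF y]];assumption)
    (rule join_path_order[OF same_order_grid(1)[OF x] same_order_grid(2)[OF y]];assumption)

text \<open>
  Changing the sign of \<open>e4\<close> only reflects the second axis and fixes the first one pointwise.
\<close>

lemma reflection_exists:
  "\<exists>M. orientation_reversing M \<and> M *v e1 = e1 \<and> M *v e2 = e2 \<and> M *v e3 = e3 \<and> M *v e4 = - e4"
proof -
  obtain B B' :: "real ^ 4 ^ 4" where B': "B' ** B = mat 1" and BB': "B ** B' = mat 1"
    and B: "\<And>x. B *v x = x $ 1 *\<^sub>R e1 + x $ 2 *\<^sub>R e2 + x $ 3 *\<^sub>R e3 + x $ 4 *\<^sub>R e4"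
    using independent4_basis_matrix[OF axes] by metis
  define D :: "real ^ 4 ^ 4" where "D = (\<chi> i j. if i = j then (if i = 4 then -1 else 1) else 0)"
  define M where "M = B ** D ** B'"
  have "det D = (\<Prod>i\<in>UNIV. D $ i $ i)" by (rule det_diagonal) (simp add: D_def)
  also have "\<dots> = (\<Prod>i\<in>(UNIV :: 4 set). if i = 4 then -1 else 1)" by (simp add: D_def)
  also have "\<dots> = -1" by (simp add: prod.delta)
  finally have "det D = -1" .
  moreover have "det B * det B' = 1" using arg_cong[OF BB', of det] by (simp add: det_mul)
  ultimately have "det M = -1" by (simp add: M_def det_mul algebra_simps)
  moreover have M: "M *v (B *v axis k 1) = (if k = 4 then -1 else 1) *\<^sub>R (B *v axis k 1)" for k
  proof -
    have "M *v (B *v axis k 1) = (B ** D) *v ((B' ** B) *v axis k 1)"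
      by (simp add: M_def matrix_vector_mul_assoc matrix_mul_assoc)
    also have "\<dots> = B *v (D *v axis k 1)" by (simp add: B' matrix_vector_mul_assoc)
    also have "D *v axis k 1 = (if k = 4 then -1 else 1) *\<^sub>R axis k 1"
      unfolding matrix_vector_mult_basis by (simp add: column_def D_def vec_eq_iff axis_def)
    finally show ?thesis by (simp only: matrix_vector_mult_scaleR)
  qed
  have "B *v axis 1 1 = e1" "B *v axis 2 1 = e2" "B *v axis 3 1 = e3" "B *v axis 4 1 = e4"
    by (simp_all add: B axis_def)
  then have "M *v e1 = e1 \<and> M *v e2 = e2 \<and> M *v e3 = e3 \<and> M *v e4 = - e4"
    using M[of 1] M[of 2] M[of 3] M[of 4] by simp
  ultimately show ?thesis by (intro exI[of _ M]) (simp add: orientation_reversing_def)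
qed

lemma image_span_2: "(*v) M ` span {u, v} = span {M *v u, M *v v}" for M :: "real ^ 4 ^ 4"
  by (simp add: linear_span_image[symmetric])

text \<open>
  After sliding its last line, each configuration is determined up to deformation by the orders on the axes, that is,
  by a grid. The two grids agree up to a move; if the move contains a reflection, the first configuration is deformed to
  the mirror image of the second one.
\<close>

theorem coarse_deformation_two_transversals:
  fixes \<theta> \<eta> :: "nat \<Rightarrow> real"
  assumes range: "\<And>i. i < 4 \<Longrightarrow> - (pi / 2) < \<theta> i \<and> \<theta> i < pi / 2 \<and> - (pi / 2) < \<eta> i \<and> \<eta> i < pi / 2"
    and sorted: "\<And>i j. i < j \<Longrightarrow> j < 4 \<Longrightarrow> \<theta> i < \<theta> j" and inj: "inj_on \<eta> {..<4}"
    and \<alpha>: "- (pi / 2) < \<alpha>" "\<alpha> \<le> pi / 2" "\<And>i. i < 4 \<Longrightarrow> \<theta> i \<noteq> \<alpha>"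
    and \<beta>: "- (pi / 2) < \<beta>" "\<beta> \<le> pi / 2" "\<And>i. i < 4 \<Longrightarrow> \<eta> i \<noteq> \<beta>"
    and bal: "balanced (\<lambda>i j. \<eta> i < \<eta> j) (\<lambda>i. (\<theta> i < \<alpha>) \<noteq> (\<eta> i < \<beta>))"
  shows "coarse_deformation_equivalent 5
    (insert (span {axis1 \<alpha>, e4 + (p *\<^sub>R e1 + q *\<^sub>R e2)}) ((\<lambda>i. join (\<theta> i) (\<eta> i)) ` {..<4}))
    (insert (span {axis2 \<beta>, e2 + (p' *\<^sub>R e3 + q' *\<^sub>R e4)}) ((\<lambda>i. join (\<theta> i) (\<eta> i)) ` {..<4}))"
proof -
  have inj\<theta>: "inj_on \<theta> {..<4}"
  proof (rule inj_onI)
    fix i j assume "i \<in> {..<4}" "j \<in> {..<4}" "\<theta> i = \<theta> j"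
    then show "i = j" using sorted[of i j] sorted[of j i] by (cases i j rule: linorder_cases) auto
  qed
  have \<theta>_iff: "\<theta> i < \<theta> j \<longleftrightarrow> i < j" if "i < 4" "j < 4" for i j
    using sorted[of i j] sorted[of j i] that by (cases i j rule: linorder_cases) auto
  have rank\<theta>: "rank \<theta> (\<theta> i) = i" if "i < 4" for i
  proof -
    have "{j. j < 4 \<and> \<theta> j < \<theta> i} = {..<i}" using \<theta>_iff that by auto
    then show ?thesis by (simp add: rank_def)
  qed
  have top: "rank x (pi / 2) = 4" if "\<And>i. i < 4 \<Longrightarrow> x i < pi / 2" for x
  proof -
    have "{i. i < 4 \<and> x i < pi / 2} = {..<4}" using that by auto
    then show ?thesis by (simp add: rank_def)
  qed
  define \<pi> where "\<pi> i = rank \<eta> (\<eta> i)" for i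
  define k l where "k = rank \<theta> \<alpha>" and "l = rank \<eta> \<beta>"
  have \<pi>_less: "\<pi> i < \<pi> j \<longleftrightarrow> \<eta> i < \<eta> j" if "i < 4" for i j
    unfolding \<pi>_def by (rule rank_less_iff[OF that])
  have \<pi>4: "\<pi> i < 4" if "i < 4" for i unfolding \<pi>_def by (rule rank_self[OF that])
  have inj\<pi>: "inj_on \<pi> {..<4}"
  proof (rule inj_onI)
    fix i j assume ij: "i \<in> {..<4}" "j \<in> {..<4}" and eq: "\<pi> i = \<pi> j"
    have "\<not> \<eta> i < \<eta> j" "\<not> \<eta> j < \<eta> i" using \<pi>_less[of i j] \<pi>_less[of j i] ij eq by simp_all
    then have "\<eta> i = \<eta> j" by linarith
    then show "i = j" using inj_on_eq_iff[OF inj ij] by simp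
  qed
  have k: "i < k \<longleftrightarrow> \<theta> i < \<alpha>" if "i < 4" for i
    using rank_less_iff[OF that, of \<theta> \<alpha>] rank\<theta>[OF that] by (simp add: k_def)
  have l: "\<pi> i < l \<longleftrightarrow> \<eta> i < \<beta>" if "i < 4" for i
    using rank_less_iff[OF that, of \<eta> \<beta>] by (simp add: \<pi>_def l_def)
  have "balanced (\<lambda>i j. \<pi> i < \<pi> j) (\<lambda>i. (i < k) \<noteq> (\<pi> i < l))"
    using bal by (simp add: balanced_def odd_triple_def \<pi>_less k l)
  moreover have "k < 5" "l < 5" using rank_le[of \<theta> \<alpha>] rank_le[of \<eta> \<beta>] by (simp_all add: k_def l_def)
  ultimately obtain e i0 j0 where e: "e = 1 \<or> e = 4"
    and grids: "set (grid_first \<pi> k) = set (grid_move e i0 j0 (grid_second \<pi> l))"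
    using grids_agree[OF \<pi>4 inj\<pi>] by blast
  define ext where "ext y x = (\<lambda>i::nat. if i = 4 then y else x i)" for x :: "nat \<Rightarrow> real" and y
  define extr where "extr y x = (\<lambda>i::nat. if i = 4 then rank x y else make_room (rank x y) (rank x (x i)))"
    for x :: "nat \<Rightarrow> real" and y
  note ord = extended_rank_order[OF _ _ ext_def extr_def]
  have half: "\<And>i. i < 4 \<Longrightarrow> \<theta> i \<noteq> pi / 2" "\<And>i. i < 4 \<Longrightarrow> \<eta> i \<noteq> pi / 2" using range by force+
  have ext_range: "- (pi / 2) < ext y x i \<and> ext y x i \<le> pi / 2 \<and> extr y x i < 5"
    if "i < 5" "inj_on x {..<4}" "\<And>i. i < 4 \<Longrightarrow> x i \<noteq> y"
      "\<And>i. i < 4 \<Longrightarrow> - (pi / 2) < x i \<and> x i < pi / 2" "- (pi / 2) < y" "y \<le> pi / 2" for x y i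
    using ord(2)[OF that(2,3,1)] that(4)[of i] that(1,5,6) by (auto simp: ext_def)
  have pi2: "- (pi / 2) < pi / 2" "pi / 2 \<le> pi / 2" using pi_gt_zero by auto
  have rx: "\<And>i. i < 4 \<Longrightarrow> - (pi / 2) < \<theta> i \<and> \<theta> i < pi / 2"
    and ry: "\<And>i. i < 4 \<Longrightarrow> - (pi / 2) < \<eta> i \<and> \<eta> i < pi / 2" using range by auto
  note gX = grid_path[where \<theta> = "ext \<alpha> \<theta>" and p = "extr \<alpha> \<theta>" and \<eta> = "ext (pi / 2) \<eta>" and r = "extr (pi / 2) \<eta>",
      OF ord(1)[OF inj\<theta> \<alpha>(3)] ext_range[OF _ inj\<theta> \<alpha>(3) rx \<alpha>(1,2)]
      ord(1)[OF inj half(2)] ext_range[OF _ inj half(2) ry pi2]]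
  note gY = grid_path[where \<theta> = "ext (pi / 2) \<theta>" and p = "extr (pi / 2) \<theta>" and \<eta> = "ext \<beta> \<eta>" and r = "extr \<beta> \<eta>",
      OF ord(1)[OF inj\<theta> half(1)] ext_range[OF _ inj\<theta> half(1) rx pi2]
      ord(1)[OF inj \<beta>(3)] ext_range[OF _ inj \<beta>(3) ry \<beta>(1,2)]]
  have rank_top: "rank \<theta> (pi / 2) = 4" "rank \<eta> (pi / 2) = 4" using top rx ry by auto
  have "(\<lambda>i. ((0 + extr \<alpha> \<theta> i) mod 5, (0 + 1 * extr (pi / 2) \<eta> i) mod 5)) ` {..<5} = 
      (\<lambda>i. (extr \<alpha> \<theta> i, extr (pi / 2) \<eta> i)) ` {..<5}"
    using ord(2)[OF inj\<theta> \<alpha>(3)] ord(2)[OF inj half(2)] by (intro image_cong) auto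
  also have "\<dots> = set (grid_first \<pi> k)"
    unfolding image_lessThan_5 grid_first_def using \<pi>4 rank\<theta>
    by (auto simp: extr_def k_def[symmetric] \<pi>_def[symmetric] rank_top make_room_def image_iff)
  finally have X: "(\<lambda>i. ((0 + extr \<alpha> \<theta> i) mod 5, (0 + 1 * extr (pi / 2) \<eta> i) mod 5)) ` {..<5} = set (grid_first \<pi> k)" .
  have "set (grid_second \<pi> l) = (\<lambda>i. (extr (pi / 2) \<theta> i, extr \<beta> \<eta> i)) ` {..<5}"
    unfolding image_lessThan_5 grid_second_def using rank\<theta>
    by (auto simp: extr_def l_def[symmetric] \<pi>_def[symmetric] rank_top make_room_def image_iff)
  then have Y: "set (grid_move e i0 j0 (grid_second \<pi> l)) =
      (\<lambda>i. ((i0 + extr (pi / 2) \<theta> i) mod 5, (j0 + e * extr \<beta> \<eta> i) mod 5)) ` {..<5}"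
    by (simp add: grid_move_def image_image)
  have X_path: "path_component_of (config_space 5)
      (insert (join \<alpha> (pi / 2)) ((\<lambda>i. join (\<theta> i) (\<eta> i)) ` {..<4})) (grid_line ` set (grid_first \<pi> k))"
    using gX(1)[where a = 0 and b = 0] unfolding X unfolding image_lessThan_5 by (simp add: ext_def)
  note X_slide = slide_last_line[OF range inj\<theta> inj less_imp_le[OF \<alpha>(1)] \<alpha>(2,3), of p q]
  show ?thesis
  proof (cases "e = 1")
    case True
    have Y_path: "path_component_of (config_space 5)
      (insert (join (pi / 2) \<beta>) ((\<lambda>i. join (\<theta> i) (\<eta> i)) ` {..<4})) (grid_line ` set (grid_first \<pi> k))"
      using gY(1)[where a = i0 and b = j0] unfolding grids[unfolded Y] unfolding True unfolding image_lessThan_5 by (simp add: ext_def)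
    note Y_slide = slide_last_line_dual[OF range inj\<theta> inj less_imp_le[OF \<beta>(1)] \<beta>(2,3), of p' q']
    show ?thesis unfolding coarse_deformation_equivalent_def
      using path_component_of_trans[OF path_component_of_trans[OF X_slide X_path]
          path_component_of_sym[OF path_component_of_trans[OF Y_slide Y_path]]] by blast
  next
    case False
    then have e4': "e = 4" using e by simp
    have Y_path: "path_component_of (config_space 5)
      (insert (join (pi / 2) (- \<beta>)) ((\<lambda>i. join (\<theta> i) (- \<eta> i)) ` {..<4})) (grid_line ` set (grid_first \<pi> k))"
      using gY(2)[where a = i0 and b = j0] unfolding grids[unfolded Y] unfolding e4' unfolding image_lessThan_5 by (simp add: ext_def)
    obtain M where M: "orientation_reversing M" "M *v e1 = e1" "M *v e2 = e2" "M *v e3 = e3" "M *v e4 = - e4"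
      using reflection_exists by blast
    have MP: "M *v axis1 x = axis1 x" and MQ: "M *v axis2 x = axis2 (- x)" for x
      by (simp_all add: axis1_def axis2_def matrix_vector_right_distrib matrix_vector_mult_scaleR M)
    have mirrored: "(\<lambda>L. (*v) M ` L) ` 
        insert (span {axis2 \<beta>, e2 + (p' *\<^sub>R e3 + q' *\<^sub>R e4)}) ((\<lambda>i. join (\<theta> i) (\<eta> i)) ` {..<4}) =
        insert (span {axis2 (- \<beta>), e2 + (p' *\<^sub>R e3 + (- q') *\<^sub>R e4)}) ((\<lambda>i. join (\<theta> i) (- \<eta> i)) ` {..<4})"
      by (simp add: image_image image_span_2 join_def MP MQ matrix_vector_right_distrib
          matrix_vector_mult_scaleR M)
    have Y_slide: "path_component_of (config_space 5)
        (insert (span {axis2 (- \<beta>), e2 + (p' *\<^sub>R e3 + (- q') *\<^sub>R e4)}) ((\<lambda>i. join (\<theta> i) (- \<eta> i)) ` {..<4}))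
        (insert (join (pi / 2) (- \<beta>)) ((\<lambda>i. join (\<theta> i) (- \<eta> i)) ` {..<4}))"
    proof (rule slide_last_line_dual[OF _ inj\<theta>])
      show "inj_on (\<lambda>i. - \<eta> i) {..<4}" using inj by (simp add: inj_on_def)
    qed (use range \<beta> in force)+
    have "path_component_of (config_space 5)
      (insert (span {axis1 \<alpha>, e4 + (p *\<^sub>R e1 + q *\<^sub>R e2)}) ((\<lambda>i. join (\<theta> i) (\<eta> i)) ` {..<4}))
      ((\<lambda>L. (*v) M ` L) ` insert (span {axis2 \<beta>, e2 + (p' *\<^sub>R e3 + q' *\<^sub>R e4)}) ((\<lambda>i. join (\<theta> i) (\<eta> i)) ` {..<4}))"
      unfolding mirrored
      using path_component_of_trans[OF path_component_of_trans[OF X_slide X_path]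
          path_component_of_sym[OF path_component_of_trans[OF Y_slide Y_path]]] .
    then show ?thesis
      unfolding coarse_deformation_equivalent_def mirror_partner_def using M(1) by blast
  qed
qed

end

section \<open>Signs from quadratic relations\<close>

text \<open>
  The left factor is the determinant of three points \<open>(u, w)\<close>, and divided by the Vandermonde product it is the second
  divided difference of \<open>w\<close>. For \<open>w\<close> a quotient of a quadratic polynomial by \<open>s1 * u - s2\<close>, this difference is the value
  of the homogenised quadratic polynomial at the pole, divided by the three denominators; that value is the same for
  all triples.
\<close>

lemma quadratic_triple_identity:
  fixes u\<^sub>i u\<^sub>j u\<^sub>k w\<^sub>i w\<^sub>j w\<^sub>k s1 s2 a b c :: real
  assumes "(s1 * u\<^sub>i - s2) * w\<^sub>i = a * u\<^sub>i\<^sup>2 + b * u\<^sub>i + c" "(s1 * u\<^sub>j - s2) * w\<^sub>j = a * u\<^sub>j\<^sup>2 + b * u\<^sub>j + c"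
    "(s1 * u\<^sub>k - s2) * w\<^sub>k = a * u\<^sub>k\<^sup>2 + b * u\<^sub>k + c"
  shows "(w\<^sub>i * (u\<^sub>k - u\<^sub>j) - w\<^sub>j * (u\<^sub>k - u\<^sub>i) + w\<^sub>k * (u\<^sub>j - u\<^sub>i)) *
      ((s1 * u\<^sub>i - s2) * (s1 * u\<^sub>j - s2) * (s1 * u\<^sub>k - s2)) =
    (a * s2\<^sup>2 + b * s1 * s2 + c * s1\<^sup>2) * ((u\<^sub>j - u\<^sub>i) * (u\<^sub>k - u\<^sub>i) * (u\<^sub>k - u\<^sub>j))"
proof -
  have "(w\<^sub>i * (u\<^sub>k - u\<^sub>j) - w\<^sub>j * (u\<^sub>k - u\<^sub>i) + w\<^sub>k * (u\<^sub>j - u\<^sub>i)) *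
      ((s1 * u\<^sub>i - s2) * (s1 * u\<^sub>j - s2) * (s1 * u\<^sub>k - s2)) =
    ((s1 * u\<^sub>i - s2) * w\<^sub>i) * (u\<^sub>k - u\<^sub>j) * (s1 * u\<^sub>j - s2) * (s1 * u\<^sub>k - s2)
    - ((s1 * u\<^sub>j - s2) * w\<^sub>j) * (u\<^sub>k - u\<^sub>i) * (s1 * u\<^sub>i - s2) * (s1 * u\<^sub>k - s2)
    + ((s1 * u\<^sub>k - s2) * w\<^sub>k) * (u\<^sub>j - u\<^sub>i) * (s1 * u\<^sub>i - s2) * (s1 * u\<^sub>j - s2)"
    by (simp add: algebra_simps)
  also have "\<dots> = (a * s2\<^sup>2 + b * s1 * s2 + c * s1\<^sup>2) * ((u\<^sub>j - u\<^sub>i) * (u\<^sub>k - u\<^sub>i) * (u\<^sub>k - u\<^sub>j))"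
    unfolding assms by (simp add: algebra_simps power2_eq_square)
  finally show ?thesis .
qed

lemma mult_less_0_iff_neq: "x \<noteq> 0 \<Longrightarrow> y \<noteq> 0 \<Longrightarrow> x * y < 0 \<longleftrightarrow> ((x < 0) \<noteq> (y < 0))" for x y :: real
  by (auto simp: mult_less_0_iff)

text \<open>
  Exchanging \<open>u\<close> and \<open>w\<close> changes the sign of the determinant of three points. So \<open>quadratic_triple_identity\<close>, applied
  in both ways, gives the sign of the product of the two Vandermonde products and all six linear factors, and this
  sign is opposite to that of the product \<open>K * K'\<close> of the values at the two poles, whatever the triple.
\<close>

lemma balanced_if_quadratics:
  fixes u w :: "nat \<Rightarrow> real"
  assumes sorted: "\<And>i j. i < j \<Longrightarrow> j < 4 \<Longrightarrow> u i < u j"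
    and inj: "inj_on w {..<4}"
    and s: "\<And>i. i < 4 \<Longrightarrow> (s1 * u i - s2) * w i = a * (u i)\<^sup>2 + b * u i + c"
      "a * s2\<^sup>2 + b * s1 * s2 + c * s1\<^sup>2 \<noteq> 0" "\<And>i. i < 4 \<Longrightarrow> s1 * u i - s2 \<noteq> 0"
    and t: "\<And>i. i < 4 \<Longrightarrow> (t1 * w i - t2) * u i = a' * (w i)\<^sup>2 + b' * w i + c'"
      "a' * t2\<^sup>2 + b' * t1 * t2 + c' * t1\<^sup>2 \<noteq> 0" "\<And>i. i < 4 \<Longrightarrow> t1 * w i - t2 \<noteq> 0"
  shows "balanced (\<lambda>i j. w i < w j) (\<lambda>i. (s1 * u i - s2 < 0) \<noteq> (t1 * w i - t2 < 0))"
proof -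
  define K where "K = a * s2\<^sup>2 + b * s1 * s2 + c * s1\<^sup>2"
  define K' where "K' = a' * t2\<^sup>2 + b' * t1 * t2 + c' * t1\<^sup>2"
  define S T where "S i = s1 * u i - s2" and "T i = t1 * w i - t2" for i
  have ne: "S i \<noteq> 0" "T i \<noteq> 0" if "i < 4" for i using s(3) t(3) that by (auto simp: S_def T_def)
  have w_ne: "w i \<noteq> w j" if "i < j" "j < 4" for i j using inj_on_eq_iff[OF inj, of i j] that by auto
  have "odd_triple (\<lambda>i j. w i < w j) (\<lambda>i. (S i < 0) \<noteq> (T i < 0)) i j k \<longleftrightarrow> K * K' < 0"
    if ijk: "i < j" "j < k" "k < 4" for i j k
  proof -
    have lt: "i < 4" "j < 4" "k < 4" using ijk by auto
    define V where "V = (u j - u i) * (u k - u i) * (u k - u j)"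
    define W where "W = (w j - w i) * (w k - w i) * (w k - w j)"
    define D where "D = w i * (u k - u j) - w j * (u k - u i) + w k * (u j - u i)"
    have V: "V > 0" using sorted ijk by (auto simp: V_def intro!: mult_pos_pos)
    have W: "W \<noteq> 0" using w_ne ijk unfolding W_def by (metis (no_types) eq_iff_diff_eq_0 mult_eq_0_iff order_less_trans)
    have 1: "D * (S i * S j * S k) = K * V"
      using quadratic_triple_identity[OF s(1)[OF lt(1)] s(1)[OF lt(2)] s(1)[OF lt(3)]]
      by (simp add: D_def S_def K_def V_def)
    have "(u i * (w k - w j) - u j * (w k - w i) + u k * (w j - w i)) * (T i * T j * T k) = K' * W"
      using quadratic_triple_identity[OF t(1)[OF lt(1)] t(1)[OF lt(2)] t(1)[OF lt(3)]]
      by (simp add: T_def K'_def W_def)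
    moreover have "u i * (w k - w j) - u j * (w k - w i) + u k * (w j - w i) = - D"
      by (simp add: D_def algebra_simps)
    ultimately have 2: "- D * (T i * T j * T k) = K' * W" by simp
    have K: "K \<noteq> 0" "K' \<noteq> 0" using s(2) t(2) by (simp_all add: K_def K'_def)
    then have "K * V \<noteq> 0" using V by auto
    then have D: "D \<noteq> 0" using 1 by auto
    \<comment> \<open>The positive factor \<open>V\<close> is left out of \<open>Z\<close>, whose sign decides the twisted linking parity.\<close>
    define Z where "Z = W * (S i * S j * S k * (T i * T j * T k))"
    have "(K * K') * (V * W\<^sup>2) = (K * V) * (K' * W) * W" by (simp add: power2_eq_square)
    also have "\<dots> = - (D\<^sup>2) * Z" unfolding 1[symmetric] 2[symmetric] Z_def by (simp add: power2_eq_square)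
    finally have "(K * K') * (V * W\<^sup>2) = - (D\<^sup>2 * Z)" by simp
    moreover have pos: "V * W\<^sup>2 > 0" "D\<^sup>2 > 0" using V W D by auto
    moreover have "K * K' < 0 \<longleftrightarrow> (K * K') * (V * W\<^sup>2) < 0" using mult_less_cancel_right_pos[OF pos(1), of "K * K'" 0] by simp
    ultimately have "K * K' < 0 \<longleftrightarrow> 0 < D\<^sup>2 * Z" by simp
    also have "\<dots> \<longleftrightarrow> 0 < Z" using pos(2) by (simp add: zero_less_mult_iff)
    also have "\<dots> \<longleftrightarrow> \<not> Z < 0"
    proof -
      have "Z \<noteq> 0" using W ne[OF lt(1)] ne[OF lt(2)] ne[OF lt(3)] by (simp add: Z_def)
      then show ?thesis by linarith
    qed
    finally have KZ: "K * K' < 0 \<longleftrightarrow> \<not> Z < 0" .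
    have nes: "S i \<noteq> 0" "S j \<noteq> 0" "S k \<noteq> 0" "T i \<noteq> 0" "T j \<noteq> 0" "T k \<noteq> 0" 
      "w j - w i \<noteq> 0" "w k - w i \<noteq> 0" "w k - w j \<noteq> 0"
      using ne lt w_ne[of i j] w_ne[of i k] w_ne[of j k] ijk by auto
    have "Z < 0 \<longleftrightarrow> ((((w j - w i < 0) \<noteq> (w k - w i < 0)) \<noteq> (w k - w j < 0)) \<noteq>
        ((((S i < 0) \<noteq> (S j < 0)) \<noteq> (S k < 0)) \<noteq> (((T i < 0) \<noteq> (T j < 0)) \<noteq> (T k < 0))))"
      unfolding Z_def W_def using nes by (simp only: mult_less_0_iff_neq mult_eq_0_iff simp_thms)
    moreover have "w j - w i < 0 \<longleftrightarrow> \<not> w i < w j" "w k - w i < 0 \<longleftrightarrow> \<not> w i < w k" "w k - w j < 0 \<longleftrightarrow> \<not> w j < w k"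
      using nes by linarith+
    ultimately show ?thesis unfolding KZ odd_triple_def by argo
  qed
  then show ?thesis by (simp add: balanced_def S_def T_def)
qed

lemma ex_sorting:
  fixes u :: "nat \<Rightarrow> real"
  assumes "inj_on u {..<n}"
  shows "\<exists>g. bij_betw g {..<n} {..<n} \<and> (\<forall>i j. i < j \<longrightarrow> j < n \<longrightarrow> u (g i) < u (g j))"
proof -
  define l where "l = sorted_list_of_set (u ` {..<n})"
  have l: "sorted_wrt (<) l" "set l = u ` {..<n}" "length l = n"
    using assms by (simp_all add: l_def card_image)
  define g where "g i = inv_into {..<n} u (l ! i)" for i
  have g: "g i < n" "u (g i) = l ! i" if "i < n" for i
  proof -
    have mem: "l ! i \<in> u ` {..<n}" using that nth_mem[of i l] unfolding l(2,3) by simp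
    show "g i < n" using inv_into_into[OF mem] by (simp add: g_def)
    show "u (g i) = l ! i" unfolding g_def by (rule f_inv_into_f[OF mem])
  qed
  have less: "u (g i) < u (g j)" if "i < j" "j < n" for i j
    using l(1,3) that g[of i] g[of j] by (simp add: sorted_wrt_iff_nth_less)
  have "inj_on g {..<n}"
  proof (rule inj_onI)
    fix i j assume ij: "i \<in> {..<n}" "j \<in> {..<n}" "g i = g j"
    show "i = j"
    proof (rule linorder_cases[of i j])
      assume "i < j" with less[of i j] ij show ?thesis by simp
    next
      assume "j < i" with less[of j i] ij show ?thesis by simp
    qed
  qed
  moreover from this have "g ` {..<n} = {..<n}" by (intro endo_inj_surj) (auto intro: g(1))
  ultimately show ?thesis using less by (auto simp: bij_betw_def)
qed

lemma ex_half_circle_angle: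
  assumes "x \<noteq> 0 \<or> y \<noteq> (0::real)"
  shows "\<exists>\<alpha> \<rho>. - (pi / 2) < \<alpha> \<and> \<alpha> \<le> pi / 2 \<and> \<rho> \<noteq> 0 \<and> x = \<rho> * cos \<alpha> \<and> y = \<rho> * sin \<alpha>"
proof (cases "x = 0")
  case True
  then show ?thesis using assms by (intro exI[of _ "pi / 2"] exI[of _ y]) (use pi_gt_zero in auto)
next
  case False
  have c: "cos (arctan (y / x)) \<noteq> 0" by (rule cos_arctan_not_zero)
  moreover have "tan (arctan (y / x)) = y / x" by (rule tan_arctan)
  ultimately have "sin (arctan (y / x)) = y / x * cos (arctan (y / x))"
    by (simp add: tan_def field_simps)
  then show ?thesis using False c arctan_bounded[of "y / x"]
    by (intro exI[of _ "arctan (y / x)"] exI[of _ "x / cos (arctan (y / x))"]) (auto simp: less_imp_le)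
qed

lemma slope_sign:
  assumes "- (pi / 2) < \<alpha>" "\<alpha> \<le> pi / 2"
  shows "cos \<alpha> * x - sin \<alpha> < 0 \<longleftrightarrow> arctan x < \<alpha>" and "cos \<alpha> * x - sin \<alpha> = 0 \<longleftrightarrow> arctan x = \<alpha>"
proof -
  define \<theta> where "\<theta> = arctan x"
  have b: "- (pi / 2) < \<theta>" "\<theta> < pi / 2" using arctan_bounded[of x] by (simp_all add: \<theta>_def)
  have c: "cos \<theta> > 0" using b by (intro cos_gt_zero_pi) auto
  have "x * cos \<theta> = sin \<theta>"
    using tan_arctan[of x] c unfolding \<theta>_def[symmetric] by (simp add: tan_def field_simps)
  then have eq: "(cos \<alpha> * x - sin \<alpha>) * cos \<theta> = sin (\<theta> - \<alpha>)"
    by (simp add: sin_diff algebra_simps)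
  consider "\<theta> < \<alpha>" | "\<theta> = \<alpha>" | "\<theta> > \<alpha>" by linarith
  then have "(cos \<alpha> * x - sin \<alpha> < 0 \<longleftrightarrow> \<theta> < \<alpha>) \<and> (cos \<alpha> * x - sin \<alpha> = 0 \<longleftrightarrow> \<theta> = \<alpha>)"
  proof cases
    case 1
    then have "sin (\<alpha> - \<theta>) > 0" using assms b by (intro sin_gt_zero) auto
    moreover have "sin (\<theta> - \<alpha>) = - sin (\<alpha> - \<theta>)" by (simp add: sin_diff)
    ultimately have "(cos \<alpha> * x - sin \<alpha>) * cos \<theta> < 0" using eq by simp
    then show ?thesis using 1 c by (auto simp: mult_less_0_iff)
  next
    case 2
    then show ?thesis using eq c by simp
  next
    case 3
    then have "sin (\<theta> - \<alpha>) > 0" using assms b by (intro sin_gt_zero) auto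
    then have "(cos \<alpha> * x - sin \<alpha>) * cos \<theta> > 0" using eq by simp
    then show ?thesis using 3 c by (auto simp: zero_less_mult_iff)
  qed
  then show "cos \<alpha> * x - sin \<alpha> < 0 \<longleftrightarrow> arctan x < \<alpha>" "cos \<alpha> * x - sin \<alpha> = 0 \<longleftrightarrow> arctan x = \<alpha>"
    by (auto simp: \<theta>_def)
qed

context axis_pair begin

definition slope_line where "slope_line x y = span {e1 + x *\<^sub>R e2, e3 + y *\<^sub>R e4}"

lemma join_arctan: "join (arctan x) (arctan y) = slope_line x y"
proof -
  have c: "cos (arctan z) \<noteq> 0" for z :: real by (rule cos_arctan_not_zero)
  have s: "sin (arctan z) = cos (arctan z) * z" for z :: real
    using tan_arctan[of z] c[of z] by (simp add: tan_def field_simps)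
  have "axis1 (arctan x) = cos (arctan x) *\<^sub>R (e1 + x *\<^sub>R e2)" "axis2 (arctan y) = cos (arctan y) *\<^sub>R (e3 + y *\<^sub>R e4)"
    by (simp_all add: axis1_def axis2_def s scaleR_add_right)
  then show ?thesis using c by (simp add: join_def slope_line_def span_2_scale)
qed

text \<open>
  The homogeneous coordinates \<open>(s1, s2)\<close> and \<open>(t1, t2)\<close> admit the case that \<open>s\<close> or \<open>t\<close> is at infinity as well. It
  occurs when three coplanar lines of the cubic surface pass through one point.
\<close>

lemma coarse_deformation_slopes_sorted:
  fixes u w :: "nat \<Rightarrow> real"
  assumes sorted: "\<And>i j. i < j \<Longrightarrow> j < 4 \<Longrightarrow> u i < u j"
    and inj: "inj_on w {..<4}"
    and s: "s1 \<noteq> 0 \<or> s2 \<noteq> 0" "\<And>i. i < 4 \<Longrightarrow> (s1 * u i - s2) * w i = a * (u i)\<^sup>2 + b * u i + c"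
      "a * s2\<^sup>2 + b * s1 * s2 + c * s1\<^sup>2 \<noteq> 0" "\<And>i. i < 4 \<Longrightarrow> s1 * u i - s2 \<noteq> 0"
    and t: "t1 \<noteq> 0 \<or> t2 \<noteq> 0" "\<And>i. i < 4 \<Longrightarrow> (t1 * w i - t2) * u i = a' * (w i)\<^sup>2 + b' * w i + c'"
      "a' * t2\<^sup>2 + b' * t1 * t2 + c' * t1\<^sup>2 \<noteq> 0" "\<And>i. i < 4 \<Longrightarrow> t1 * w i - t2 \<noteq> 0"
  shows "coarse_deformation_equivalent 5
    (insert (span {s1 *\<^sub>R e1 + s2 *\<^sub>R e2, e4 + (p *\<^sub>R e1 + q *\<^sub>R e2)}) ((\<lambda>i. slope_line (u i) (w i)) ` {..<4}))
    (insert (span {t1 *\<^sub>R e3 + t2 *\<^sub>R e4, e2 + (p' *\<^sub>R e3 + q' *\<^sub>R e4)}) ((\<lambda>i. slope_line (u i) (w i)) ` {..<4}))"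
proof -
  obtain \<alpha> \<rho> where \<alpha>: "- (pi / 2) < \<alpha>" "\<alpha> \<le> pi / 2" and \<rho>: "\<rho> \<noteq> 0" "s1 = \<rho> * cos \<alpha>" "s2 = \<rho> * sin \<alpha>"
    using ex_half_circle_angle[OF s(1)] by blast
  obtain \<beta> \<kappa> where \<beta>: "- (pi / 2) < \<beta>" "\<beta> \<le> pi / 2" and \<kappa>: "\<kappa> \<noteq> 0" "t1 = \<kappa> * cos \<beta>" "t2 = \<kappa> * sin \<beta>"
    using ex_half_circle_angle[OF t(1)] by blast
  have S: "s1 * x - s2 = \<rho> * (cos \<alpha> * x - sin \<alpha>)" and T: "t1 * x - t2 = \<kappa> * (cos \<beta> * x - sin \<beta>)" for x
    by (simp_all add: \<rho> \<kappa> algebra_simps)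
  have "balanced (\<lambda>i j. w i < w j) (\<lambda>i. (cos \<alpha> * u i - sin \<alpha> < 0) \<noteq> (cos \<beta> * w i - sin \<beta> < 0))"
  proof (rule balanced_if_quadratics[OF sorted inj, where a = "a / \<rho>" and b = "b / \<rho>" and c = "c / \<rho>"
        and a' = "a' / \<kappa>" and b' = "b' / \<kappa>" and c' = "c' / \<kappa>"])
    show "(cos \<alpha> * u i - sin \<alpha>) * w i = a / \<rho> * (u i)\<^sup>2 + b / \<rho> * u i + c / \<rho>" if "i < 4" for i
      using s(2)[OF that] \<rho>(1) unfolding S by (simp add: field_simps)
    show "(cos \<beta> * w i - sin \<beta>) * u i = a' / \<kappa> * (w i)\<^sup>2 + b' / \<kappa> * w i + c' / \<kappa>" if "i < 4" for i
      using t(2)[OF that] \<kappa>(1) unfolding T by (simp add: field_simps)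
    have "a * s2\<^sup>2 + b * s1 * s2 + c * s1\<^sup>2 = \<rho> ^ 3 * (a / \<rho> * (sin \<alpha>)\<^sup>2 + b / \<rho> * cos \<alpha> * sin \<alpha> + c / \<rho> * (cos \<alpha>)\<^sup>2)"
      using \<rho>(1) unfolding \<rho>(2,3) by (simp add: field_simps power2_eq_square power3_eq_cube)
    then show "a / \<rho> * (sin \<alpha>)\<^sup>2 + b / \<rho> * cos \<alpha> * sin \<alpha> + c / \<rho> * (cos \<alpha>)\<^sup>2 \<noteq> 0" using s(3) by auto
    have "a' * t2\<^sup>2 + b' * t1 * t2 + c' * t1\<^sup>2 = \<kappa> ^ 3 * (a' / \<kappa> * (sin \<beta>)\<^sup>2 + b' / \<kappa> * cos \<beta> * sin \<beta> + c' / \<kappa> * (cos \<beta>)\<^sup>2)"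
      using \<kappa>(1) unfolding \<kappa>(2,3) by (simp add: field_simps power2_eq_square power3_eq_cube)
    then show "a' / \<kappa> * (sin \<beta>)\<^sup>2 + b' / \<kappa> * cos \<beta> * sin \<beta> + c' / \<kappa> * (cos \<beta>)\<^sup>2 \<noteq> 0" using t(3) by auto
    show "cos \<alpha> * u i - sin \<alpha> \<noteq> 0" "cos \<beta> * w i - sin \<beta> \<noteq> 0" if "i < 4" for i
      using s(4)[OF that] t(4)[OF that] unfolding S T by auto
  qed auto
  then have bal: "balanced (\<lambda>i j. arctan (w i) < arctan (w j)) (\<lambda>i. (arctan (u i) < \<alpha>) \<noteq> (arctan (w i) < \<beta>))"
    unfolding slope_sign(1)[OF \<alpha>] slope_sign(1)[OF \<beta>] arctan_less_iff .
  have "arctan (u i) \<noteq> \<alpha>" "arctan (w i) \<noteq> \<beta>" if "i < 4" for i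
    using s(4)[OF that] t(4)[OF that] slope_sign(2)[OF \<alpha>, of "u i"] slope_sign(2)[OF \<beta>, of "w i"] unfolding S T by auto
  then have "coarse_deformation_equivalent 5
    (insert (span {axis1 \<alpha>, e4 + (p *\<^sub>R e1 + q *\<^sub>R e2)}) ((\<lambda>i. join (arctan (u i)) (arctan (w i))) ` {..<4}))
    (insert (span {axis2 \<beta>, e2 + (p' *\<^sub>R e3 + q' *\<^sub>R e4)}) ((\<lambda>i. join (arctan (u i)) (arctan (w i))) ` {..<4}))"
    by (intro coarse_deformation_two_transversals[OF _ _ _ \<alpha> _ \<beta> _ bal])
      (use arctan_bounded sorted inj in \<open>auto simp: arctan_less_iff arctan_eq_iff inj_on_def\<close>)
  moreover have "span {axis1 \<alpha>, v} = span {s1 *\<^sub>R e1 + s2 *\<^sub>R e2, v}" "span {axis2 \<beta>, v} = span {t1 *\<^sub>R e3 + t2 *\<^sub>R e4, v}" for v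
    using span_2_scale[of \<rho> 1 "axis1 \<alpha>" v] span_2_scale[of \<kappa> 1 "axis2 \<beta>" v] \<rho> \<kappa>
    by (simp_all add: axis1_def axis2_def scaleR_add_right)
  ultimately show ?thesis by (simp add: join_arctan)
qed

theorem coarse_deformation_slopes:
  fixes u w :: "nat \<Rightarrow> real"
  assumes inj: "inj_on u {..<4}" "inj_on w {..<4}"
    and s: "s1 \<noteq> 0 \<or> s2 \<noteq> 0" "\<And>i. i < 4 \<Longrightarrow> (s1 * u i - s2) * w i = a * (u i)\<^sup>2 + b * u i + c"
      "a * s2\<^sup>2 + b * s1 * s2 + c * s1\<^sup>2 \<noteq> 0" "\<And>i. i < 4 \<Longrightarrow> s1 * u i - s2 \<noteq> 0"
    and t: "t1 \<noteq> 0 \<or> t2 \<noteq> 0" "\<And>i. i < 4 \<Longrightarrow> (t1 * w i - t2) * u i = a' * (w i)\<^sup>2 + b' * w i + c'"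
      "a' * t2\<^sup>2 + b' * t1 * t2 + c' * t1\<^sup>2 \<noteq> 0" "\<And>i. i < 4 \<Longrightarrow> t1 * w i - t2 \<noteq> 0"
  shows "coarse_deformation_equivalent 5
    (insert (span {s1 *\<^sub>R e1 + s2 *\<^sub>R e2, e4 + (p *\<^sub>R e1 + q *\<^sub>R e2)}) ((\<lambda>i. slope_line (u i) (w i)) ` {..<4}))
    (insert (span {t1 *\<^sub>R e3 + t2 *\<^sub>R e4, e2 + (p' *\<^sub>R e3 + q' *\<^sub>R e4)}) ((\<lambda>i. slope_line (u i) (w i)) ` {..<4}))"
proof -
  obtain g :: "nat \<Rightarrow> nat" where g: "bij_betw g {..<4} {..<4}"
    and sorted': "\<forall>i j. i < j \<longrightarrow> j < 4 \<longrightarrow> u (g i) < u (g j)"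
    using ex_sorting[OF inj(1)] by (elim exE conjE)
  have sorted: "u (g i) < u (g j)" if "i < j" "j < 4" for i j
    using sorted' that by simp
  have img: "g ` {..<4} = {..<4}" and injg: "inj_on g {..<4}" using g by (simp_all add: bij_betw_def)
  have g4: "g i < 4" if "i < 4" for i using bij_betwE[OF g] that by simp
  have "inj_on w (g ` {..<4})" unfolding img by (rule inj(2))
  then have "inj_on (w \<circ> g) {..<4}" by (rule comp_inj_on[OF injg])
  then have "inj_on (\<lambda>i. w (g i)) {..<4}" by (simp add: o_def)
  note coarse_deformation_slopes_sorted[OF sorted this s(1) s(2)[OF g4] s(3) s(4)[OF g4] t(1) t(2)[OF g4] t(3) t(4)[OF g4], of p q p' q']
  moreover have "(\<lambda>i. slope_line (u (g i)) (w (g i))) ` {..<4} = (\<lambda>i. slope_line (u i) (w i)) ` {..<4}"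
    using image_image[of "\<lambda>i. slope_line (u i) (w i)" g "{..<4}"] unfolding img by (rule sym)
  ultimately show ?thesis by (simp only:)
qed

end

section \<open>Smooth cubic forms vanishing on three skew lines\<close>

lemma cramer_2:
  fixes a b :: "'a::idom"
  assumes "p1 * q2 - p2 * q1 \<noteq> 0" "p1 * a + q1 * b = 0" "p2 * a + q2 * b = 0"
  shows "a = 0 \<and> b = 0"
proof -
  have "(p1 * q2 - p2 * q1) * a = q2 * (p1 * a + q1 * b) - q1 * (p2 * a + q2 * b)"
    "(p1 * q2 - p2 * q1) * b = p1 * (p2 * a + q2 * b) - p2 * (p1 * a + q1 * b)"
    by (simp_all add: algebra_simps)
  then show ?thesis unfolding assms(2,3) using assms(1) by simp
qed

text \<open>
  The polarisation of a cubic form \<open>F\<close>: then \<open>F x = T x x x\<close>, and \<open>T x x v\<close> is a third of the derivative of \<open>F\<close> at \<open>x\<close>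
  in the direction \<open>v\<close>.
\<close>

locale trilinear_form =
  fixes T :: "complex ^ 4 \<Rightarrow> complex ^ 4 \<Rightarrow> complex ^ 4 \<Rightarrow> complex"
  assumes add1: "T (x + y) z w = T x z w + T y z w"
    and scale1: "T (c *s x) z w = c * T x z w"
    and swap12: "T x y z = T y x z"
    and swap23: "T x y z = T x z y"
begin

lemma add2: "T z (x + y) w = T z x w + T z y w" using add1 swap12 by metis
lemma add3: "T z w (x + y) = T z w x + T z w y" using add2 swap23 by metis
lemma scale2: "T z (c *s x) w = c * T z x w" using scale1 swap12 by metis
lemma scale3: "T z w (c *s x) = c * T z w x" using scale2 swap23 by metis
lemma diff1: "T (x - y) z w = T x z w - T y z w"
  using add1[of "x - y" y z w] by simp
lemma diff2: "T z (x - y) w = T z x w - T z y w" using diff1 swap12 by metis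
lemma diff3: "T z w (x - y) = T z w x - T z w y" using diff2 swap23 by metis

lemmas multilinear = add1 add2 add3 scale1 scale2 scale3 diff1 diff2 diff3

text \<open>
  Up to binomial factors, these are the coefficients of the cubic form on the span of \<open>v\<close> and \<open>w\<close>.
\<close>

definition vanishes :: "complex ^ 4 \<Rightarrow> complex ^ 4 \<Rightarrow> bool" where
  "vanishes v w \<longleftrightarrow> T v v v = 0 \<and> T v v w = 0 \<and> T v w w = 0 \<and> T w w w = 0"

lemma vanishes_if_form_vanishes:
  assumes "\<And>\<alpha> \<beta>. T (\<alpha> *s v + \<beta> *s w) (\<alpha> *s v + \<beta> *s w) (\<alpha> *s v + \<beta> *s w) = 0"
  shows "vanishes v w"
proof -
  have eq: "\<alpha> ^ 3 * T v v v + 3 * \<alpha>\<^sup>2 * \<beta> * T v v w + 3 * \<alpha> * \<beta>\<^sup>2 * T v w w + \<beta> ^ 3 * T w w w = 0" for \<alpha> \<beta>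
    using assms[of \<alpha> \<beta>] by (simp add: multilinear swap12[of w v] swap23[of _ w v] algebra_simps power2_eq_square power3_eq_cube)
  have 1: "T v v v = 0" "T w w w = 0" using eq[of 1 0] eq[of 0 1] by simp_all
  have "T v v w + T v w w = 0" "T v v w - T v w w = 0"
    using eq[of 1 1] eq[of 1 "-1"] 1 by (simp_all add: algebra_simps)
  then have "T v v w = 0" "T v w w = 0" by (simp_all add: eq_neg_iff_add_eq_0)
  with 1 show ?thesis by (simp add: vanishes_def)
qed

lemma vanishes_combination:
  assumes "vanishes v w"
  shows "vanishes (a *s v + b *s w) (c *s v + d *s w)"
  using assms by (simp add: vanishes_def multilinear swap12[of w v] swap23[of _ w v])

text \<open>
  No nonzero combination of the frame is a singular point. As \<open>z = 0\<close> satisfies all four equations, this includes the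
  linear independence of the frame.
\<close>

definition smooth_frame where
  "smooth_frame X1 X2 Y1 Y2 \<longleftrightarrow> (\<forall>x1 x2 y1 y2 z. z = x1 *s X1 + x2 *s X2 + y1 *s Y1 + y2 *s Y2 \<longrightarrow>
     T z z X1 = 0 \<longrightarrow> T z z X2 = 0 \<longrightarrow> T z z Y1 = 0 \<longrightarrow> T z z Y2 = 0 \<longrightarrow> x1 = 0 \<and> x2 = 0 \<and> y1 = 0 \<and> y2 = 0)"

text \<open>
  Three pairwise skew lines on the surface, spanned by \<open>X1\<close>, \<open>X2\<close>, by \<open>Y1\<close>, \<open>Y2\<close> and by their sums. A fourth line
  skew to the second one is the graph of a linear map from the first line to the second; its matrix has the rows
  \<open>(a, b)\<close> and \<open>(c, d)\<close>.
\<close>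

definition cubic_frame where
  "cubic_frame X1 X2 Y1 Y2 \<longleftrightarrow> smooth_frame X1 X2 Y1 Y2 \<and>
     vanishes X1 X2 \<and> vanishes Y1 Y2 \<and> vanishes (X1 + Y1) (X2 + Y2)"

definition graph_in_cubic where
  "graph_in_cubic X1 X2 Y1 Y2 a b c d \<longleftrightarrow> vanishes (X1 + a *s Y1 + c *s Y2) (X2 + b *s Y1 + d *s Y2)"

lemma smooth_frameD:
  assumes "smooth_frame X1 X2 Y1 Y2" "z = x1 *s X1 + x2 *s X2 + y1 *s Y1 + y2 *s Y2"
    "T z z X1 = 0" "T z z X2 = 0" "T z z Y1 = 0" "T z z Y2 = 0"
  shows "x1 = 0 \<and> x2 = 0 \<and> y1 = 0 \<and> y2 = 0"
  using assms unfolding smooth_frame_def by blast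

lemma smooth_frame_change:
  assumes S: "smooth_frame X1 X2 Y1 Y2" and d: "p1 * q2 - p2 * q1 \<noteq> 0"
  shows "smooth_frame (p1 *s X1 + p2 *s X2) (q1 *s X1 + q2 *s X2) (p1 *s Y1 + p2 *s Y2) (q1 *s Y1 + q2 *s Y2)"
  unfolding smooth_frame_def
proof (intro allI impI)
  fix x1 x2 y1 y2 z
  assume z: "z = x1 *s (p1 *s X1 + p2 *s X2) + x2 *s (q1 *s X1 + q2 *s X2)
      + y1 *s (p1 *s Y1 + p2 *s Y2) + y2 *s (q1 *s Y1 + q2 *s Y2)"
    and h: "T z z (p1 *s X1 + p2 *s X2) = 0" "T z z (q1 *s X1 + q2 *s X2) = 0"
      "T z z (p1 *s Y1 + p2 *s Y2) = 0" "T z z (q1 *s Y1 + q2 *s Y2) = 0"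
  have d': "p1 * q2 - q1 * p2 \<noteq> 0" using d by (simp add: mult.commute)
  have "T z z X1 = 0 \<and> T z z X2 = 0" "T z z Y1 = 0 \<and> T z z Y2 = 0"
    using h by (intro cramer_2[OF d']; simp add: add3 scale3)+
  moreover have "z = (p1 * x1 + q1 * x2) *s X1 + (p2 * x1 + q2 * x2) *s X2
      + (p1 * y1 + q1 * y2) *s Y1 + (p2 * y1 + q2 * y2) *s Y2"
    unfolding z by (simp add: vec_eq_iff algebra_simps)
  ultimately have "p1 * x1 + q1 * x2 = 0" "p2 * x1 + q2 * x2 = 0" "p1 * y1 + q1 * y2 = 0" "p2 * y1 + q2 * y2 = 0"
    using smooth_frameD[OF S] by blast+
  then show "x1 = 0 \<and> x2 = 0 \<and> y1 = 0 \<and> y2 = 0" using cramer_2[OF d] by blast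
qed

lemma cubic_frame_change:
  assumes S: "cubic_frame X1 X2 Y1 Y2" and d: "p1 * q2 - p2 * q1 \<noteq> 0"
  shows "cubic_frame (p1 *s X1 + p2 *s X2) (q1 *s X1 + q2 *s X2) (p1 *s Y1 + p2 *s Y2) (q1 *s Y1 + q2 *s Y2)"
proof -
  have "vanishes (p1 *s (X1 + Y1) + p2 *s (X2 + Y2)) (q1 *s (X1 + Y1) + q2 *s (X2 + Y2))"
    using S by (intro vanishes_combination) (simp add: cubic_frame_def)
  moreover have "p1 *s (X1 + Y1) + p2 *s (X2 + Y2) = p1 *s X1 + p2 *s X2 + (p1 *s Y1 + p2 *s Y2)"
    "q1 *s (X1 + Y1) + q2 *s (X2 + Y2) = q1 *s X1 + q2 *s X2 + (q1 *s Y1 + q2 *s Y2)"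
    by (simp_all add: vec_eq_iff algebra_simps)
  ultimately have "vanishes (p1 *s X1 + p2 *s X2 + (p1 *s Y1 + p2 *s Y2)) (q1 *s X1 + q2 *s X2 + (q1 *s Y1 + q2 *s Y2))"
    by (simp only:)
  then show ?thesis
    using S smooth_frame_change[OF _ d] vanishes_combination by (simp add: cubic_frame_def)
qed

text \<open>
  The new entries are characterised by the images of the new basis vectors \<open>p\<close> and \<open>q\<close>, which avoids inverse matrices.
\<close>

lemma graph_change:
  assumes G: "graph_in_cubic X1 X2 Y1 Y2 a b c d"
    and "a * p1 + b * p2 = a' * p1 + c' * q1" "c * p1 + d * p2 = a' * p2 + c' * q2"
    and "a * q1 + b * q2 = b' * p1 + d' * q1" "c * q1 + d * q2 = b' * p2 + d' * q2"
  shows "graph_in_cubic (p1 *s X1 + p2 *s X2) (q1 *s X1 + q2 *s X2) (p1 *s Y1 + p2 *s Y2) (q1 *s Y1 + q2 *s Y2) a' b' c' d'"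
proof -
  have "vanishes (p1 *s (X1 + a *s Y1 + c *s Y2) + p2 *s (X2 + b *s Y1 + d *s Y2))
      (q1 *s (X1 + a *s Y1 + c *s Y2) + q2 *s (X2 + b *s Y1 + d *s Y2))"
    using G by (intro vanishes_combination) (simp add: graph_in_cubic_def)
  moreover have "p1 *s (X1 + a *s Y1 + c *s Y2) + p2 *s (X2 + b *s Y1 + d *s Y2) =
      p1 *s X1 + p2 *s X2 + (a * p1 + b * p2) *s Y1 + (c * p1 + d * p2) *s Y2"
    "q1 *s (X1 + a *s Y1 + c *s Y2) + q2 *s (X2 + b *s Y1 + d *s Y2) =
      q1 *s X1 + q2 *s X2 + (a * q1 + b * q2) *s Y1 + (c * q1 + d * q2) *s Y2"
    by (simp_all add: vec_eq_iff algebra_simps)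
  moreover have "p1 *s X1 + p2 *s X2 + (a * p1 + b * p2) *s Y1 + (c * p1 + d * p2) *s Y2 =
      p1 *s X1 + p2 *s X2 + a' *s (p1 *s Y1 + p2 *s Y2) + c' *s (q1 *s Y1 + q2 *s Y2)"
    "q1 *s X1 + q2 *s X2 + (a * q1 + b * q2) *s Y1 + (c * q1 + d * q2) *s Y2 =
      q1 *s X1 + q2 *s X2 + b' *s (p1 *s Y1 + p2 *s Y2) + d' *s (q1 *s Y1 + q2 *s Y2)"
    unfolding assms(2-5) by (simp_all add: vec_eq_iff algebra_simps)
  ultimately show ?thesis unfolding graph_in_cubic_def by (simp only:)
qed

text \<open>
  For \<open>X\<close> in the span of \<open>X1\<close>, \<open>X2\<close> and its partner \<open>Y\<close>, the binary cubic \<open>T X X Y\<close> vanishes iff the transversal through \<open>X\<close>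
  and \<open>Y\<close> lies on the surface. At a double root, the tangent planes of the surface along this transversal are those
  of the quadric through the three skew lines: the two derivatives differ by a linear factor, and its zero is a
  singular point of the surface.
\<close>

lemma no_double_root:
  assumes S: "cubic_frame X1 X2 Y1 Y2"
    and r: "T X1 X1 Y1 = 0" "T X1 X1 Y2 + 2 * T X1 X2 Y1 = 0"
  shows False
proof -
  have V: "vanishes X1 X2" "vanishes Y1 Y2" "vanishes (X1 + Y1) (X2 + Y2)" and sm: "smooth_frame X1 X2 Y1 Y2"
    using S by (auto simp: cubic_frame_def)
  note sw = swap12[of X2 X1] swap23[of _ X2 X1] swap12[of Y1 X1] swap12[of Y1 X2] swap12[of Y2 X1] swap12[of Y2 X2]
     swap23[of _ Y1 X1] swap23[of _ Y1 X2] swap23[of _ Y2 X1] swap23[of _ Y2 X2] swap12[of Y2 Y1] swap23[of _ Y2 Y1]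
  have V12: "T X1 X1 X1 = 0" "T X1 X1 X2 = 0" "T X1 X2 X2 = 0" "T X2 X2 X2 = 0"
     "T Y1 Y1 Y1 = 0" "T Y1 Y1 Y2 = 0" "T Y1 Y2 Y2 = 0" "T Y2 Y2 Y2 = 0"
    using V by (simp_all add: vanishes_def)
  have a: "T X1 Y1 Y1 = 0" using V(3) V12 r(1) by (simp add: vanishes_def multilinear sw)
  have "T X1 X1 Y2 + 2 * T X1 X2 Y1 + (T X2 Y1 Y1 + 2 * T X1 Y1 Y2) = 0"
    using V(3) V12 by (simp add: vanishes_def multilinear sw algebra_simps)
  then have b: "T X2 Y1 Y1 = - (2 * T X1 Y1 Y2)" and b': "T X1 X1 Y2 = - (2 * T X1 X2 Y1)"
    using r(2) by (simp_all add: add_eq_0_iff)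
  define n n' where "n = T X1 X2 Y1" and "n' = T X1 Y1 Y2"
  \<comment> \<open>The zero of the linear factor \<open>\<alpha> * n - \<beta> * n'\<close>.\<close>
  obtain \<alpha> \<beta> where ab: "\<alpha> * n = \<beta> * n'" "\<alpha> \<noteq> 0 \<or> \<beta> \<noteq> 0"
  proof (cases "n = 0")
    case True
    then show ?thesis using that[of 1 0] by simp
  next
    case False
    then show ?thesis using that[of n' n] by (simp add: mult.commute)
  qed
  define z where "z = \<alpha> *s X1 + 0 *s X2 + \<beta> *s Y1 + 0 *s Y2"
  have z: "z = \<alpha> *s X1 + \<beta> *s Y1" by (simp add: z_def)
  have "T z z X1 = 0" "T z z Y1 = 0" unfolding z by (simp_all add: multilinear sw V12 a r)
  moreover have "T z z X2 = 2 * \<beta> * (\<alpha> * n - \<beta> * n')" "T z z Y2 = - 2 * \<alpha> * (\<alpha> * n - \<beta> * n')"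
    unfolding z by (simp_all add: multilinear sw V12 a b b' n_def n'_def algebra_simps)
  then have "T z z X2 = 0" "T z z Y2 = 0" using ab by simp_all
  ultimately show False using smooth_frameD[OF sm z_def] ab(2) by simp
qed

text \<open>
  On the transversal through \<open>X\<close> and \<open>Y\<close> the cubic form has the zeros \<open>X\<close>, \<open>Y\<close>, \<open>X + Y\<close> and \<open>X + t * Y\<close>, more than a
  nonzero binary cubic can have. Thus an eigenvector of a graph gives a transversal on the surface.
\<close>

lemma root_if_eigenvector:
  assumes "T X X X = 0" "T Y Y Y = 0" "T (X + Y) (X + Y) (X + Y) = 0"
    and "T (X + t *s Y) (X + t *s Y) (X + t *s Y) = 0" "t \<noteq> 0" "t \<noteq> 1"
  shows "T X X Y = 0 \<and> T X Y Y = 0"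
proof -
  have "3 * (T X X Y + T X Y Y) = 0"
    using assms(1-3) by (simp add: multilinear swap12[of Y X] swap23[of _ Y X] algebra_simps)
  then have "T X X Y + T X Y Y = 0" unfolding mult_eq_0_iff by simp
  then have 1: "T X X Y = - T X Y Y" by (simp only: eq_neg_iff_add_eq_0)
  have "3 * t * (T X X Y + t * T X Y Y) = 0"
    using assms(1,2,4) by (simp add: multilinear swap12[of Y X] swap23[of _ Y X] algebra_simps)
  then have "T X X Y + t * T X Y Y = 0" using assms(5) by simp
  then have "(t - 1) * T X Y Y = 0" by (simp add: 1 algebra_simps)
  then show ?thesis using assms(6) 1 by simp
qed

text \<open>
  A double eigenvalue with a single eigenvector, like a scalar matrix, turns the eigenvector into a double root of the
  binary cubic: to first order in the direction of \<open>X2\<close>, the points of the graph deviate from those \<open>X + t * Y\<close> by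
  multiples of \<open>Y1\<close> only, and such a deviation is along a transversal contained in the surface.
\<close>

lemma no_jordan_block:
  assumes S: "cubic_frame X1 X2 Y1 Y2" and G: "graph_in_cubic X1 X2 Y1 Y2 t \<delta> 0 t" and t: "t \<noteq> 0" "t \<noteq> 1"
  shows False
proof (rule no_double_root[OF S])
  have V: "vanishes X1 X2" "vanishes Y1 Y2" "vanishes (X1 + Y1) (X2 + Y2)"
    "vanishes (X1 + t *s Y1) (X2 + \<delta> *s Y1 + t *s Y2)"
    using S G by (auto simp: cubic_frame_def graph_in_cubic_def)
  note sw = swap12[of X2 X1] swap23[of _ X2 X1] swap12[of Y1 X1] swap12[of Y1 X2] swap12[of Y2 X1] swap12[of Y2 X2]
     swap23[of _ Y1 X1] swap23[of _ Y1 X2] swap23[of _ Y2 X1] swap23[of _ Y2 X2] swap12[of Y2 Y1] swap23[of _ Y2 Y1]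
  have V12: "T X1 X1 X1 = 0" "T X1 X1 X2 = 0" "T X1 X2 X2 = 0" "T X2 X2 X2 = 0"
     "T Y1 Y1 Y1 = 0" "T Y1 Y1 Y2 = 0" "T Y1 Y2 Y2 = 0" "T Y2 Y2 Y2 = 0"
    using V by (simp_all add: vanishes_def)
  have "T X1 X1 Y1 = 0 \<and> T X1 Y1 Y1 = 0"
    by (rule root_if_eigenvector[OF _ _ _ _ t]) (use V in \<open>simp_all add: vanishes_def\<close>)
  then have r: "T X1 X1 Y1 = 0" and a: "T X1 Y1 Y1 = 0" by auto
  show "T X1 X1 Y1 = 0" by (rule r)
  define f g where "f = T X1 X1 Y2 + 2 * T X1 X2 Y1" and "g = T X2 Y1 Y1 + 2 * T X1 Y1 Y2"
  have "f + g = 0"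
    using V(3) V12 unfolding f_def g_def by (simp add: vanishes_def multilinear sw algebra_simps)
  moreover have "t * (f + t * g) = 0"
    using V(4) V12 r a unfolding f_def g_def by (simp add: vanishes_def multilinear sw algebra_simps)
  ultimately have "f = - g" "f + t * g = 0" using t by (auto simp: eq_neg_iff_add_eq_0)
  then have "(t - 1) * g = 0" by (simp add: algebra_simps)
  then have "f = 0" using \<open>f = - g\<close> t by simp
  then show "T X1 X1 Y2 + 2 * T X1 X2 Y1 = 0" by (simp add: f_def)
qed

text \<open>
  With discriminant zero, \<open>t\<close> is the only eigenvalue and the matrix minus \<open>t\<close> squares to zero. For \<open>c \<noteq> 0\<close>, in the basis consisting
  of the image \<open>(n, c)\<close> of \<open>(1, 0)\<close> under the difference and of \<open>(1, 0)\<close> itself it is a Jordan block.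
\<close>

lemma graph_discriminant_nonzero:
  assumes S: "cubic_frame X1 X2 Y1 Y2" and G: "graph_in_cubic X1 X2 Y1 Y2 a b c d"
    and det: "a * d - b * c \<noteq> 0" "(a - 1) * (d - 1) - b * c \<noteq> 0"
  shows "(a - d)\<^sup>2 + 4 * b * c \<noteq> 0"
proof
  assume disc: "(a - d)\<^sup>2 + 4 * b * c = 0"
  define t n where "t = (a + d) / 2" and "n = (a - d) / 2"
  have ad: "a = t + n" "d = t - n" by (simp_all add: t_def n_def field_simps)
  have "4 * (b * c + n * n) = 0" using disc by (simp add: ad power2_eq_square algebra_simps)
  then have "b * c + n * n = 0" unfolding mult_eq_0_iff by simp
  then have bc: "b * c = - (n * n)" by (simp only: eq_neg_iff_add_eq_0)
  have "a * d - b * c = t * t" "(a - 1) * (d - 1) - b * c = (t - 1) * (t - 1)"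
    unfolding bc by (simp_all add: ad algebra_simps)
  then have t: "t \<noteq> 0" "t \<noteq> 1" using det by auto
  show False
  proof (cases "c = 0")
    case True
    then have "n = 0" using bc by simp
    then show False using no_jordan_block[OF S _ t, of b] G by (simp add: ad True)
  next
    case False
    have "graph_in_cubic (n *s X1 + c *s X2) (1 *s X1 + 0 *s X2) (n *s Y1 + c *s Y2) (1 *s Y1 + 0 *s Y2) t 1 0 t"
      by (rule graph_change[OF G]) (use bc in \<open>simp_all add: ad algebra_simps\<close>)
    moreover have "cubic_frame (n *s X1 + c *s X2) (1 *s X1 + 0 *s X2) (n *s Y1 + c *s Y2) (1 *s Y1 + 0 *s Y2)"
      by (rule cubic_frame_change[OF S]) (use False in simp)
    ultimately show False using no_jordan_block t by blast
  qed
qed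

text \<open>
  If neither basis vector is an eigenvector, the two eigenvectors of the matrix are further roots of the binary
  cubic. With four roots it vanishes identically and has double roots.
\<close>

lemma graph_triangular:
  assumes S: "cubic_frame X1 X2 Y1 Y2" and r: "T X1 X1 Y1 = 0" "T X2 X2 Y2 = 0"
    and G: "graph_in_cubic X1 X2 Y1 Y2 a b c d"
    and det: "a * d - b * c \<noteq> 0" "(a - 1) * (d - 1) - b * c \<noteq> 0"
  shows "b = 0 \<or> c = 0"
proof (rule ccontr)
  assume "\<not> (b = 0 \<or> c = 0)"
  then have bc: "b \<noteq> 0" "c \<noteq> 0" by auto
  have V: "vanishes X1 X2" "vanishes Y1 Y2" "vanishes (X1 + Y1) (X2 + Y2)"
    "vanishes (X1 + a *s Y1 + c *s Y2) (X2 + b *s Y1 + d *s Y2)"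
    using S G by (auto simp: cubic_frame_def graph_in_cubic_def)
  note sw = swap12[of X2 X1] swap23[of _ X2 X1] swap12[of Y1 X1] swap12[of Y1 X2] swap12[of Y2 X1] swap12[of Y2 X2]
     swap23[of _ Y1 X1] swap23[of _ Y1 X2] swap23[of _ Y2 X1] swap23[of _ Y2 X2] swap12[of Y2 Y1] swap23[of _ Y2 Y1]
  define \<mu> \<nu> where "\<mu> = T X1 X1 Y2 + 2 * T X1 X2 Y1" and "\<nu> = T X2 X2 Y1 + 2 * T X1 X2 Y2"
  define D where "D = csqrt ((a - d)\<^sup>2 + 4 * b * c)"
  have D2: "D * D = (a - d)\<^sup>2 + 4 * b * c" unfolding D_def power2_eq_square[symmetric] by simp
  have D: "D \<noteq> 0" using graph_discriminant_nonzero[OF S G det] by (simp add: D_def)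
  have root: "\<mu> * b + \<nu> * (t - a) = 0" if t: "t = (a + d + e) / 2" "e * e = (a - d)\<^sup>2 + 4 * b * c" for t e
  proof -
    have char: "(t - a) * (t - d) = b * c"
    proof -
      have "4 * ((t - a) * (t - d)) = e * e - (a - d)\<^sup>2" unfolding t(1) by (simp add: field_simps power2_eq_square)
      then show ?thesis unfolding t(2) by simp
    qed
    have t01: "t \<noteq> 0" "t \<noteq> 1" using char det by (auto simp: algebra_simps)
    have ta: "t - a \<noteq> 0" using char bc by auto
    \<comment> \<open>The vector \<open>(b, t - a)\<close> is an eigenvector for the eigenvalue \<open>t\<close>.\<close>
    define X Y where "X = b *s X1 + (t - a) *s X2" and "Y = b *s Y1 + (t - a) *s Y2"
    have "b *s (X1 + a *s Y1 + c *s Y2) + (t - a) *s (X2 + b *s Y1 + d *s Y2) = 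
        X + (t * b) *s Y1 + ((t - a) * d + b * c) *s Y2"
      unfolding X_def by (simp add: vec_eq_iff algebra_simps)
    also have "(t - a) * d + b * c = t * (t - a)" using char by (simp add: algebra_simps)
    also have "X + (t * b) *s Y1 + (t * (t - a)) *s Y2 = X + t *s Y"
      unfolding Y_def by (simp add: vec_eq_iff algebra_simps)
    finally have XtY: "X + t *s Y = b *s (X1 + a *s Y1 + c *s Y2) + (t - a) *s (X2 + b *s Y1 + d *s Y2)" ..
    have XY: "X + Y = b *s (X1 + Y1) + (t - a) *s (X2 + Y2)"
      unfolding X_def Y_def by (simp add: vec_eq_iff algebra_simps)
    have comb: "T (p *s v + q *s w) (p *s v + q *s w) (p *s v + q *s w) = 0" if "vanishes v w" for p q v w
      using vanishes_combination[OF that, of p q p q] by (simp add: vanishes_def)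
    have "T X X Y = 0"
      using root_if_eigenvector[of X Y t] comb[OF V(1)] comb[OF V(2)] comb[OF V(3)] comb[OF V(4)] t01
      unfolding XtY XY unfolding X_def Y_def by blast
    moreover have "T X X Y = b * (t - a) * (\<mu> * b + \<nu> * (t - a))"
      unfolding X_def Y_def \<mu>_def \<nu>_def by (simp add: multilinear sw r algebra_simps)
    ultimately show ?thesis using bc ta by simp
  qed
  have "\<mu> * b + \<nu> * ((a + d + D) / 2 - a) = 0" "\<mu> * b + \<nu> * ((a + d + (- D)) / 2 - a) = 0"
    using root[OF refl, of D] root[OF refl, of "- D"] D2 by simp_all
  moreover have "\<nu> * D = (\<mu> * b + \<nu> * ((a + d + D) / 2 - a)) - (\<mu> * b + \<nu> * ((a + d + (- D)) / 2 - a))"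
    by (simp add: field_simps)
  ultimately have "\<nu> * D = 0" by simp
  then have "\<nu> = 0" using D by simp
  then have "\<mu> = 0" using \<open>\<mu> * b + \<nu> * ((a + d + D) / 2 - a) = 0\<close> bc by simp
  then show False using no_double_root[OF S r(1)] by (simp add: \<mu>_def)
qed

end

section \<open>Common zeros of forms of bidegree (2,1) and (1,2)\<close>

text \<open>
  The general form of bidegree \<open>(2, 1)\<close> in affine coordinates, subject to vanishing at \<open>(0, 0)\<close> and at infinity, which
  removes the constant and the coefficient of \<open>u\<^sup>2 * w\<close>. It is nondegenerate if for no \<open>u\<close>, infinity
  included, it vanishes for all \<open>w\<close>.
\<close>

definition form21 :: "complex \<Rightarrow> complex \<Rightarrow> complex \<Rightarrow> complex \<Rightarrow> complex \<Rightarrow> complex \<Rightarrow> complex" where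
  "form21 \<alpha> \<beta> \<gamma> \<delta> u w = \<alpha> * w + \<beta> * u + \<gamma> * u * w + \<delta> * u\<^sup>2"

definition nondegenerate :: "complex \<Rightarrow> complex \<Rightarrow> complex \<Rightarrow> complex \<Rightarrow> bool" where
  "nondegenerate \<alpha> \<beta> \<gamma> \<delta> \<longleftrightarrow> \<alpha> \<noteq> 0 \<and> \<delta> \<noteq> 0 \<and> (\<forall>u. \<beta> + \<delta> * u = 0 \<longrightarrow> \<alpha> + \<gamma> * u \<noteq> 0)"

lemma form21_split: "form21 \<alpha> \<beta> \<gamma> \<delta> u w = w * (\<alpha> + \<gamma> * u) + u * (\<beta> + \<delta> * u)"
  by (simp add: form21_def algebra_simps power2_eq_square)

lemma form21_denominator:
  assumes "nondegenerate \<alpha> \<beta> \<gamma> \<delta>" "form21 \<alpha> \<beta> \<gamma> \<delta> u w = 0" "u \<noteq> 0"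
  shows "\<alpha> + \<gamma> * u \<noteq> 0"
  using assms by (auto simp: form21_split nondegenerate_def)

lemma form21_unique:
  assumes "nondegenerate \<alpha> \<beta> \<gamma> \<delta>" "form21 \<alpha> \<beta> \<gamma> \<delta> u w = 0" "form21 \<alpha> \<beta> \<gamma> \<delta> u w' = 0" "u \<noteq> 0"
  shows "w = w'"
proof -
  have "(w - w') * (\<alpha> + \<gamma> * u) = form21 \<alpha> \<beta> \<gamma> \<delta> u w - form21 \<alpha> \<beta> \<gamma> \<delta> u w'"
    by (simp add: form21_split algebra_simps)
  then have "(w - w') * (\<alpha> + \<gamma> * u) = 0" using assms(2,3) by simp
  then show ?thesis using form21_denominator[OF assms(1,2,4)] by simp
qed

lemma cubic_four_roots:
  fixes a0 a1 a2 a3 :: "'a::idom"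
  assumes "distinct [x1, x2, x3, x4]" "\<And>x. x \<in> {x1, x2, x3, x4} \<Longrightarrow> a0 + a1 * x + a2 * x\<^sup>2 + a3 * x ^ 3 = 0"
  shows "a0 + a1 * x + a2 * x\<^sup>2 + a3 * x ^ 3 = 0" and "a3 = 0"
proof -
  define p where "p = [:a0, a1, a2, a3:]"
  have ev: "poly p x = a0 + a1 * x + a2 * x\<^sup>2 + a3 * x ^ 3" for x
    by (simp add: p_def algebra_simps power2_eq_square power3_eq_cube)
  have "p = 0"
  proof (rule ccontr)
    assume p: "p \<noteq> 0"
    have "{x1, x2, x3, x4} \<subseteq> {x. poly p x = 0}" using assms(2) by (auto simp: ev)
    then have "card {x1, x2, x3, x4} \<le> card {x. poly p x = 0}" by (intro card_mono poly_roots_finite[OF p])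
    also have "\<dots> \<le> degree p" by (rule card_poly_roots_bound[OF p])
    also have "degree p \<le> 3" by (simp add: p_def degree_pCons_eq_if)
    finally show False using assms(1) by simp
  qed
  then show "a0 + a1 * x + a2 * x\<^sup>2 + a3 * x ^ 3 = 0" "a3 = 0" using ev[of x] by (simp_all add: p_def)
qed

text \<open>
  The two forms have intersection number five, and the origin and infinity account for two common zeros. To bound the others,
  \<open>w\<close> is eliminated: it is a quotient of polynomials in \<open>u\<close>, and substitution in the second form leaves a cubic equation
  for \<open>u\<close>.
\<close>

lemma at_most_three_common_zeros:
  assumes g: "nondegenerate \<alpha> \<beta> \<gamma> \<delta>" and h: "nondegenerate \<alpha>' \<beta>' \<gamma>' \<delta>'"
    and d: "distinct [u1, u2, u3, u4]" "0 \<notin> {u1, u2, u3, u4}"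
    and z: "\<And>u. u \<in> {u1, u2, u3, u4} \<Longrightarrow> \<exists>w. form21 \<alpha> \<beta> \<gamma> \<delta> u w = 0 \<and> form21 \<alpha>' \<beta>' \<gamma>' \<delta>' w u = 0"
  shows False
proof -
  define a0 a1 a2 a3 where "a0 = \<alpha>' * \<alpha>\<^sup>2 - \<beta>' * \<alpha> * \<beta>"
    and "a1 = \<delta>' * \<beta>\<^sup>2 - \<gamma>' * \<alpha> * \<beta> + 2 * \<alpha>' * \<alpha> * \<gamma> - \<beta>' * (\<beta> * \<gamma> + \<delta> * \<alpha>)"
    and "a2 = 2 * \<delta>' * \<beta> * \<delta> - \<gamma>' * (\<beta> * \<gamma> + \<delta> * \<alpha>) + \<alpha>' * \<gamma>\<^sup>2 - \<beta>' * \<delta> * \<gamma>"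
    and "a3 = \<delta>' * \<delta>\<^sup>2 - \<gamma>' * \<delta> * \<gamma>"
  have R: "a0 + a1 * u + a2 * u\<^sup>2 + a3 * u ^ 3 = \<delta>' * u * (\<beta> + \<delta> * u)\<^sup>2 - \<gamma>' * u * (\<beta> + \<delta> * u) * (\<alpha> + \<gamma> * u)
      + \<alpha>' * (\<alpha> + \<gamma> * u)\<^sup>2 - \<beta>' * (\<beta> + \<delta> * u) * (\<alpha> + \<gamma> * u)" for u
    by (simp add: a0_def a1_def a2_def a3_def algebra_simps power2_eq_square power3_eq_cube)
  have zero: "a0 + a1 * u + a2 * u\<^sup>2 + a3 * u ^ 3 = 0" if u: "u \<in> {u1, u2, u3, u4}" for u
  proof -
    obtain w where w: "form21 \<alpha> \<beta> \<gamma> \<delta> u w = 0" "form21 \<alpha>' \<beta>' \<gamma>' \<delta>' w u = 0" using z[OF u] by blast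
    have u0: "u \<noteq> 0" using u d(2) by metis
    have wd: "w * (\<alpha> + \<gamma> * u) = - (u * (\<beta> + \<delta> * u))" using w(1) by (simp add: form21_split eq_neg_iff_add_eq_0)
    have "0 = (\<alpha> + \<gamma> * u)\<^sup>2 * form21 \<alpha>' \<beta>' \<gamma>' \<delta>' w u" using w(2) by simp
    also have "\<dots> = \<alpha>' * u * (\<alpha> + \<gamma> * u)\<^sup>2 + \<beta>' * (w * (\<alpha> + \<gamma> * u)) * (\<alpha> + \<gamma> * u)
        + \<gamma>' * (w * (\<alpha> + \<gamma> * u)) * u * (\<alpha> + \<gamma> * u) + \<delta>' * (w * (\<alpha> + \<gamma> * u))\<^sup>2"
      unfolding form21_def by (simp add: algebra_simps power2_eq_square)
    also have "\<dots> = u * (a0 + a1 * u + a2 * u\<^sup>2 + a3 * u ^ 3)"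
      unfolding wd R by (simp add: algebra_simps power2_eq_square)
    finally show ?thesis using u0 by simp
  qed
  have all: "a0 + a1 * u + a2 * u\<^sup>2 + a3 * u ^ 3 = 0" and a3: "a3 = 0" for u
    using cubic_four_roots[OF d(1) zero] by auto
  show False
  proof (cases "\<gamma> = 0")
    case True
    then show False using a3 g h by (simp add: a3_def nondegenerate_def)
  next
    case False
    \<comment> \<open>The cubic polynomial cannot vanish identically, as it is nonzero at the pole of \<open>w\<close>.\<close>
    define u where "u = - \<alpha> / \<gamma>"
    have u: "\<alpha> + \<gamma> * u = 0" "u \<noteq> 0" using False g by (simp_all add: u_def nondegenerate_def)
    have "\<delta>' * u * (\<beta> + \<delta> * u)\<^sup>2 = 0" using all[of u] unfolding R u(1) by simp
    then have "\<beta> + \<delta> * u = 0" using u(2) h by (simp add: nondegenerate_def)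
    then show False using g u(1) by (simp add: nondegenerate_def)
  qed
qed

text \<open>
  A form of bidegree \<open>(2, 1)\<close>, divided by its coefficient of \<open>u\<^sup>2\<close>, with the two zeros \<open>u0\<close> and \<open>s\<close> at \<open>w = w0\<close> and further
  zeros \<open>(1, 1)\<close> and \<open>(a1, a2)\<close>. The inequalities express nondegeneracy at \<open>u0\<close> and \<open>s\<close>.
\<close>

definition slope_relation :: "complex \<Rightarrow> complex \<Rightarrow> complex \<Rightarrow> complex \<Rightarrow> complex \<Rightarrow> bool" where
  "slope_relation u0 s w0 a1 a2 \<longleftrightarrow> (\<exists>\<gamma> \<kappa>. \<kappa> * w0 = u0 * s \<and> \<kappa> + \<gamma> * u0 \<noteq> 0 \<and> \<kappa> + \<gamma> * s \<noteq> 0 \<and>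
     \<kappa> - (u0 + s + \<gamma> * w0) + \<gamma> + 1 = 0 \<and> \<kappa> * a2 - (u0 + s + \<gamma> * w0) * a1 + \<gamma> * a1 * a2 + a1\<^sup>2 = 0)"

lemma slope_relation_if_form21:
  assumes g: "nondegenerate \<alpha> \<beta> \<gamma> \<delta>"
    and z: "form21 \<alpha> \<beta> \<gamma> \<delta> 1 1 = 0" "form21 \<alpha> \<beta> \<gamma> \<delta> a1 a2 = 0"
    and r: "\<And>u. form21 \<alpha> \<beta> \<gamma> \<delta> u w0 = \<delta> * (u - s) * (u - u0)"
    and nz: "u0 \<noteq> 0" "s \<noteq> 0"
  shows "slope_relation u0 s w0 a1 a2"
proof -
  have d: "\<delta> \<noteq> 0" using g by (simp add: nondegenerate_def)
  have k: "\<alpha> * w0 = \<delta> * s * u0" using r[of 0] by (simp add: form21_def)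
  have "\<beta> + \<gamma> * w0 = - \<delta> * (u0 + s)"
    using r[of 1] k by (simp add: form21_def algebra_simps eq_neg_iff_add_eq_0)
  then have b: "\<beta> = - \<delta> * (u0 + s) - \<gamma> * w0" by (simp add: algebra_simps eq_neg_iff_add_eq_0)
  have "\<alpha> + \<gamma> * u0 \<noteq> 0" "\<alpha> + \<gamma> * s \<noteq> 0"
    using form21_denominator[OF g, of u0 w0] form21_denominator[OF g, of s w0] r nz by simp_all
  then have n: "\<alpha> / \<delta> + \<gamma> / \<delta> * u0 \<noteq> 0" "\<alpha> / \<delta> + \<gamma> / \<delta> * s \<noteq> 0" using d by (simp_all add: field_simps)
  have "\<alpha> / \<delta> * w0 = u0 * s" using k d by (simp add: field_simps)
  moreover have "form21 \<alpha> \<beta> \<gamma> \<delta> u w = \<delta> * (\<alpha> / \<delta> * w - (u0 + s + \<gamma> / \<delta> * w0) * u + \<gamma> / \<delta> * u * w + u\<^sup>2)" for u w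
    unfolding form21_def b using d by (simp add: field_simps)
  from this[of 1 1] this[of a1 a2]
  have "\<alpha> / \<delta> - (u0 + s + \<gamma> / \<delta> * w0) + \<gamma> / \<delta> + 1 = 0"
    "\<alpha> / \<delta> * a2 - (u0 + s + \<gamma> / \<delta> * w0) * a1 + \<gamma> / \<delta> * a1 * a2 + a1\<^sup>2 = 0"
    using z d by simp_all
  ultimately show ?thesis unfolding slope_relation_def using n by blast
qed

context trilinear_form
begin

section \<open>Two transversals in the cubic surface\<close>

text \<open>
  For \<open>v = X1 + u * Y1\<close> and \<open>x = X2 + w * Y2\<close>, this is \<open>T v v x\<close>. If the first transversal lies on the surface,
  the form vanishes iff \<open>x\<close> is in the tangent plane at \<open>v\<close>. The form of the second transversal is the one of the
  frame with the indices exchanged.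
\<close>

definition bundle_form where
  "bundle_form X1 X2 Y1 Y2 = form21 (T X1 X1 Y2) (2 * T X1 X2 Y1) (2 * T X1 Y1 Y2) (T X2 Y1 Y1)"

definition bundle_nondegenerate where
  "bundle_nondegenerate X1 X2 Y1 Y2 \<longleftrightarrow> nondegenerate (T X1 X1 Y2) (2 * T X1 X2 Y1) (2 * T X1 Y1 Y2) (T X2 Y1 Y1)"

definition split_frame where
  "split_frame X1 X2 Y1 Y2 \<longleftrightarrow> cubic_frame X1 X2 Y1 Y2 \<and> vanishes X1 Y1 \<and> vanishes X2 Y2"

lemma cubic_frame_swap: "cubic_frame X1 X2 Y1 Y2 \<Longrightarrow> cubic_frame X2 X1 Y2 Y1"
  using cubic_frame_change[of X1 X2 Y1 Y2 0 0 1 1] by simp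

lemma split_frame_swap: "split_frame X1 X2 Y1 Y2 \<Longrightarrow> split_frame X2 X1 Y2 Y1"
  using cubic_frame_swap by (simp add: split_frame_def)

lemma graph_swap: "graph_in_cubic X1 X2 Y1 Y2 a b c d \<Longrightarrow> graph_in_cubic X2 X1 Y2 Y1 d c b a"
  using graph_change[of X1 X2 Y1 Y2 a b c d 0 1 d b 1 0 c a] by simp

lemma split_frame_if_diagonal:
  assumes S: "cubic_frame X1 X2 Y1 Y2" and G: "graph_in_cubic X1 X2 Y1 Y2 a1 0 0 a2"
    and a: "a1 \<noteq> 0" "a1 \<noteq> 1" "a2 \<noteq> 0" "a2 \<noteq> 1"
  shows "split_frame X1 X2 Y1 Y2"
proof -
  have V: "vanishes X1 X2" "vanishes Y1 Y2" "vanishes (X1 + Y1) (X2 + Y2)"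
    "vanishes (X1 + a1 *s Y1) (X2 + a2 *s Y2)"
    using S G by (auto simp: cubic_frame_def graph_in_cubic_def)
  have "T X1 X1 Y1 = 0 \<and> T X1 Y1 Y1 = 0"
    by (rule root_if_eigenvector[OF _ _ _ _ a(1,2)]) (use V in \<open>simp_all add: vanishes_def\<close>)
  moreover have "T X2 X2 Y2 = 0 \<and> T X2 Y2 Y2 = 0"
    by (rule root_if_eigenvector[OF _ _ _ _ a(3,4)]) (use V in \<open>simp_all add: vanishes_def\<close>)
  ultimately show ?thesis using S V by (simp add: split_frame_def vanishes_def)
qed

text \<open>
  A point of the first transversal at which the form vanishes for all \<open>w\<close> has every derivative zero.
\<close>

lemma split_frame_nondegenerate:
  assumes "split_frame X1 X2 Y1 Y2"
  shows "bundle_nondegenerate X1 X2 Y1 Y2"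
proof -
  have V: "vanishes X1 X2" "vanishes Y1 Y2" "vanishes X1 Y1" "vanishes X2 Y2" and sm: "smooth_frame X1 X2 Y1 Y2"
    using assms by (auto simp: split_frame_def cubic_frame_def)
  note sw = swap12[of X2 X1] swap23[of _ X2 X1] swap12[of Y1 X1] swap12[of Y1 X2] swap12[of Y2 X1] swap12[of Y2 X2]
     swap23[of _ Y1 X1] swap23[of _ Y1 X2] swap23[of _ Y2 X1] swap23[of _ Y2 X2] swap12[of Y2 Y1] swap23[of _ Y2 Y1]
  have gauss: "p = 0 \<and> q = 0" if "2 * p * q * T X1 X2 Y1 + q\<^sup>2 * T X2 Y1 Y1 = 0" "p\<^sup>2 * T X1 X1 Y2 + 2 * p * q * T X1 Y1 Y2 = 0" for p q
  proof -
    define z where "z = p *s X1 + 0 *s X2 + q *s Y1 + 0 *s Y2"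
    have z: "z = p *s X1 + q *s Y1" by (simp add: z_def)
    have "T z z X1 = 0" "T z z Y1 = 0" unfolding z using V by (simp_all add: vanishes_def multilinear sw)
    moreover have "T z z X2 = 0" "T z z Y2 = 0" 
      using that V unfolding z by (simp_all add: vanishes_def multilinear sw algebra_simps power2_eq_square)
    ultimately show ?thesis using smooth_frameD[OF sm z_def] by simp
  qed
  have "T X1 X1 Y2 \<noteq> 0" "T X2 Y1 Y1 \<noteq> 0" using gauss[of 1 0] gauss[of 0 1] by auto
  moreover have "T X1 X1 Y2 + 2 * T X1 Y1 Y2 * u \<noteq> 0" if "2 * T X1 X2 Y1 + T X2 Y1 Y1 * u = 0" for u
  proof
    assume "T X1 X1 Y2 + 2 * T X1 Y1 Y2 * u = 0"
    moreover have "2 * u * T X1 X2 Y1 + u\<^sup>2 * T X2 Y1 Y1 = u * (2 * T X1 X2 Y1 + T X2 Y1 Y1 * u)"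
      by (simp add: algebra_simps power2_eq_square)
    ultimately show False using gauss[of 1 u] that by (simp add: mult_ac)
  qed
  ultimately show ?thesis by (simp add: bundle_nondegenerate_def nondegenerate_def)
qed

text \<open>
  A graph with \<open>c = 0\<close> meets the first transversal. The plane spanned by both contains a third line of the surface,
  which meets the two transversals at \<open>u0\<close> and \<open>d\<close> and is a common zero of the two forms. For \<open>b = 0\<close> the graph itself
  meets both transversals and takes its place.
\<close>

lemma upper_graph:
  assumes S: "split_frame X1 X2 Y1 Y2" and G: "graph_in_cubic X1 X2 Y1 Y2 a b 0 d"
  shows "\<exists>u0. bundle_form X1 X2 Y1 Y2 u0 d = 0 \<and> bundle_form X2 X1 Y2 Y1 d u0 = 0 \<and>
    (b \<noteq> 0 \<longrightarrow> (\<forall>u. bundle_form X1 X2 Y1 Y2 u d = T X2 Y1 Y1 * (u - a) * (u - u0))) \<and> (b = 0 \<longrightarrow> u0 = a)"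
proof -
  have V: "vanishes X1 X2" "vanishes Y1 Y2" "vanishes X1 Y1" "vanishes X2 Y2"
     "vanishes (X1 + a *s Y1) (X2 + b *s Y1 + d *s Y2)"
    using S G by (auto simp: split_frame_def cubic_frame_def graph_in_cubic_def)
  note sw = swap12[of X2 X1] swap23[of _ X2 X1] swap12[of Y1 X1] swap12[of Y1 X2] swap12[of Y2 X1] swap12[of Y2 X2]
     swap23[of _ Y1 X1] swap23[of _ Y1 X2] swap23[of _ Y2 X1] swap23[of _ Y2 X2] swap12[of Y2 Y1] swap23[of _ Y2 Y1]
  have g20: "T X2 Y1 Y1 \<noteq> 0"
    using split_frame_nondegenerate[OF S] by (simp add: bundle_nondegenerate_def nondegenerate_def)
  define f h where "f = bundle_form X1 X2 Y1 Y2" and "h = bundle_form X2 X1 Y2 Y1"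
  have f: "f u w = T X1 X1 Y2 * w + 2 * T X1 X2 Y1 * u + 2 * T X1 Y1 Y2 * u * w + T X2 Y1 Y1 * u\<^sup>2"
   and h: "h w u = T X2 X2 Y1 * u + 2 * T X1 X2 Y2 * w + 2 * T X2 Y1 Y2 * w * u + T X1 Y2 Y2 * w\<^sup>2" for u w
    by (simp_all add: f_def h_def bundle_form_def form21_def sw)
  have 1: "f a d = 0"
    using V unfolding f by (simp add: vanishes_def multilinear sw algebra_simps power2_eq_square)
  have 2: "b * (2 * T X1 X2 Y1 + 2 * T X1 Y1 Y2 * d + 2 * T X2 Y1 Y1 * a) + h d a = 0"
    using V unfolding h by (simp add: vanishes_def multilinear sw algebra_simps power2_eq_square)
  have "3 * (b * (b * T X2 Y1 Y1 + (T X2 X2 Y1 + 2 * T X2 Y1 Y2 * d))) = 0"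
    using V by (simp add: vanishes_def multilinear sw algebra_simps power2_eq_square)
  then have 3: "b = 0 \<or> T X2 X2 Y1 + 2 * T X2 Y1 Y2 * d = - (b * T X2 Y1 Y1)"
    by (auto simp: add_eq_0_iff)
  show ?thesis
  proof (cases "b = 0")
    case True
    then show ?thesis using 1 2 unfolding f_def h_def by auto
  next
    case False
    define u0 where "u0 = - (2 * T X1 X2 Y1 + 2 * T X1 Y1 Y2 * d) / T X2 Y1 Y1 - a"
    have u0: "2 * T X1 X2 Y1 + 2 * T X1 Y1 Y2 * d = - (T X2 Y1 Y1 * (a + u0))"
      using g20 by (simp add: u0_def field_simps)
    have step: "f u d - f a d = (u - a) * ((2 * T X1 X2 Y1 + 2 * T X1 Y1 Y2 * d) + T X2 Y1 Y1 * (u + a))" for u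
      unfolding f by (simp add: algebra_simps power2_eq_square)
    have fu: "f u d = T X2 Y1 Y1 * (u - a) * (u - u0)" for u
      using step[of u] unfolding u0 1 by (simp add: algebra_simps)
    have "h d u0 = h d a + (T X2 X2 Y1 + 2 * T X2 Y1 Y2 * d) * (u0 - a)"
      unfolding h by (simp add: algebra_simps)
    also have "\<dots> = h d a + b * (2 * T X1 X2 Y1 + 2 * T X1 Y1 Y2 * d + 2 * T X2 Y1 Y1 * a)"
      using 3 False unfolding u0 by (simp add: algebra_simps)
    finally have "h d u0 = 0" using 2 by (simp only: add.commute)
    then show ?thesis using fu False unfolding f_def h_def by auto
  qed
qed

text \<open>
  Two such graphs contribute a common zero each, in addition to the diagonal \<open>(1, 1)\<close> and to \<open>(a1, a2)\<close>.
\<close>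

lemma not_both_upper:
  assumes S: "split_frame X1 X2 Y1 Y2" and A: "graph_in_cubic X1 X2 Y1 Y2 a1 0 0 a2"
    and B: "graph_in_cubic X1 X2 Y1 Y2 b1 \<beta> 0 b2" and C: "graph_in_cubic X1 X2 Y1 Y2 c1 \<gamma> 0 c2"
    and d: "distinct [0, 1, a2, b2, c2]"
  shows False
proof -
  let ?f = "bundle_form X1 X2 Y1 Y2" and ?h = "bundle_form X2 X1 Y2 Y1"
  have I: "graph_in_cubic X1 X2 Y1 Y2 1 0 0 1"
    using S by (simp add: split_frame_def cubic_frame_def graph_in_cubic_def)
  have g: "bundle_nondegenerate X1 X2 Y1 Y2" and h: "bundle_nondegenerate X2 X1 Y2 Y1"
    using split_frame_nondegenerate S split_frame_swap by blast+
  obtain u1 where u1: "?f u1 1 = 0" "?h 1 u1 = 0" using upper_graph[OF S I] by blast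
  obtain u2 where u2: "?f u2 a2 = 0" "?h a2 u2 = 0" using upper_graph[OF S A] by blast
  obtain u3 where u3: "?f u3 b2 = 0" "?h b2 u3 = 0" using upper_graph[OF S B] by blast
  obtain u4 where u4: "?f u4 c2 = 0" "?h c2 u4 = 0" using upper_graph[OF S C] by blast
  have nz: "u \<noteq> 0" if "?f u w = 0" "w \<noteq> 0" for u w
    using that g by (auto simp: bundle_form_def form21_def bundle_nondegenerate_def nondegenerate_def)
  have nz4: "u1 \<noteq> 0" "u2 \<noteq> 0" "u3 \<noteq> 0" "u4 \<noteq> 0"
    using nz[OF u1(1)] nz[OF u2(1)] nz[OF u3(1)] nz[OF u4(1)] d by auto
  have ne: "u \<noteq> u'" if "?f u w = 0" "?f u' w' = 0" "w \<noteq> w'" "u \<noteq> 0" for u u' w w'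
    using form21_unique[OF g[unfolded bundle_nondegenerate_def], of u w w'] that by (auto simp: bundle_form_def)
  have "distinct [u1, u2, u3, u4]"
    using ne[OF u1(1) u2(1)] ne[OF u1(1) u3(1)] ne[OF u1(1) u4(1)]
      ne[OF u2(1) u3(1)] ne[OF u2(1) u4(1)] ne[OF u3(1) u4(1)] nz4 d by simp
  moreover have "0 \<notin> {u1, u2, u3, u4}" using nz4 by auto
  ultimately show False
    by (rule at_most_three_common_zeros[OF g[unfolded bundle_nondegenerate_def] h[unfolded bundle_nondegenerate_def]])
      (use u1 u2 u3 u4 in \<open>auto simp: bundle_form_def\<close>)
qed

text \<open>
  The third line in the plane of \<open>C\<close> and the first transversal and the third line in the plane of \<open>B\<close> and the second
  transversal are both common zeros; together with \<open>(1, 1)\<close> and \<open>(a1, a2)\<close> there would be four, unless they are the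
  same line. So \<open>b1\<close> is a zero of the first form at \<open>c2\<close>, besides \<open>c1\<close>, and \<open>c2\<close> is a zero of the second form at \<open>b1\<close>,
  besides \<open>b2\<close>.
\<close>

lemma lower_upper_relation:
  assumes S: "split_frame X1 X2 Y1 Y2" and A: "graph_in_cubic X1 X2 Y1 Y2 a1 0 0 a2"
    and B: "graph_in_cubic X1 X2 Y1 Y2 b1 0 \<beta> b2" and C: "graph_in_cubic X1 X2 Y1 Y2 c1 \<gamma> 0 c2"
    and nz: "\<beta> \<noteq> 0" "\<gamma> \<noteq> 0" "c1 \<noteq> 0" "b2 \<noteq> 0"
    and d: "distinct [0, 1, a1, b1]" "distinct [0, 1, a2, c2]"
  shows "slope_relation b1 c1 c2 a1 a2" and "slope_relation c2 b2 b1 a2 a1"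
proof -
  let ?f = "bundle_form X1 X2 Y1 Y2" and ?h = "bundle_form X2 X1 Y2 Y1"
  note S' = split_frame_swap[OF S]
  have I: "graph_in_cubic X1 X2 Y1 Y2 1 0 0 1"
    using S by (simp add: split_frame_def cubic_frame_def graph_in_cubic_def)
  note g = split_frame_nondegenerate[OF S] and h = split_frame_nondegenerate[OF S']
  have z1: "?f 1 1 = 0" "?h 1 1 = 0" using upper_graph[OF S I] by auto
  have z2: "?f a1 a2 = 0" "?h a2 a1 = 0" using upper_graph[OF S A] by auto
  obtain u0 where u0: "?f u0 c2 = 0" "?h c2 u0 = 0" "\<And>u. ?f u c2 = T X2 Y1 Y1 * (u - c1) * (u - u0)"
    using upper_graph[OF S C] nz by blast
  obtain w0 where w0: "?h w0 b1 = 0" "?f b1 w0 = 0" "\<And>w. ?h w b1 = T X1 Y2 Y2 * (w - b2) * (w - w0)"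
    using upper_graph[OF S' graph_swap[OF B]] nz by blast
  have inj: "w = w'" if "?f u w = 0" "?f u w' = 0" "u \<noteq> 0" for u w w'
    using form21_unique[OF g[unfolded bundle_nondegenerate_def], of u w w'] that unfolding bundle_form_def by blast
  have u0z: "u0 \<noteq> 0"
    using u0(1) d(2) g by (auto simp: bundle_form_def form21_def bundle_nondegenerate_def nondegenerate_def)
  have u0d: "u0 \<noteq> 1" "u0 \<noteq> a1" using inj[of u0 c2 1] inj[of u0 c2 a2] z1(1) z2(1) u0(1) u0z d by auto
  have eq: "u0 = b1"
  proof (rule ccontr)
    assume "u0 \<noteq> b1"
    then have "distinct [1, a1, b1, u0]" and "0 \<notin> {1, a1, b1, u0}" using d u0z u0d by auto
    moreover have "\<exists>w. ?f u w = 0 \<and> ?h w u = 0" if "u \<in> {1, a1, b1, u0}" for u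
      using that z1 z2 u0(1,2) w0(1,2) by blast
    ultimately show False
      using at_most_three_common_zeros[OF g[unfolded bundle_nondegenerate_def] h[unfolded bundle_nondegenerate_def]]
      unfolding bundle_form_def by blast
  qed
  have eq': "w0 = c2" using inj[of b1 w0 c2] w0(2) u0(1) eq d by simp
  have nz': "b1 \<noteq> 0" "c2 \<noteq> 0" using d by auto
  show "slope_relation b1 c1 c2 a1 a2"
    by (rule slope_relation_if_form21[OF g[unfolded bundle_nondegenerate_def] z1(1)[unfolded bundle_form_def]
      z2(1)[unfolded bundle_form_def] u0(3)[unfolded bundle_form_def eq] nz'(1) nz(3)])
  show "slope_relation c2 b2 b1 a2 a1"
    by (rule slope_relation_if_form21[OF h[unfolded bundle_nondegenerate_def] z1(2)[unfolded bundle_form_def]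
      z2(2)[unfolded bundle_form_def] w0(3)[unfolded bundle_form_def eq'] nz'(2) nz(4)])
qed

end

section \<open>Real lines and their complexifications\<close>

lemma deriv_quadratic_perturbation: "deriv (\<lambda>t. c + t\<^sup>2 * (a + t * b)) 0 = (0::complex)"
  by (rule DERIV_imp_deriv) (auto intro!: derivative_eq_intros)

lemma nonsingular_cubic_form_polarization:
  assumes "nonsingular_cubic_form F"
  shows "\<exists>T. trilinear_form T \<and> (\<forall>x. F x = T x x x) \<and> (\<forall>z. z \<noteq> 0 \<longrightarrow> (\<exists>v. T z z v \<noteq> 0))"
proof -
  obtain a where a: "\<And>x. F x = (\<Sum>i\<in>UNIV. \<Sum>j\<in>UNIV. \<Sum>k\<in>UNIV. a i j k * x $ i * x $ j * x $ k)"
    using assms by (auto simp: nonsingular_cubic_form_def cubic_form_def)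
  define A where "A x y z = (\<Sum>i\<in>UNIV. \<Sum>j\<in>UNIV. \<Sum>k\<in>UNIV. a i j k * x $ i * y $ j * z $ k)" for x y z :: "complex ^ 4"
  have A1: "A (x + y) z w = A x z w + A y z w" "A z (x + y) w = A z x w + A z y w" "A z w (x + y) = A z w x + A z w y" for x y z w
    by (simp_all add: A_def sum.distrib algebra_simps)
  have A2: "A (c *s x) z w = c * A x z w" "A z (c *s x) w = c * A z x w" "A z w (c *s x) = c * A z w x" for c x z w
    by (simp_all add: A_def sum_distrib_left mult_ac)
  define T where "T x y z = (A x y z + A x z y + A y x z + A y z x + A z x y + A z y x) / 6" for x y z
  interpret trilinear_form T
    by standard (simp_all add: T_def A1 A2 field_simps)
  have F: "F x = T x x x" for x by (simp add: a T_def A_def)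
  have "\<exists>v. T z z v \<noteq> 0" if "z \<noteq> 0" for z
  proof (rule ccontr)
    assume "\<not> (\<exists>v. T z z v \<noteq> 0)"
    then have z: "T z z v = 0" for v by blast
    have z': "T z v z = 0" "T v z z = 0" for v using z swap23 swap12 by metis+
    have "partial_deriv i F z = 0" for i
    proof -
      have "F (z + t *s axis i 1) = 0 + t\<^sup>2 * (3 * T z (axis i 1) (axis i 1) + t * T (axis i 1) (axis i 1) (axis i 1))" for t
        by (simp add: F multilinear z z' swap12[of "axis i 1" z] swap23[of _ "axis i 1" z] algebra_simps power2_eq_square)
      then show ?thesis unfolding partial_deriv_def by (simp only: deriv_quadratic_perturbation)
    qed
    moreover have "F z = 0" by (simp add: F z)
    ultimately show False using assms that by (auto simp: nonsingular_cubic_form_def)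
  qed
  then show ?thesis using trilinear_form_axioms F by blast
qed

definition cvec :: "real ^ 4 \<Rightarrow> complex ^ 4" where "cvec v = (\<chi> i. complex_of_real (v $ i))"

lemma cvec_add: "cvec (v + w) = cvec v + cvec w"
  and cvec_scale: "cvec (r *\<^sub>R v) = of_real r *s cvec v"
  by (simp_all add: cvec_def vec_eq_iff)

lemma combination_in_complexification:
  assumes "subspace L" "v \<in> L" "w \<in> L"
  shows "\<alpha> *s cvec v + \<beta> *s cvec w \<in> complexification L"
proof -
  have "(\<chi> k. Re ((\<alpha> *s cvec v + \<beta> *s cvec w) $ k)) = Re \<alpha> *\<^sub>R v + Re \<beta> *\<^sub>R w"
    "(\<chi> k. Im ((\<alpha> *s cvec v + \<beta> *s cvec w) $ k)) = Im \<alpha> *\<^sub>R v + Im \<beta> *\<^sub>R w"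
    by (simp_all add: vec_eq_iff cvec_def)
  then show ?thesis using assms by (simp add: complexification_def subspace_add subspace_scale)
qed

lemma independent4_spans:
  assumes "independent4 a b c d"
  shows "\<exists>r s t u. v = r *\<^sub>R a + s *\<^sub>R b + t *\<^sub>R c + u *\<^sub>R d"
proof -
  obtain B B' :: "real ^ 4 ^ 4" where "B ** B' = mat 1"
    and B: "\<And>x. B *v x = x $ 1 *\<^sub>R a + x $ 2 *\<^sub>R b + x $ 3 *\<^sub>R c + x $ 4 *\<^sub>R d"
    using independent4_basis_matrix[OF assms] by metis
  then have "v = B *v (B' *v v)" by (simp only: matrix_vector_mul_assoc matrix_vector_mul_lid)
  then show ?thesis unfolding B by blast
qed

lemma (in trilinear_form) smooth_frame_cvec:
  assumes smooth: "\<And>z. z \<noteq> 0 \<Longrightarrow> \<exists>v. T z z v \<noteq> 0" and ind: "independent4 X1 X2 Y1 Y2"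
  shows "smooth_frame (cvec X1) (cvec X2) (cvec Y1) (cvec Y2)"
  unfolding smooth_frame_def
proof (intro allI impI)
  fix x1 x2 y1 y2 z
  assume z: "z = x1 *s cvec X1 + x2 *s cvec X2 + y1 *s cvec Y1 + y2 *s cvec Y2"
    and h: "T z z (cvec X1) = 0" "T z z (cvec X2) = 0" "T z z (cvec Y1) = 0" "T z z (cvec Y2) = 0"
  have real: "T z z (cvec v) = 0" for v
  proof -
    obtain r s t u where v: "v = r *\<^sub>R X1 + s *\<^sub>R X2 + t *\<^sub>R Y1 + u *\<^sub>R Y2" using independent4_spans[OF ind] by blast
    show ?thesis unfolding v by (simp add: cvec_add cvec_scale add3 scale3 h)
  qed
  have "T z z v = 0" for v
  proof -
    have "v = cvec (\<chi> i. Re (v $ i)) + \<i> *s cvec (\<chi> i. Im (v $ i))"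
      by (simp add: cvec_def vec_eq_iff complex_eq_iff)
    then have "T z z v = T z z (cvec (\<chi> i. Re (v $ i)) + \<i> *s cvec (\<chi> i. Im (v $ i)))" by simp
    also have "\<dots> = 0" by (simp add: add3 scale3 real)
    finally show ?thesis .
  qed
  then have z0: "z = 0" using smooth by blast
  have "Re x1 *\<^sub>R X1 + Re x2 *\<^sub>R X2 + Re y1 *\<^sub>R Y1 + Re y2 *\<^sub>R Y2 = (\<chi> i. Re (z $ i))"
    "Im x1 *\<^sub>R X1 + Im x2 *\<^sub>R X2 + Im y1 *\<^sub>R Y1 + Im y2 *\<^sub>R Y2 = (\<chi> i. Im (z $ i))"
    by (simp_all add: z vec_eq_iff cvec_def)
  then have "Re x1 *\<^sub>R X1 + Re x2 *\<^sub>R X2 + Re y1 *\<^sub>R Y1 + Re y2 *\<^sub>R Y2 = 0"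
    "Im x1 *\<^sub>R X1 + Im x2 *\<^sub>R X2 + Im y1 *\<^sub>R Y1 + Im y2 *\<^sub>R Y2 = 0"
    by (simp_all add: z0 vec_eq_iff)
  then have "Re x1 = 0 \<and> Re x2 = 0 \<and> Re y1 = 0 \<and> Re y2 = 0" "Im x1 = 0 \<and> Im x2 = 0 \<and> Im y1 = 0 \<and> Im y2 = 0"
    using ind unfolding independent4_def by blast+
  then show "x1 = 0 \<and> x2 = 0 \<and> y1 = 0 \<and> y2 = 0" by (simp add: complex_eq_iff)
qed

lemma proj_line_eq_span:
  assumes "proj_line N" "u \<in> N" "v \<in> N" "(u, v) \<in> frames"
  shows "N = span {u, v}"
proof -
  have "span {u, v} \<subseteq> N" using assms by (intro span_minimal) (auto simp: proj_line_def)
  moreover have "dim (span {u, v}) = dim N"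
    using proj_line_span_frame[OF assms(4)] assms(1) by (simp only: proj_line_def)
  ultimately show ?thesis
    using assms(1) subspace_dim_equal[of "span {u, v}" N] by (simp add: proj_line_def)
qed

lemma skew_lines_span:
  assumes "proj_line L" "proj_line M" "skew L M"
  shows "\<exists>x\<in>L. \<exists>y\<in>M. v = x + y"
proof -
  have sub: "subspace L" "subspace M" and d: "dim L = 2" "dim M = 2" using assms by (auto simp: proj_line_def)
  have "dim {x + y |x y. x \<in> L \<and> y \<in> M} + dim (L \<inter> M) = dim L + dim M"
    by (rule dim_sums_Int[OF sub])
  moreover have "dim (L \<inter> M) = 0" using assms(3) by (simp add: skew_def)
  ultimately have "dim {x + y |x y. x \<in> L \<and> y \<in> M} = DIM(real ^ 4)" using d by simp
  then have "span {x + y |x y. x \<in> L \<and> y \<in> M} = UNIV" by (rule dim_eq_full[THEN iffD1])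
  moreover have "span {x + y |x y. x \<in> L \<and> y \<in> M} = {x + y |x y. x \<in> L \<and> y \<in> M}"
    by (rule span_eq_iff[THEN iffD2, OF subspace_sums[OF sub]])
  ultimately have "v \<in> {x + y |x y. x \<in> L \<and> y \<in> M}" by simp
  then show ?thesis by blast
qed

definition line_frame where
  "line_frame M1 M2 M3 X1 X2 Y1 Y2 \<longleftrightarrow> independent4 X1 X2 Y1 Y2 \<and>
     X1 \<in> M1 \<and> X2 \<in> M1 \<and> Y1 \<in> M2 \<and> Y2 \<in> M2 \<and> X1 + Y1 \<in> M3 \<and> X2 + Y2 \<in> M3"

text \<open>
  The frame consists of the components, along the first two lines, of a basis of the third one.
\<close>

lemma ex_line_frame:
  assumes M: "proj_line M1" "proj_line M2" "proj_line M3" and sk: "skew M1 M2" "skew M1 M3" "skew M2 M3"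
  shows "\<exists>X1 X2 Y1 Y2. line_frame M1 M2 M3 X1 X2 Y1 Y2"
proof -
  have sub: "subspace M1" "subspace M2" "subspace M3" using M by (auto simp: proj_line_def)
  obtain g1 g2 where g: "(g1, g2) \<in> frames" "M3 = span {g1, g2}" using proj_line_imp_frame[OF M(3)] by blast
  obtain X1 Y1 where 1: "X1 \<in> M1" "Y1 \<in> M2" "g1 = X1 + Y1" using skew_lines_span[OF M(1,2) sk(1)] by blast
  obtain X2 Y2 where 2: "X2 \<in> M1" "Y2 \<in> M2" "g2 = X2 + Y2" using skew_lines_span[OF M(1,2) sk(1)] by blast
  have gi: "r = 0 \<and> s = 0" if "r *\<^sub>R g1 + s *\<^sub>R g2 = 0" for r s
  proof -
    have ne: "g1 \<noteq> g2" and ind: "independent {g1, g2}" using g by (auto simp: frames_def)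
    have "g2 \<noteq> 0" using dependent_zero[of "{g1, g2}"] ind by auto
    have "g1 \<notin> span {g2}" using ind ne by (simp add: independent_insert)
    have "r = 0"
    proof (rule ccontr)
      assume "r \<noteq> 0"
      have "r *\<^sub>R g1 = (- s) *\<^sub>R g2" using that by (simp add: eq_neg_iff_add_eq_0)
      then have "r *\<^sub>R g1 \<in> span {g2}" by (simp add: span_scale span_base span_neg)
      then show False using \<open>g1 \<notin> _\<close> \<open>r \<noteq> 0\<close> span_scale[of "r *\<^sub>R g1" "{g2}" "inverse r"] by simp
    qed
    then show ?thesis using that \<open>g2 \<noteq> 0\<close> by simp
  qed
  have g3: "r *\<^sub>R g1 + s *\<^sub>R g2 \<in> M3" for r s unfolding g(2) by (intro span_add span_scale span_base) auto
  have "independent4 X1 X2 Y1 Y2"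
    unfolding independent4_def
  proof (intro allI impI)
    fix r s t u assume z: "r *\<^sub>R X1 + s *\<^sub>R X2 + t *\<^sub>R Y1 + u *\<^sub>R Y2 = 0"
    have X: "p *\<^sub>R X1 + q *\<^sub>R X2 \<in> M1" and Y: "p *\<^sub>R Y1 + q *\<^sub>R Y2 \<in> M2" for p q
      using 1 2 sub by (simp_all add: subspace_add subspace_scale)
    have "r *\<^sub>R X1 + s *\<^sub>R X2 = - (t *\<^sub>R Y1 + u *\<^sub>R Y2)" using z by (simp only: eq_neg_iff_add_eq_0 add.assoc)
    then have "r *\<^sub>R X1 + s *\<^sub>R X2 \<in> M1 \<inter> M2" using X[of r s] subspace_neg[OF sub(2) Y[of t u]] by simp
    then have rX: "r *\<^sub>R X1 + s *\<^sub>R X2 = 0" using sk(1) unfolding skew_def by blast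
    then have tY: "t *\<^sub>R Y1 + u *\<^sub>R Y2 = 0" using z by (simp add: add.assoc)
    have "r *\<^sub>R g1 + s *\<^sub>R g2 = (r *\<^sub>R X1 + s *\<^sub>R X2) + (r *\<^sub>R Y1 + s *\<^sub>R Y2)"
      "t *\<^sub>R g1 + u *\<^sub>R g2 = (t *\<^sub>R X1 + u *\<^sub>R X2) + (t *\<^sub>R Y1 + u *\<^sub>R Y2)"
      by (simp_all add: 1 2 algebra_simps)
    then have "r *\<^sub>R g1 + s *\<^sub>R g2 \<in> M2 \<inter> M3" "t *\<^sub>R g1 + u *\<^sub>R g2 \<in> M1 \<inter> M3"
      using X Y g3[of r s] g3[of t u] rX tY by simp_all
    then have "r *\<^sub>R g1 + s *\<^sub>R g2 = 0" "t *\<^sub>R g1 + u *\<^sub>R g2 = 0" using sk(2,3) unfolding skew_def by blast+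
    then show "r = 0 \<and> s = 0 \<and> t = 0 \<and> u = 0" using gi by blast
  qed
  moreover have "g1 \<in> M3" "g2 \<in> M3" using g3[of 1 0] g3[of 0 1] by simp_all
  ultimately show ?thesis unfolding line_frame_def using 1 2 by blast
qed

lemma line_frame_change:
  assumes F: "line_frame M1 M2 M3 X1 X2 Y1 Y2" and sub: "subspace M1" "subspace M2" "subspace M3"
    and d: "p1 * q2 - p2 * q1 \<noteq> 0"
  shows "line_frame M1 M2 M3 (p1 *\<^sub>R X1 + p2 *\<^sub>R X2) (q1 *\<^sub>R X1 + q2 *\<^sub>R X2) (p1 *\<^sub>R Y1 + p2 *\<^sub>R Y2) (q1 *\<^sub>R Y1 + q2 *\<^sub>R Y2)"
proof -
  have "independent4 (p1 *\<^sub>R X1 + p2 *\<^sub>R X2) (q1 *\<^sub>R X1 + q2 *\<^sub>R X2) (p1 *\<^sub>R Y1 + p2 *\<^sub>R Y2) (q1 *\<^sub>R Y1 + q2 *\<^sub>R Y2)"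
    unfolding independent4_def
  proof (intro allI impI)
    fix r s t u
    assume "r *\<^sub>R (p1 *\<^sub>R X1 + p2 *\<^sub>R X2) + s *\<^sub>R (q1 *\<^sub>R X1 + q2 *\<^sub>R X2) + t *\<^sub>R (p1 *\<^sub>R Y1 + p2 *\<^sub>R Y2) + u *\<^sub>R (q1 *\<^sub>R Y1 + q2 *\<^sub>R Y2) = 0"
    then have "(p1 * r + q1 * s) *\<^sub>R X1 + (p2 * r + q2 * s) *\<^sub>R X2 + (p1 * t + q1 * u) *\<^sub>R Y1 + (p2 * t + q2 * u) *\<^sub>R Y2 = 0"
      by (simp add: algebra_simps)
    then have z: "p1 * r + q1 * s = 0" "p2 * r + q2 * s = 0" "p1 * t + q1 * u = 0" "p2 * t + q2 * u = 0"
      using F unfolding line_frame_def independent4_def by blast+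
    then show "r = 0 \<and> s = 0 \<and> t = 0 \<and> u = 0" using cramer_2[OF d] by blast
  qed
  moreover have "p *\<^sub>R X1 + q *\<^sub>R X2 + (p *\<^sub>R Y1 + q *\<^sub>R Y2) = p *\<^sub>R (X1 + Y1) + q *\<^sub>R (X2 + Y2)" for p q
    by (simp add: algebra_simps)
  ultimately show ?thesis using F sub by (simp add: line_frame_def subspace_add subspace_scale)
qed

definition graph_line :: "(real ^ 4) set \<Rightarrow> real ^ 4 \<Rightarrow> real ^ 4 \<Rightarrow> real ^ 4 \<Rightarrow> real ^ 4 \<Rightarrow>
    real \<Rightarrow> real \<Rightarrow> real \<Rightarrow> real \<Rightarrow> bool" where
  "graph_line N X1 X2 Y1 Y2 a b c d \<longleftrightarrow> X1 + a *\<^sub>R Y1 + c *\<^sub>R Y2 \<in> N \<and> X2 + b *\<^sub>R Y1 + d *\<^sub>R Y2 \<in> N"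

lemma independent4_frame_right:
  assumes "independent4 X1 X2 Y1 Y2" shows "(Y1, Y2) \<in> frames"
proof (rule frames_if_coefficients_zero)
  fix r s assume "r *\<^sub>R Y1 + s *\<^sub>R Y2 = 0"
  then have "0 *\<^sub>R X1 + 0 *\<^sub>R X2 + r *\<^sub>R Y1 + s *\<^sub>R Y2 = 0" by simp
  then show "r = 0 \<and> s = 0" using assms unfolding independent4_def by blast
qed

lemma graph_line_frame:
  assumes "independent4 X1 X2 Y1 Y2" shows "(X1 + a *\<^sub>R Y1 + c *\<^sub>R Y2, X2 + b *\<^sub>R Y1 + d *\<^sub>R Y2) \<in> frames"
proof (rule frames_if_coefficients_zero)
  fix r s assume "r *\<^sub>R (X1 + a *\<^sub>R Y1 + c *\<^sub>R Y2) + s *\<^sub>R (X2 + b *\<^sub>R Y1 + d *\<^sub>R Y2) = 0"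
  then have "r *\<^sub>R X1 + s *\<^sub>R X2 + (r * a + s * b) *\<^sub>R Y1 + (r * c + s * d) *\<^sub>R Y2 = 0" by (simp add: algebra_simps)
  then show "r = 0 \<and> s = 0" using assms unfolding independent4_def by blast
qed

lemma ex_graph_line:
  assumes F: "line_frame M1 M2 M3 X1 X2 Y1 Y2" and N: "proj_line N" "proj_line M2" "skew N M2"
  shows "\<exists>a b c d. graph_line N X1 X2 Y1 Y2 a b c d"
proof -
  have M2: "M2 = span {Y1, Y2}"
    using F independent4_frame_right by (intro proj_line_eq_span[OF N(2)]) (auto simp: line_frame_def)
  have "\<exists>a c. X + a *\<^sub>R Y1 + c *\<^sub>R Y2 \<in> N" for X
  proof -
    obtain x y where xy: "x \<in> N" "y \<in> M2" "X = x + y" using skew_lines_span[OF N] by blast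
    obtain r s where y: "y = r *\<^sub>R Y1 + s *\<^sub>R Y2" using xy(2) unfolding M2 span_2 by blast
    have "X + (- r) *\<^sub>R Y1 + (- s) *\<^sub>R Y2 = x" using xy(3) y by (simp add: algebra_simps)
    then show ?thesis using xy(1) by metis
  qed
  then show ?thesis unfolding graph_line_def by metis
qed

text \<open>
  A vector on which the two matrices agree gives a common point of the graphs.
\<close>

lemma graph_lines_skew:
  assumes ind: "independent4 X1 X2 Y1 Y2" and "subspace N" "subspace N'"
    and G: "graph_line N X1 X2 Y1 Y2 a b c d" "graph_line N' X1 X2 Y1 Y2 a' b' c' d'" and sk: "skew N N'"
  shows "(a - a') * (d - d') - (b - b') * (c - c') \<noteq> 0"
proof
  assume det: "(a - a') * (d - d') - (b - b') * (c - c') = 0"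
  have "\<exists>x y. (x \<noteq> 0 \<or> y \<noteq> 0) \<and> (a - a') * x + (b - b') * y = 0 \<and> (c - c') * x + (d - d') * y = 0"
  proof -
    consider "d - d' \<noteq> 0 \<or> c - c' \<noteq> 0" | "a - a' \<noteq> 0 \<or> b - b' \<noteq> 0" | "a - a' = 0" "b - b' = 0" "c - c' = 0" "d - d' = 0" by blast
    then show ?thesis
    proof cases
      case 1
      then show ?thesis using det by (intro exI[of _ "d - d'"] exI[of _ "- (c - c')"]) (auto simp: algebra_simps)
    next
      case 2
      then show ?thesis using det by (intro exI[of _ "- (b - b')"] exI[of _ "a - a'"]) (auto simp: algebra_simps)
    next
      case 3
      then show ?thesis by (intro exI[of _ 1] exI[of _ 0]) simp
    qed
  qed
  then obtain x y where xy: "x \<noteq> 0 \<or> y \<noteq> 0" "(a - a') * x + (b - b') * y = 0" "(c - c') * x + (d - d') * y = 0" by blast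
  have e: "a * x + b * y = a' * x + b' * y" "c * x + d * y = c' * x + d' * y" using xy(2,3) by (simp_all add: algebra_simps)
  define v where "v = x *\<^sub>R X1 + y *\<^sub>R X2 + (a * x + b * y) *\<^sub>R Y1 + (c * x + d * y) *\<^sub>R Y2"
  have "v = x *\<^sub>R (X1 + a *\<^sub>R Y1 + c *\<^sub>R Y2) + y *\<^sub>R (X2 + b *\<^sub>R Y1 + d *\<^sub>R Y2)"
    unfolding v_def by (simp add: algebra_simps)
  moreover have "v = x *\<^sub>R (X1 + a' *\<^sub>R Y1 + c' *\<^sub>R Y2) + y *\<^sub>R (X2 + b' *\<^sub>R Y1 + d' *\<^sub>R Y2)"
    unfolding v_def e by (simp add: algebra_simps)
  ultimately have "v \<in> N \<inter> N'"
    using G assms(2,3) unfolding graph_line_def by (metis IntI subspace_add subspace_scale)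
  then have "v = 0" using sk unfolding skew_def by blast
  then show False using ind xy(1) unfolding v_def independent4_def by blast
qed

section \<open>Deformation in the presence of two real transversals\<close>

definition real_slope_relation :: "real \<Rightarrow> real \<Rightarrow> real \<Rightarrow> real \<Rightarrow> real \<Rightarrow> real \<Rightarrow> real \<Rightarrow> bool" where
  "real_slope_relation \<gamma> \<kappa> u0 s w0 a1 a2 \<longleftrightarrow> \<kappa> * w0 = u0 * s \<and> \<kappa> + \<gamma> * u0 \<noteq> 0 \<and> \<kappa> + \<gamma> * s \<noteq> 0 \<and>
     \<kappa> - (u0 + s + \<gamma> * w0) + \<gamma> + 1 = 0 \<and> \<kappa> * a2 - (u0 + s + \<gamma> * w0) * a1 + \<gamma> * a1 * a2 + a1\<^sup>2 = 0"

text \<open>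
  The coefficients \<open>\<kappa>\<close> and \<open>\<gamma>\<close> solve linear equations with real coefficients.
\<close>

lemma slope_relation_real:
  assumes R: "slope_relation (of_real u0) (of_real s) (of_real w0) (of_real a1) (of_real a2)" and w0: "w0 \<noteq> 0" "w0 \<noteq> 1"
  shows "\<exists>\<gamma> \<kappa>. real_slope_relation \<gamma> \<kappa> u0 s w0 a1 a2"
proof -
  obtain g k :: complex where gk: "k * of_real w0 = of_real u0 * of_real s" "k + g * of_real u0 \<noteq> 0" "k + g * of_real s \<noteq> 0"
    "k - (of_real u0 + of_real s + g * of_real w0) + g + 1 = 0"
    "k * of_real a2 - (of_real u0 + of_real s + g * of_real w0) * of_real a1 + g * of_real a1 * of_real a2 + (of_real a1)\<^sup>2 = 0"
    using R unfolding slope_relation_def by blast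
  define \<kappa> \<gamma> where "\<kappa> = u0 * s / w0" and "\<gamma> = (u0 + s - 1 - \<kappa>) / (1 - w0)"
  have k: "k = of_real \<kappa>" using gk(1) w0 by (simp add: \<kappa>_def field_simps)
  have "g * (1 - of_real w0) = of_real (u0 + s - 1 - \<kappa>)" using gk(4) unfolding k by (simp add: algebra_simps)
  moreover have "(1 - of_real w0 :: complex) \<noteq> 0" using w0 by (metis eq_iff_diff_eq_0 of_real_eq_1_iff)
  ultimately have g: "g = of_real \<gamma>" by (simp add: \<gamma>_def field_simps)
  have c: "(of_real x :: complex) = of_real y \<longleftrightarrow> x = y" for x y by simp
  have "real_slope_relation \<gamma> \<kappa> u0 s w0 a1 a2"
    using gk unfolding k g of_real_mult[symmetric] of_real_add[symmetric] of_real_diff[symmetric] of_real_power[symmetric]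
      of_real_1[symmetric, where 'a = complex] of_real_0[symmetric, where 'a = complex] c real_slope_relation_def by simp
  then show ?thesis by blast
qed

text \<open>
  The lines \<open>M2\<close>, \<open>M1\<close>, \<open>M3\<close>, \<open>M4\<close> meet a transversal at infinity, \<open>0\<close>, \<open>1\<close> and \<open>a\<close>. These are their coordinates after the
  projective change \<open>x \<mapsto> 1 / (x - u0)\<close>, which moves \<open>u0\<close> to infinity.
\<close>

definition slopes :: "real \<Rightarrow> real \<Rightarrow> nat \<Rightarrow> real" where
  "slopes u0 a i = (if i = 0 then 0 else if i = 1 then 1 / (0 - u0) else if i = 2 then 1 / (1 - u0) else 1 / (a - u0))"

lemma less_4_cases: "i < 4 \<Longrightarrow> i = 0 \<or> i = 1 \<or> i = 2 \<or> i = (3::nat)"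
  by linarith

lemma slopes_inj:
  assumes "distinct [0, 1, a, u0]"
  shows "inj_on (slopes u0 a) {..<4}"
proof -
  have "distinct [0, 1 / (0 - u0), 1 / (1 - u0), 1 / (a - u0)]"
    using assms by (auto simp: divide_eq_eq eq_divide_eq)
  then show ?thesis
    by (intro inj_onI) (auto simp: slopes_def dest!: less_4_cases split: if_splits)
qed

lemma slopes_nonzero:
  assumes "distinct [0, 1, a, u0]" "s \<notin> {0, 1, a}" "i < 4"
  shows "(s - u0) * slopes u0 a i - 1 \<noteq> 0"
  using less_4_cases[OF assms(3)] assms(1,2) by (auto simp: slopes_def field_simps)

lemma slopes_quadratic:
  assumes R: "real_slope_relation \<gamma> \<kappa> u0 s w0 a1 a2" and d: "distinct [0, 1, a1, u0]" "distinct [0, 1, a2, w0]" and i: "i < 4"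
  shows "((s - u0) * slopes u0 a1 i - 1) * slopes w0 a2 i = (\<kappa> + \<gamma> * u0) * (slopes u0 a1 i)\<^sup>2 + \<gamma> * slopes u0 a1 i + 0"
proof -
  have r: "\<kappa> * w0 = u0 * s" "\<kappa> - (u0 + s + \<gamma> * w0) + \<gamma> + 1 = 0" 
     "\<kappa> * a2 - (u0 + s + \<gamma> * w0) * a1 + \<gamma> * a1 * a2 + a1\<^sup>2 = 0"
    using R by (auto simp: real_slope_relation_def)
  have key: "((s - u0) * (1 / (x - u0)) - 1) * (1 / (y - w0)) = (\<kappa> + \<gamma> * u0) * (1 / (x - u0))\<^sup>2 + \<gamma> * (1 / (x - u0)) + 0"
    if xy: "x \<noteq> u0" "y \<noteq> w0" and F: "\<kappa> * y - (u0 + s + \<gamma> * w0) * x + \<gamma> * x * y + x\<^sup>2 = 0" for x y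
  proof -
    define p q where "p = x - u0" and "q = y - w0"
    have pq: "p \<noteq> 0" "q \<noteq> 0" and x: "x = u0 + p" and y: "y = w0 + q" using xy by (auto simp: p_def q_def)
    have "(s - u0 - p) * p = (\<kappa> + \<gamma> * u0 + \<gamma> * p) * q"
      using F r(1) unfolding x y by (simp add: algebra_simps power2_eq_square)
    then show ?thesis using pq unfolding p_def[symmetric] q_def[symmetric] by (simp add: field_simps power2_eq_square)
  qed
  show ?thesis
    using less_4_cases[OF i] key[of 0 0] key[of 1 1] key[of a1 a2] r d by (auto simp: slopes_def)
qed

lemma frames_if_independent4:
  assumes "independent4 X1 X2 Y1 Y2"
  shows "(X1, X2) \<in> frames" "(Y1, Y2) \<in> frames"
  using independent4_frame_right[OF assms] graph_line_frame[OF assms, of 0 0 0 0] by simp_all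

text \<open>
  The basis of the axes is chosen so that the third line of the surface in the plane of \<open>L'\<close> and the first transversal, which meets the transversals at \<open>b1\<close> and
  \<open>c2\<close>, joins the points \<open>e2\<close> and \<open>e4\<close> at infinity. Then \<open>L'\<close> lies in the plane of the first axis and \<open>e4\<close>, and
  \<open>L\<close> in the plane of the second axis and \<open>e2\<close>.
\<close>

lemma coarse_deformation_lower_upper:
  assumes F: "line_frame M1 M2 M3 X1 X2 Y1 Y2"
    and M: "proj_line M1" "proj_line M2" "proj_line M3" "proj_line M4" "proj_line L" "proj_line L'"
    and A: "graph_line M4 X1 X2 Y1 Y2 a1 0 0 a2"
    and B: "graph_line L X1 X2 Y1 Y2 b1 0 \<beta> b2" and C: "graph_line L' X1 X2 Y1 Y2 c1 \<gamma> 0 c2"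
    and R: "real_slope_relation \<gamma>1 \<kappa>1 b1 c1 c2 a1 a2" "real_slope_relation \<gamma>2 \<kappa>2 c2 b2 b1 a2 a1"
    and d: "distinct [0, 1, a1, b1]" "distinct [0, 1, a2, c2]" "c1 \<notin> {0, 1, a1}" "b2 \<notin> {0, 1, a2}"
  shows "coarse_deformation_equivalent 5 {M1, M2, M3, M4, L'} {M1, M2, M3, M4, L}"
proof -
  have ind: "independent4 X1 X2 Y1 Y2" using F by (simp add: line_frame_def)
  define e1 e2 e3 e4 where "e1 = Y1" and "e2 = X1 + b1 *\<^sub>R Y1" and "e3 = Y2" and "e4 = X2 + c2 *\<^sub>R Y2"
  note e = e1_def e2_def e3_def e4_def
  interpret axis_pair e1 e2 e3 e4
  proof
    have "r = 0 \<and> s = 0 \<and> t = 0 \<and> u = 0" if "r *\<^sub>R e1 + s *\<^sub>R e2 + t *\<^sub>R e3 + u *\<^sub>R e4 = 0" for r s t u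
    proof -
      have "s *\<^sub>R X1 + u *\<^sub>R X2 + (r + s * b1) *\<^sub>R Y1 + (t + u * c2) *\<^sub>R Y2 = 0"
        using that by (simp add: e algebra_simps)
      then have "s = 0 \<and> u = 0 \<and> r + s * b1 = 0 \<and> t + u * c2 = 0" using ind unfolding independent4_def by blast
      then show ?thesis by auto
    qed
    then show "independent4 e1 e2 e3 e4" unfolding independent4_def by blast
  qed
  let ?u = "slopes b1 a1" and ?w = "slopes c2 a2"
  note frame = graph_line_frame[OF ind]
  have M1: "M1 = span {X1, X2}" and M2: "M2 = span {Y1, Y2}"
    using F frames_if_independent4[OF ind] by (simp_all only: line_frame_def proj_line_eq_span[OF M(1)] proj_line_eq_span[OF M(2)])
  have M3: "M3 = span {X1 + 1 *\<^sub>R Y1, X2 + 1 *\<^sub>R Y2}"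
    using F frame[of 1 0 0 1] by (intro proj_line_eq_span M) (auto simp: line_frame_def)
  have M4: "M4 = span {X1 + a1 *\<^sub>R Y1, X2 + a2 *\<^sub>R Y2}"
    using A frame[of a1 0 0 a2] by (intro proj_line_eq_span M) (auto simp: graph_line_def)
  have L: "L = span {X1 + b1 *\<^sub>R Y1 + \<beta> *\<^sub>R Y2, X2 + b2 *\<^sub>R Y2}"
    using B frame[of b1 \<beta> 0 b2] by (intro proj_line_eq_span M) (auto simp: graph_line_def)
  have L': "L' = span {X1 + c1 *\<^sub>R Y1, X2 + \<gamma> *\<^sub>R Y1 + c2 *\<^sub>R Y2}"
    using C frame[of c1 0 \<gamma> c2] by (intro proj_line_eq_span M) (auto simp: graph_line_def)
  have diag: "slope_line (1 / (x - b1)) (1 / (y - c2)) = span {X1 + x *\<^sub>R Y1, X2 + y *\<^sub>R Y2}"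
    if "x \<noteq> b1" "y \<noteq> c2" for x y
  proof -
    have "e1 + (1 / (x - b1)) *\<^sub>R e2 = (1 / (x - b1)) *\<^sub>R ((x - b1) *\<^sub>R e1 + e2)"
      "e3 + (1 / (y - c2)) *\<^sub>R e4 = (1 / (y - c2)) *\<^sub>R ((y - c2) *\<^sub>R e3 + e4)"
      using that by (simp_all add: scaleR_add_right)
    moreover have "(x - b1) *\<^sub>R e1 + e2 = X1 + x *\<^sub>R Y1" "(y - c2) *\<^sub>R e3 + e4 = X2 + y *\<^sub>R Y2"
      by (simp_all add: e algebra_simps)
    ultimately show ?thesis using that by (simp add: slope_line_def span_2_scale)
  qed
  have four: "f ` {..<4} = {f 1, f 0, f 2, f 3}" for f :: "nat \<Rightarrow> (real ^ 4) set"
  proof -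
    have "{..<4} = {1, 0, 2, 3::nat}" by auto
    then show ?thesis by simp
  qed
  have s0: "slope_line 0 0 = span {Y1, Y2}" unfolding slope_line_def by (simp add: e1_def e3_def)
  have "slope_line (?u 0) (?w 0) = M2" "slope_line (?u 1) (?w 1) = M1" "slope_line (?u 2) (?w 2) = M3" "slope_line (?u 3) (?w 3) = M4"
    unfolding M1 M2 M3 M4 using diag[of 0 0] diag[of 1 1] diag[of a1 a2] d
    by (simp_all add: slopes_def s0)
  then have X: "(\<lambda>i. slope_line (?u i) (?w i)) ` {..<4} = {M1, M2, M3, M4}"
    unfolding four by simp
  have "L' = span {(c1 - b1) *\<^sub>R e1 + 1 *\<^sub>R e2, e4 + (\<gamma> *\<^sub>R e1 + 0 *\<^sub>R e2)}"
    unfolding L' by (simp add: e algebra_simps)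
  moreover have "L = span {(b2 - c2) *\<^sub>R e3 + 1 *\<^sub>R e4, e2 + (\<beta> *\<^sub>R e3 + 0 *\<^sub>R e4)}"
    unfolding L by (simp add: e algebra_simps insert_commute)
  moreover have "coarse_deformation_equivalent 5
    (insert (span {(c1 - b1) *\<^sub>R e1 + 1 *\<^sub>R e2, e4 + (\<gamma> *\<^sub>R e1 + 0 *\<^sub>R e2)}) ((\<lambda>i. slope_line (?u i) (?w i)) ` {..<4}))
    (insert (span {(b2 - c2) *\<^sub>R e3 + 1 *\<^sub>R e4, e2 + (\<beta> *\<^sub>R e3 + 0 *\<^sub>R e4)}) ((\<lambda>i. slope_line (?u i) (?w i)) ` {..<4}))"
  proof (rule coarse_deformation_slopes)
    show "inj_on ?u {..<4}" "inj_on ?w {..<4}" using d by (auto intro!: slopes_inj)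
    show "((c1 - b1) * ?u i - 1) * ?w i = (\<kappa>1 + \<gamma>1 * b1) * (?u i)\<^sup>2 + \<gamma>1 * ?u i + 0" if "i < 4" for i
      by (rule slopes_quadratic[OF R(1) d(1,2) that])
    show "((b2 - c2) * ?w i - 1) * ?u i = (\<kappa>2 + \<gamma>2 * c2) * (?w i)\<^sup>2 + \<gamma>2 * ?w i + 0" if "i < 4" for i
      by (rule slopes_quadratic[OF R(2) d(2,1) that])
    show "(c1 - b1) * ?u i - 1 \<noteq> 0" if "i < 4" for i by (rule slopes_nonzero[OF d(1,3) that])
    show "(b2 - c2) * ?w i - 1 \<noteq> 0" if "i < 4" for i by (rule slopes_nonzero[OF d(2,4) that])
    show "(\<kappa>1 + \<gamma>1 * b1) * 1\<^sup>2 + \<gamma>1 * (c1 - b1) * 1 + 0 * (c1 - b1)\<^sup>2 \<noteq> 0"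
      using R(1) by (simp add: real_slope_relation_def algebra_simps)
    show "(\<kappa>2 + \<gamma>2 * c2) * 1\<^sup>2 + \<gamma>2 * (b2 - c2) * 1 + 0 * (b2 - c2)\<^sup>2 \<noteq> 0"
      using R(2) by (simp add: real_slope_relation_def algebra_simps)
  qed simp_all
  moreover have "{M1, M2, M3, M4, N} = insert N {M1, M2, M3, M4}" for N by auto
  ultimately show ?thesis unfolding X by simp
qed

section \<open>Eigenvectors of real matrices\<close>

lemma graph_line_change:
  assumes "subspace N" and G: "graph_line N X1 X2 Y1 Y2 a b c d"
    and "a * p1 + b * p2 = a' * p1 + c' * q1" "c * p1 + d * p2 = a' * p2 + c' * q2"
    and "a * q1 + b * q2 = b' * p1 + d' * q1" "c * q1 + d * q2 = b' * p2 + d' * q2"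
  shows "graph_line N (p1 *\<^sub>R X1 + p2 *\<^sub>R X2) (q1 *\<^sub>R X1 + q2 *\<^sub>R X2) (p1 *\<^sub>R Y1 + p2 *\<^sub>R Y2) (q1 *\<^sub>R Y1 + q2 *\<^sub>R Y2) a' b' c' d'"
proof -
  have "x *\<^sub>R (X1 + a *\<^sub>R Y1 + c *\<^sub>R Y2) + y *\<^sub>R (X2 + b *\<^sub>R Y1 + d *\<^sub>R Y2) \<in> N" for x y
    using assms(1) G by (simp add: graph_line_def subspace_add subspace_scale)
  moreover have "x *\<^sub>R (X1 + a *\<^sub>R Y1 + c *\<^sub>R Y2) + y *\<^sub>R (X2 + b *\<^sub>R Y1 + d *\<^sub>R Y2) =
      x *\<^sub>R X1 + y *\<^sub>R X2 + (a * x + b * y) *\<^sub>R Y1 + (c * x + d * y) *\<^sub>R Y2" for x y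
    by (simp add: algebra_simps)
  ultimately have "x *\<^sub>R X1 + y *\<^sub>R X2 + (a * x + b * y) *\<^sub>R Y1 + (c * x + d * y) *\<^sub>R Y2 \<in> N" for x y by metis
  from this[of p1 p2] this[of q1 q2] show ?thesis
    unfolding assms(3-6) graph_line_def by (simp_all add: algebra_simps)
qed

lemma real_eigenbasis:
  fixes a b c d :: real
  assumes "(a - d)\<^sup>2 + 4 * b * c > 0"
  shows "\<exists>p1 p2 q1 q2 a1 a2. p1 * q2 - p2 * q1 \<noteq> 0 \<and> a * p1 + b * p2 = a1 * p1 \<and> c * p1 + d * p2 = a1 * p2 \<and>
    a * q1 + b * q2 = a2 * q1 \<and> c * q1 + d * q2 = a2 * q2"
proof -
  define D where "D = sqrt ((a - d)\<^sup>2 + 4 * b * c)"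
  have D: "D * D = (a - d)\<^sup>2 + 4 * b * c" "D \<noteq> 0"
    using assms by (auto simp: D_def)
  define t t' where "t = (a + d + D) / 2" and "t' = (a + d - D) / 2"
  have char: "(t - a) * (t - d) = b * c" "(t' - a) * (t' - d) = b * c"
  proof -
    have "4 * ((t - a) * (t - d)) = D * D - (a - d)\<^sup>2" "4 * ((t' - a) * (t' - d)) = D * D - (a - d)\<^sup>2"
      by (simp_all add: t_def t'_def field_simps power2_eq_square)
    then show "(t - a) * (t - d) = b * c" "(t' - a) * (t' - d) = b * c" unfolding D by simp_all
  qed
  have tt': "t - t' = D" by (simp add: t_def t'_def field_simps)
  consider "b \<noteq> 0" | "c \<noteq> 0" | "b = 0" "c = 0" by blast
  then show ?thesis
  proof cases
    case 1
    have "b * (t' - a) - (t - a) * b \<noteq> 0" using 1 D(2) tt' by (simp add: algebra_simps)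
    then show ?thesis using char
      by (intro exI[of _ b] exI[of _ "t - a"] exI[of _ "t' - a"] exI[of _ t] exI[of _ t'])
        (simp add: algebra_simps)
  next
    case 2
    have "(t - d) * c - c * (t' - d) \<noteq> 0" using 2 D(2) tt' by (simp add: algebra_simps)
    then show ?thesis using char
      by (intro exI[of _ "t - d"] exI[of _ c] exI[of _ "t' - d"] exI[of _ t] exI[of _ t'])
        (simp add: algebra_simps)
  next
    case 3
    then show ?thesis
      by (intro exI[of _ 1] exI[of _ 0] exI[of _ a] exI[of _ d]) simp
  qed
qed

text \<open>
  A real matrix with nonreal eigenvalues is a rotation with scaling in the basis of \<open>(1, 0)\<close> and \<open>(q1, q2)\<close>.
\<close>

lemma real_rotation_basis:
  fixes a b c d :: real
  assumes "(a - d)\<^sup>2 + 4 * b * c < 0"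
  shows "\<exists>q1 q2 \<alpha> \<beta>. q2 \<noteq> 0 \<and> \<beta> \<noteq> 0 \<and> a = \<alpha> + \<beta> * q1 \<and> c = \<beta> * q2 \<and>
    a * q1 + b * q2 = - \<beta> + \<alpha> * q1 \<and> c * q1 + d * q2 = \<alpha> * q2"
proof -
  define D where "D = sqrt (- ((a - d)\<^sup>2 + 4 * b * c))"
  have D: "D * D = - ((a - d)\<^sup>2 + 4 * b * c)" "D \<noteq> 0" using assms by (auto simp: D_def)
  have c: "c \<noteq> 0" using assms by auto
  define \<alpha> \<beta> where "\<alpha> = (a + d) / 2" and "\<beta> = D / 2"
  define q1 q2 where "q1 = (a - \<alpha>) / \<beta>" and "q2 = c / \<beta>"
  have \<beta>: "\<beta> \<noteq> 0" using D by (simp add: \<beta>_def)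
  have "4 * (\<beta> * \<beta>) = D * D" by (simp add: \<beta>_def)
  moreover have "4 * ((a - \<alpha>) * (a - \<alpha>) + b * c) = (a - d)\<^sup>2 + 4 * b * c"
    by (simp add: \<alpha>_def field_simps power2_eq_square)
  ultimately have key: "(a - \<alpha>) * (a - \<alpha>) + b * c = - (\<beta> * \<beta>)" using D(1) by simp
  have "(a * q1 + b * q2 + \<beta> - \<alpha> * q1) * \<beta> = (a - \<alpha>) * (a - \<alpha>) + b * c + \<beta> * \<beta>"
    using \<beta> by (simp add: q1_def q2_def field_simps)
  then have one: "a * q1 + b * q2 = - \<beta> + \<alpha> * q1" using key \<beta> by simp
  have "(c * q1 + d * q2 - \<alpha> * q2) * \<beta> = c * (a + d - 2 * \<alpha>)"
    using \<beta> by (simp add: q1_def q2_def field_simps)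
  moreover have "a + d - 2 * \<alpha> = 0" by (simp add: \<alpha>_def)
  ultimately have "c * q1 + d * q2 = \<alpha> * q2" using \<beta> by simp
  with one show ?thesis using \<beta> c by (intro exI[of _ q1] exI[of _ q2] exI[of _ \<alpha>] exI[of _ \<beta>]) (simp add: q1_def q2_def)
qed

context trilinear_form begin

text \<open>
  The new basis vectors are complex conjugates, so the off-diagonal entries of a real matrix become conjugate: in this
  basis a triangular matrix is diagonal.
\<close>

lemma graph_conjugate_basis:
  fixes a b c d :: real
  assumes G: "graph_in_cubic X1 X2 Y1 Y2 a b c d"
  shows "graph_in_cubic (1 *s X1 + (- \<i>) *s X2) (1 *s X1 + \<i> *s X2) (1 *s Y1 + (- \<i>) *s Y2) (1 *s Y1 + \<i> *s Y2)
     (Complex ((a + d) / 2) ((c - b) / 2)) (Complex ((a - d) / 2) ((b + c) / 2))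
     (Complex ((a - d) / 2) (- ((b + c) / 2))) (Complex ((a + d) / 2) (- ((c - b) / 2)))"
  by (rule graph_change[OF G]) (simp_all add: complex_eq_iff field_simps)

text \<open>
  If the eigenvectors of \<open>A\<close> are not real, then \<open>B\<close> and \<open>C\<close> are triangular, hence diagonal, in the basis of these
  eigenvectors. All lines then meet both complex transversals, which is excluded by \<open>not_both_upper\<close>.
\<close>

lemma no_conjugate_eigenvectors:
  fixes \<alpha> \<beta> b11 b12 b21 b22 c11 c12 c21 c22 :: real
  assumes S: "cubic_frame X1 X2 Y1 Y2"
    and A: "graph_in_cubic X1 X2 Y1 Y2 \<alpha> (- \<beta>) \<beta> \<alpha>"
    and B: "graph_in_cubic X1 X2 Y1 Y2 b11 b12 b21 b22" and C: "graph_in_cubic X1 X2 Y1 Y2 c11 c12 c21 c22"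
    and \<beta>: "\<beta> \<noteq> 0"
    and dB: "b11 * b22 - b12 * b21 \<noteq> 0" "(b11 - 1) * (b22 - 1) - b12 * b21 \<noteq> 0"
      "(\<alpha> - b11) * (\<alpha> - b22) - (- \<beta> - b12) * (\<beta> - b21) \<noteq> 0"
    and dC: "c11 * c22 - c12 * c21 \<noteq> 0" "(c11 - 1) * (c22 - 1) - c12 * c21 \<noteq> 0"
      "(\<alpha> - c11) * (\<alpha> - c22) - (- \<beta> - c12) * (\<beta> - c21) \<noteq> 0"
    and dBC: "(b11 - c11) * (b22 - c22) - (b12 - c12) * (b21 - c21) \<noteq> 0"
  shows False
proof -
  let ?X1 = "1 *s X1 + (- \<i>) *s X2" and ?X2 = "1 *s X1 + \<i> *s X2" and ?Y1 = "1 *s Y1 + (- \<i>) *s Y2" and ?Y2 = "1 *s Y1 + \<i> *s Y2"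
  have zero: "Complex 0 0 = 0" by (simp add: complex_eq_iff)
  have S': "cubic_frame ?X1 ?X2 ?Y1 ?Y2" by (rule cubic_frame_change[OF S]) simp
  have A': "graph_in_cubic ?X1 ?X2 ?Y1 ?Y2 (Complex \<alpha> \<beta>) 0 0 (Complex \<alpha> (- \<beta>))"
    using graph_conjugate_basis[OF A] by (simp add: zero)
  have Sp: "split_frame ?X1 ?X2 ?Y1 ?Y2"
    by (rule split_frame_if_diagonal[OF S' A']) (use \<beta> in \<open>simp_all add: complex_eq_iff\<close>)
  have rot: "a = d \<and> b = - c \<and> graph_in_cubic ?X1 ?X2 ?Y1 ?Y2 (Complex a c) 0 0 (Complex a (- c))"
    if G: "graph_in_cubic X1 X2 Y1 Y2 a b c d" and dG: "a * d - b * c \<noteq> 0" "(a - 1) * (d - 1) - b * c \<noteq> 0"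
    for a b c d :: real
  proof -
    have "Complex ((a - d) / 2) ((b + c) / 2) = 0 \<or> Complex ((a - d) / 2) (- ((b + c) / 2)) = 0"
    proof (rule graph_triangular[OF S' _ _ graph_conjugate_basis[OF G]])
      show "T ?X1 ?X1 ?Y1 = 0" "T ?X2 ?X2 ?Y2 = 0" using Sp by (simp_all add: split_frame_def vanishes_def)
      have "Complex ((a + d) / 2) ((c - b) / 2) * Complex ((a + d) / 2) (- ((c - b) / 2))
          - Complex ((a - d) / 2) ((b + c) / 2) * Complex ((a - d) / 2) (- ((b + c) / 2)) = of_real (a * d - b * c)"
        by (simp add: complex_eq_iff field_simps)
      then show "Complex ((a + d) / 2) ((c - b) / 2) * Complex ((a + d) / 2) (- ((c - b) / 2))
          - Complex ((a - d) / 2) ((b + c) / 2) * Complex ((a - d) / 2) (- ((b + c) / 2)) \<noteq> 0"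
        using dG(1) by (simp only: of_real_eq_0_iff not_False_eq_True)
      have "(Complex ((a + d) / 2) ((c - b) / 2) - 1) * (Complex ((a + d) / 2) (- ((c - b) / 2)) - 1)
          - Complex ((a - d) / 2) ((b + c) / 2) * Complex ((a - d) / 2) (- ((b + c) / 2)) = of_real ((a - 1) * (d - 1) - b * c)"
        by (simp add: complex_eq_iff field_simps)
      then show "(Complex ((a + d) / 2) ((c - b) / 2) - 1) * (Complex ((a + d) / 2) (- ((c - b) / 2)) - 1)
          - Complex ((a - d) / 2) ((b + c) / 2) * Complex ((a - d) / 2) (- ((b + c) / 2)) \<noteq> 0"
        using dG(2) by (simp only: of_real_eq_0_iff not_False_eq_True)
    qed
    then have eq: "a = d" "b = - c" by (auto simp: complex_eq_iff)
    show ?thesis using graph_conjugate_basis[OF G] unfolding eq by (simp add: zero)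
  qed
  note B' = rot[OF B dB(1,2)] and C' = rot[OF C dC(1,2)]
  show False
  proof (rule not_both_upper[OF Sp A'])
    show "graph_in_cubic ?X1 ?X2 ?Y1 ?Y2 (Complex b11 b21) 0 0 (Complex b11 (- b21))" using B' by blast
    show "graph_in_cubic ?X1 ?X2 ?Y1 ?Y2 (Complex c11 c21) 0 0 (Complex c11 (- c21))" using C' by blast
    show "distinct [0, 1, Complex \<alpha> (- \<beta>), Complex b11 (- b21), Complex c11 (- c21)]"
      using B' C' \<beta> dB dC dBC by (auto simp: complex_eq_iff)
  qed
qed

end

section \<open>Six skew lines on a smooth cubic surface\<close>

text \<open>
  The lines \<open>L\<close> and \<open>L'\<close> are the ones to be removed.
\<close>

locale six_lines = trilinear_form +
  fixes M1 M2 M3 M4 L L'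
  assumes smooth: "z \<noteq> 0 \<Longrightarrow> \<exists>v. T z z v \<noteq> 0"
    and distinct_lines: "distinct [M1, M2, M3, M4, L, L']"
    and lines: "N \<in> {M1, M2, M3, M4, L, L'} \<Longrightarrow> proj_line N"
    and skew_lines: "pairwise skew {M1, M2, M3, M4, L, L'}"
    and on_cubic: "N \<in> {M1, M2, M3, M4, L, L'} \<Longrightarrow> v \<in> N \<Longrightarrow> w \<in> N \<Longrightarrow> vanishes (cvec v) (cvec w)"
begin

lemma six_subspace: "N \<in> {M1, M2, M3, M4, L, L'} \<Longrightarrow> subspace N"
  using lines by (simp add: proj_line_def)

lemma six_skew: "N \<in> {M1, M2, M3, M4, L, L'} \<Longrightarrow> N' \<in> {M1, M2, M3, M4, L, L'} \<Longrightarrow> N \<noteq> N' \<Longrightarrow> skew N N'"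
  using skew_lines unfolding pairwise_def by blast

lemma cubic_frame_cvec:
  assumes "line_frame M1 M2 M3 X1 X2 Y1 Y2"
  shows "cubic_frame (cvec X1) (cvec X2) (cvec Y1) (cvec Y2)"
  using assms smooth_frame_cvec[OF smooth] unfolding cubic_frame_def line_frame_def
  using on_cubic[of M1] on_cubic[of M2] on_cubic[of M3] by (simp add: cvec_add[symmetric])

lemma graph_in_cubic_cvec:
  assumes "N \<in> {M1, M2, M3, M4, L, L'}" "graph_line N X1 X2 Y1 Y2 a b c d"
  shows "graph_in_cubic (cvec X1) (cvec X2) (cvec Y1) (cvec Y2) a b c d"
  using on_cubic[OF assms(1)] assms(2) unfolding graph_in_cubic_def graph_line_def
  by (simp add: cvec_add[symmetric] cvec_scale[symmetric])

lemma ex_graph: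
  assumes "line_frame M1 M2 M3 X1 X2 Y1 Y2" "N \<in> {M4, L, L'}"
  shows "\<exists>a b c d. graph_line N X1 X2 Y1 Y2 a b c d"
proof -
  have N6: "N \<in> {M1, M2, M3, M4, L, L'}" using assms(2) by blast
  have M2: "M2 \<in> {M1, M2, M3, M4, L, L'}" by simp
  have "M2 \<notin> {M4, L, L'}" using distinct_lines by simp
  then have "N \<noteq> M2" using assms(2) by blast
  then show ?thesis by (rule ex_graph_line[OF assms(1) lines[OF N6] lines[OF M2] six_skew[OF N6 M2]])
qed

lemma graph_determinants:
  assumes F: "line_frame M1 M2 M3 X1 X2 Y1 Y2" and N: "N \<in> {M4, L, L'}" and G: "graph_line N X1 X2 Y1 Y2 a b c d"
  shows "a * d - b * c \<noteq> 0" "(a - 1) * (d - 1) - b * c \<noteq> 0"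
proof -
  have ind: "independent4 X1 X2 Y1 Y2" using F by (simp add: line_frame_def)
  have N6: "N \<in> {M1, M2, M3, M4, L, L'}" using N by blast
  have "graph_line M1 X1 X2 Y1 Y2 0 0 0 0" "graph_line M3 X1 X2 Y1 Y2 1 0 0 1"
    using F by (simp_all add: graph_line_def line_frame_def)
  moreover have "M1 \<notin> {M4, L, L'}" "M3 \<notin> {M4, L, L'}" using distinct_lines by simp_all
  then have "N \<noteq> M1" "N \<noteq> M3" using N by blast+
  then have "skew N M1" "skew N M3" using six_skew[OF N6, of M1] six_skew[OF N6, of M3] by simp_all
  ultimately show "a * d - b * c \<noteq> 0" "(a - 1) * (d - 1) - b * c \<noteq> 0"
    using graph_lines_skew[OF ind six_subspace[OF N6] six_subspace G, of M1 0 0 0 0] graph_lines_skew[OF ind six_subspace[OF N6] six_subspace G, of M3 1 0 0 1]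
    by simp_all
qed

lemma graph_difference_determinant:
  assumes F: "line_frame M1 M2 M3 X1 X2 Y1 Y2" and N: "N \<in> {M4, L, L'}" "N' \<in> {M4, L, L'}" "N \<noteq> N'"
    and G: "graph_line N X1 X2 Y1 Y2 a b c d" "graph_line N' X1 X2 Y1 Y2 a' b' c' d'"
  shows "(a - a') * (d - d') - (b - b') * (c - c') \<noteq> 0"
proof -
  have N6: "N \<in> {M1, M2, M3, M4, L, L'}" "N' \<in> {M1, M2, M3, M4, L, L'}" using N by blast+
  show ?thesis
    using F by (intro graph_lines_skew[OF _ six_subspace[OF N6(1)] six_subspace[OF N6(2)] G six_skew[OF N6 N(3)]]) (simp add: line_frame_def)
qed

lemma frame_change:
  assumes "line_frame M1 M2 M3 X1 X2 Y1 Y2" "p1 * q2 - p2 * q1 \<noteq> 0"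
  shows "line_frame M1 M2 M3 (p1 *\<^sub>R X1 + p2 *\<^sub>R X2) (q1 *\<^sub>R X1 + q2 *\<^sub>R X2) (p1 *\<^sub>R Y1 + p2 *\<^sub>R Y2) (q1 *\<^sub>R Y1 + q2 *\<^sub>R Y2)"
  by (rule line_frame_change[OF assms(1) _ _ _ assms(2)]; rule six_subspace; simp)

lemma frame_swap:
  assumes "line_frame M1 M2 M3 X1 X2 Y1 Y2"
  shows "line_frame M1 M2 M3 X2 X1 Y2 Y1"
  using frame_change[OF assms, of 0 0 1 1] by simp

lemma graph_line_swap:
  assumes "graph_line N X1 X2 Y1 Y2 a b c d" shows "graph_line N X2 X1 Y2 Y1 d c b a"
proof -
  have "X2 + d *\<^sub>R Y2 + b *\<^sub>R Y1 = X2 + b *\<^sub>R Y1 + d *\<^sub>R Y2" "X1 + c *\<^sub>R Y2 + a *\<^sub>R Y1 = X1 + a *\<^sub>R Y1 + c *\<^sub>R Y2"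
    by (simp_all add: algebra_simps)
  then show ?thesis using assms unfolding graph_line_def by (simp only:)
qed

lemma coarse_if_lower_upper:
  assumes F: "line_frame M1 M2 M3 X1 X2 Y1 Y2" and A: "graph_line M4 X1 X2 Y1 Y2 a1 0 0 a2"
    and B: "graph_line L X1 X2 Y1 Y2 b1 0 \<beta> b2" and C: "graph_line L' X1 X2 Y1 Y2 c1 \<gamma> 0 c2"
    and nz: "\<beta> \<noteq> 0" "\<gamma> \<noteq> 0"
  shows "coarse_deformation_equivalent 5 {M1, M2, M3, M4, L'} {M1, M2, M3, M4, L}"
proof -
  have dA: "a1 \<noteq> 0" "a2 \<noteq> 0" "a1 \<noteq> 1" "a2 \<noteq> 1" using graph_determinants[OF F _ A] by auto
  have dB: "b1 \<noteq> 0" "b2 \<noteq> 0" "b1 \<noteq> 1" "b2 \<noteq> 1" using graph_determinants[OF F _ B] by auto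
  have dC: "c1 \<noteq> 0" "c2 \<noteq> 0" "c1 \<noteq> 1" "c2 \<noteq> 1" using graph_determinants[OF F _ C] by auto
  have dAB: "a1 \<noteq> b1" "a2 \<noteq> b2" using graph_difference_determinant[OF F _ _ _ A B] distinct_lines by auto
  have dAC: "a1 \<noteq> c1" "a2 \<noteq> c2" using graph_difference_determinant[OF F _ _ _ A C] distinct_lines by auto
  note A' = graph_in_cubic_cvec[OF _ A] and B' = graph_in_cubic_cvec[OF _ B] and C' = graph_in_cubic_cvec[OF _ C]
  have A': "graph_in_cubic (cvec X1) (cvec X2) (cvec Y1) (cvec Y2) a1 0 0 a2"
    and B': "graph_in_cubic (cvec X1) (cvec X2) (cvec Y1) (cvec Y2) b1 0 \<beta> b2"
    and C': "graph_in_cubic (cvec X1) (cvec X2) (cvec Y1) (cvec Y2) c1 \<gamma> 0 c2"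
    using A' B' C' by simp_all
  have Sp: "split_frame (cvec X1) (cvec X2) (cvec Y1) (cvec Y2)"
    by (rule split_frame_if_diagonal[OF cubic_frame_cvec[OF F] A']) (use dA in simp_all)
  have d: "distinct [0, 1, complex_of_real a1, complex_of_real b1]" "distinct [0, 1, complex_of_real a2, complex_of_real c2]"
    using dA dB dC dAB dAC by auto
  have "slope_relation b1 c1 c2 a1 a2" "slope_relation c2 b2 b1 a2 a1"
    using lower_upper_relation[OF Sp A' B' C' _ _ _ _ d] nz dB dC by simp_all
  then obtain \<gamma>1 \<kappa>1 \<gamma>2 \<kappa>2 where R: "real_slope_relation \<gamma>1 \<kappa>1 b1 c1 c2 a1 a2" "real_slope_relation \<gamma>2 \<kappa>2 c2 b2 b1 a2 a1"
    using slope_relation_real dB dC by metis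
  show ?thesis
    by (rule coarse_deformation_lower_upper[OF F lines lines lines lines lines lines A B C R])
      (use dA dB dC dAB dAC in simp_all)
qed

text \<open>
  The matrices of \<open>L\<close> and \<open>L'\<close> are triangular, and \<open>not_both_upper\<close> in both orders of the basis leaves one lower and
  one upper triangular matrix, neither of them diagonal. Exchanging the basis vectors makes that of \<open>L\<close> the lower one.
\<close>

lemma coarse_if_diagonal:
  assumes F: "line_frame M1 M2 M3 X1 X2 Y1 Y2" and A: "graph_line M4 X1 X2 Y1 Y2 a1 0 0 a2"
  shows "coarse_deformation_equivalent 5 {M1, M2, M3, M4, L'} {M1, M2, M3, M4, L}"
proof -
  obtain b11 b12 b21 b22 where B: "graph_line L X1 X2 Y1 Y2 b11 b12 b21 b22" using ex_graph[OF F, of L] by blast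
  obtain c11 c12 c21 c22 where C: "graph_line L' X1 X2 Y1 Y2 c11 c12 c21 c22" using ex_graph[OF F, of L'] by blast
  have dA: "a1 \<noteq> 0" "a2 \<noteq> 0" "a1 \<noteq> 1" "a2 \<noteq> 1" using graph_determinants[OF F _ A] by auto
  have dB: "b11 * b22 - b12 * b21 \<noteq> 0" "(b11 - 1) * (b22 - 1) - b12 * b21 \<noteq> 0" using graph_determinants[OF F _ B] by auto
  have dC: "c11 * c22 - c12 * c21 \<noteq> 0" "(c11 - 1) * (c22 - 1) - c12 * c21 \<noteq> 0" using graph_determinants[OF F _ C] by auto
  have dAB: "(a1 - b11) * (a2 - b22) - (0 - b12) * (0 - b21) \<noteq> 0"
    using graph_difference_determinant[OF F _ _ _ A B] distinct_lines by auto
  have dAC: "(a1 - c11) * (a2 - c22) - (0 - c12) * (0 - c21) \<noteq> 0"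
    using graph_difference_determinant[OF F _ _ _ A C] distinct_lines by auto
  have dBC: "(b11 - c11) * (b22 - c22) - (b12 - c12) * (b21 - c21) \<noteq> 0"
    using graph_difference_determinant[OF F _ _ _ B C] distinct_lines by auto
  have A': "graph_in_cubic (cvec X1) (cvec X2) (cvec Y1) (cvec Y2) a1 0 0 a2"
    and B': "graph_in_cubic (cvec X1) (cvec X2) (cvec Y1) (cvec Y2) b11 b12 b21 b22"
    and C': "graph_in_cubic (cvec X1) (cvec X2) (cvec Y1) (cvec Y2) c11 c12 c21 c22"
    using graph_in_cubic_cvec[OF _ A] graph_in_cubic_cvec[OF _ B] graph_in_cubic_cvec[OF _ C] by simp_all
  note S = cubic_frame_cvec[OF F]
  have Sp: "split_frame (cvec X1) (cvec X2) (cvec Y1) (cvec Y2)"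
    by (rule split_frame_if_diagonal[OF S A']) (use dA in simp_all)
  have root: "T (cvec X1) (cvec X1) (cvec Y1) = 0" "T (cvec X2) (cvec X2) (cvec Y2) = 0"
    using Sp by (simp_all add: split_frame_def vanishes_def)
  have tri: "b = 0 \<or> c = 0" if G: "graph_in_cubic (cvec X1) (cvec X2) (cvec Y1) (cvec Y2) a b c d"
    and dG: "a * d - b * c \<noteq> 0" "(a - 1) * (d - 1) - b * c \<noteq> 0" for a b c d :: real
  proof -
    have "of_real a * of_real d - of_real b * of_real c = (of_real (a * d - b * c) :: complex)"
      "(of_real a - 1) * (of_real d - 1) - of_real b * of_real c = (of_real ((a - 1) * (d - 1) - b * c) :: complex)"
      by simp_all
    then have "complex_of_real b = 0 \<or> complex_of_real c = 0"
      using dG by (intro graph_triangular[OF S root G]) (simp_all only: of_real_eq_0_iff not_False_eq_True)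
    then show ?thesis by simp
  qed
  have triB: "b12 = 0 \<or> b21 = 0" and triC: "c12 = 0 \<or> c21 = 0" using tri[OF B' dB] tri[OF C' dC] by auto
  have not_upper: "\<not> (b21 = 0 \<and> c21 = 0)"
  proof
    assume z: "b21 = 0 \<and> c21 = 0"
    have "distinct [0, 1, complex_of_real a2, complex_of_real b22, complex_of_real c22]"
      using z dA dB dC dAB dAC dBC by auto
    then show False using not_both_upper[OF Sp A'] B' C' z by (metis of_real_0)
  qed
  have not_lower: "\<not> (b12 = 0 \<and> c12 = 0)"
  proof
    assume z: "b12 = 0 \<and> c12 = 0"
    have "distinct [0, 1, complex_of_real a1, complex_of_real b11, complex_of_real c11]"
      using z dA dB dC dAB dAC dBC by auto
    then show False
      using not_both_upper[OF split_frame_swap[OF Sp] graph_swap[OF A']] graph_swap[OF B'] graph_swap[OF C'] z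
      by (metis of_real_0)
  qed
  consider "b12 = 0" "c21 = 0" "b21 \<noteq> 0" "c12 \<noteq> 0" | "b21 = 0" "c12 = 0" "b12 \<noteq> 0" "c21 \<noteq> 0"
    using triB triC not_upper not_lower by blast
  then show ?thesis
  proof cases
    case 1
    then show ?thesis using coarse_if_lower_upper[OF F A] B C by simp
  next
    case 2
    then show ?thesis
      using coarse_if_lower_upper[OF frame_swap[OF F] graph_line_swap[OF A]] graph_line_swap[OF B] graph_line_swap[OF C] by simp
  qed
qed

theorem coarse_deformation_of_removals:
  "coarse_deformation_equivalent 5 {M1, M2, M3, M4, L'} {M1, M2, M3, M4, L}"
proof -
  have "\<exists>X1 X2 Y1 Y2. line_frame M1 M2 M3 X1 X2 Y1 Y2"
    by (rule ex_line_frame[OF lines lines lines six_skew six_skew six_skew]) (use distinct_lines in simp_all)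
  then obtain X1 X2 Y1 Y2 where F: "line_frame M1 M2 M3 X1 X2 Y1 Y2" by blast
  obtain a b c d where A: "graph_line M4 X1 X2 Y1 Y2 a b c d" using ex_graph[OF F, of M4] by blast
  have M4: "subspace M4" by (rule six_subspace) simp
  have dA: "a * d - b * c \<noteq> 0" "(a - 1) * (d - 1) - b * c \<noteq> 0" using graph_determinants[OF F _ A] by auto
  have "of_real a * of_real d - of_real b * of_real c = (of_real (a * d - b * c) :: complex)"
    "(of_real a - 1) * (of_real d - 1) - of_real b * of_real c = (of_real ((a - 1) * (d - 1) - b * c) :: complex)"
    by simp_all
  then have "(of_real a - of_real d)\<^sup>2 + 4 * of_real b * of_real c \<noteq> (0 :: complex)"
    using dA graph_in_cubic_cvec[OF _ A]
    by (intro graph_discriminant_nonzero[OF cubic_frame_cvec[OF F]]) (simp_all only: of_real_eq_0_iff not_False_eq_True insert_iff simp_thms)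
  moreover have "(of_real a - of_real d)\<^sup>2 + 4 * of_real b * of_real c = (of_real ((a - d)\<^sup>2 + 4 * b * c) :: complex)" by simp
  ultimately have "(a - d)\<^sup>2 + 4 * b * c \<noteq> 0" by (metis of_real_0)
  then consider "(a - d)\<^sup>2 + 4 * b * c > 0" | "(a - d)\<^sup>2 + 4 * b * c < 0" by linarith
  then show ?thesis
  proof cases
    case 1
    obtain p1 p2 q1 q2 a1 a2 where e: "p1 * q2 - p2 * q1 \<noteq> 0" "a * p1 + b * p2 = a1 * p1" "c * p1 + d * p2 = a1 * p2"
      "a * q1 + b * q2 = a2 * q1" "c * q1 + d * q2 = a2 * q2" using real_eigenbasis[OF 1] by blast
    have "graph_line M4 (p1 *\<^sub>R X1 + p2 *\<^sub>R X2) (q1 *\<^sub>R X1 + q2 *\<^sub>R X2) (p1 *\<^sub>R Y1 + p2 *\<^sub>R Y2) (q1 *\<^sub>R Y1 + q2 *\<^sub>R Y2) a1 0 0 a2"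
      by (rule graph_line_change[OF M4 A]) (simp_all add: e)
    then show ?thesis by (rule coarse_if_diagonal[OF frame_change[OF F e(1)]])
  next
    case 2
    obtain q1 q2 \<alpha> \<beta> where e: "q2 \<noteq> 0" "\<beta> \<noteq> 0" "a = \<alpha> + \<beta> * q1" "c = \<beta> * q2"
      "a * q1 + b * q2 = - \<beta> + \<alpha> * q1" "c * q1 + d * q2 = \<alpha> * q2" using real_rotation_basis[OF 2] by blast
    have F': "line_frame M1 M2 M3 (1 *\<^sub>R X1 + 0 *\<^sub>R X2) (q1 *\<^sub>R X1 + q2 *\<^sub>R X2) (1 *\<^sub>R Y1 + 0 *\<^sub>R Y2) (q1 *\<^sub>R Y1 + q2 *\<^sub>R Y2)"
      (is "line_frame _ _ _ ?X1 ?X2 ?Y1 ?Y2")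
      by (rule frame_change[OF F]) (use e in simp)
    have A': "graph_line M4 ?X1 ?X2 ?Y1 ?Y2 \<alpha> (- \<beta>) \<beta> \<alpha>"
      by (rule graph_line_change[OF M4 A]) (use e(3-6) in simp_all)
    obtain b11 b12 b21 b22 where B: "graph_line L ?X1 ?X2 ?Y1 ?Y2 b11 b12 b21 b22" using ex_graph[OF F', of L] by blast
    obtain c11 c12 c21 c22 where C: "graph_line L' ?X1 ?X2 ?Y1 ?Y2 c11 c12 c21 c22" using ex_graph[OF F', of L'] by blast
    have G: "graph_in_cubic (cvec ?X1) (cvec ?X2) (cvec ?Y1) (cvec ?Y2) \<alpha> (- \<beta>) \<beta> \<alpha>"
      "graph_in_cubic (cvec ?X1) (cvec ?X2) (cvec ?Y1) (cvec ?Y2) b11 b12 b21 b22"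
      "graph_in_cubic (cvec ?X1) (cvec ?X2) (cvec ?Y1) (cvec ?Y2) c11 c12 c21 c22"
      using graph_in_cubic_cvec[OF _ A'] graph_in_cubic_cvec[OF _ B] graph_in_cubic_cvec[OF _ C] by simp_all
    have ne: "M4 \<noteq> L" "M4 \<noteq> L'" "L \<noteq> L'" using distinct_lines by auto
    have False
      by (rule no_conjugate_eigenvectors[OF cubic_frame_cvec[OF F'] G e(2)
          graph_determinants[OF F' _ B] graph_difference_determinant[OF F' _ _ ne(1) A' B]
          graph_determinants[OF F' _ C] graph_difference_determinant[OF F' _ _ ne(2) A' C]
          graph_difference_determinant[OF F' _ _ ne(3) B C]]) simp_all
    then show ?thesis ..
  qed
qed

end

lemma coarse_deformation_equivalent_refl:
  assumes "A \<in> configurations n"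
  shows "coarse_deformation_equivalent n A A"
  using assms by (simp add: coarse_deformation_equivalent_def path_component_of_refl topspace_config_space)

theorem proposition3p1p1:
  fixes \<L> :: "(real ^ 4) set set"
  assumes "real_schlaefli_six \<L>"
  shows "\<forall>L\<in>\<L>. \<forall>L'\<in>\<L>. coarse_deformation_equivalent 5 (\<L> - {L}) (\<L> - {L'})"
proof (intro ballI)
  fix L L' assume L: "L \<in> \<L>" "L' \<in> \<L>"
  obtain F where conf: "\<L> \<in> configurations 6" and F: "nonsingular_cubic_form F"
    and zero: "\<And>L. L \<in> \<L> \<Longrightarrow> complexification L \<subseteq> {z. F z = 0}"
    using assms unfolding real_schlaefli_six_def by blast
  have fin: "finite \<L>" "card \<L> = 6" and pl: "\<And>L. L \<in> \<L> \<Longrightarrow> proj_line L" and sk: "pairwise skew \<L>"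
    using conf by (auto simp: configurations_def)
  show "coarse_deformation_equivalent 5 (\<L> - {L}) (\<L> - {L'})"
  proof (cases "L = L'")
    case True
    have "\<L> - {L'} \<in> configurations 5"
      using fin pl sk L by (auto simp: configurations_def card_Diff_singleton pairwise_def)
    then show ?thesis unfolding True by (rule coarse_deformation_equivalent_refl)
  next
    case False
    have "card (\<L> - {L, L'}) = 4" using fin L False by (simp add: card_Diff_subset)
    then obtain M1 M2 M3 M4 where M: "\<L> - {L, L'} = {M1, M2, M3, M4}" "distinct [M1, M2, M3, M4]"
    proof -
      obtain Ms where Ms: "set Ms = \<L> - {L, L'}" "distinct Ms"
        using finite_distinct_list[of "\<L> - {L, L'}"] fin(1) by auto
      have "length Ms = 4" using distinct_card[OF Ms(2)] Ms(1) \<open>card (\<L> - {L, L'}) = 4\<close> by simp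
      then obtain N1 N2 N3 N4 where "Ms = [N1, N2, N3, N4]"
        by (auto simp: length_Suc_conv numeral_eq_Suc)
      then show thesis using that[of N1 N2 N3 N4] Ms by simp
    qed
    have "\<L> = (\<L> - {L, L'}) \<union> {L, L'}" using L by blast
    then have six: "\<L> = {M1, M2, M3, M4, L, L'}" unfolding M(1) by (simp add: insert_commute)
    have LM: "L \<notin> {M1, M2, M3, M4}" "L' \<notin> {M1, M2, M3, M4}" unfolding M(1)[symmetric] by blast+
    then have d: "distinct [M1, M2, M3, M4, L, L']" using M(2) False by (simp add: eq_commute)
    obtain T where T: "trilinear_form T" "\<And>x. F x = T x x x" "\<And>z. z \<noteq> 0 \<Longrightarrow> \<exists>v. T z z v \<noteq> 0"
      using nonsingular_cubic_form_polarization[OF F] by blast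
    interpret trilinear_form T by (rule T(1))
    interpret six_lines T M1 M2 M3 M4 L L'
    proof
      show "\<exists>v. T z z v \<noteq> 0" if "z \<noteq> 0" for z by (rule T(3)[OF that])
      show "distinct [M1, M2, M3, M4, L, L']" by (rule d)
      show "proj_line N" if "N \<in> {M1, M2, M3, M4, L, L'}" for N using pl that unfolding six by blast
      show "pairwise skew {M1, M2, M3, M4, L, L'}" using sk unfolding six .
      show "vanishes (cvec v) (cvec w)" if N: "N \<in> {M1, M2, M3, M4, L, L'}" "v \<in> N" "w \<in> N" for N v w
      proof (rule vanishes_if_form_vanishes)
        fix \<alpha> \<beta>
        have "N \<in> \<L>" using N(1) six by blast
        then have "\<alpha> *s cvec v + \<beta> *s cvec w \<in> {z. F z = 0}"
          using combination_in_complexification[of N v w \<alpha> \<beta>] N(2,3) pl zero by (auto simp: proj_line_def)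
        then show "T (\<alpha> *s cvec v + \<beta> *s cvec w) (\<alpha> *s cvec v + \<beta> *s cvec w) (\<alpha> *s cvec v + \<beta> *s cvec w) = 0"
          by (simp add: T(2))
      qed
    qed
    have "\<L> - {L} = {M1, M2, M3, M4, L'}" "\<L> - {L'} = {M1, M2, M3, M4, L}"
      unfolding six using LM False by blast+
    then show ?thesis using coarse_deformation_of_removals by (simp only:)
  qed
qed

end
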